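(* Let $b>0$, and for real-valued $V\in L^1(\mathbb{R})$ let $W_V(b)=W_0(b)-V$ be the self-adjoint operator on $L^2(\mathbb{R})$ defined in the context. (i) If $V\in L^1(\mathbb{R})$ is real-valued with $\int_{\mathbb{R}}V\,dx>0$, then $W_V(b)$ has at least one eigenvalue below $2$. (ii) If $0\le\gamma<1/2$, then there is no (finite) constant $L_\gamma$ such that $$\sum_{j\ge 1}|\lambda_j-2|^{\gamma}\le\frac{L_\gamma}{b}\int_{\mathbb{R}}V(x)^{\gamma+1/2}\,dx$$ holds for all compactly supported $V\in L^1(\mathbb{R})$ with $V\ge 0$, where $\lambda_j\le 2$ denote the eigenvalues of $W_V(b)$ that are at most $2$, repeated with multiplicities. (iii) The conclusion of (ii) holds even under the assumption that $W_V(b)\ge -2$; that is, for $0\le\gamma<1/2$ there is no constant $L_\gamma$ such that the inequality in (ii) holds for all compactly supported $V\in L^1(\mathbb{R})$ with $V\ge 0$ and $W_V(b)\ge -2$.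
   Context: The Fourier transform is $\widehat\psi(k)=\int_{\mathbb{R}}e^{-2\pi i kx}\psi(x)\,dx$. For $b>0$, $W_0(b)$ is the self-adjoint operator on $L^2(\mathbb{R})$ acting in Fourier space as multiplication by $2\cosh(2\pi bk)$, with domain $\{\psi\in L^2(\mathbb{R}):\ 2\cosh(2\pi bk)\widehat\psi(k)\in L^2(\mathbb{R})\}$. Equivalently, $(W_0(b)\psi)(x)=\psi(x+ib)+\psi(x-ib)$ in terms of analytic continuation to a strip. Its spectrum is $[2,\infty)$ and its quadratic form is $$2\|\psi\|^2+\int_{\mathbb{R}}|2\sinh(\pi bk)\widehat\psi(k)|^2\,dk$$ with form domain $Q_b=\{\psi\in L^2(\mathbb{R}):\ 2\cosh(\pi bk)\widehat\psi(k)\in L^2(\mathbb{R})\}\subset H^1(\mathbb{R})$. For real-valued $V\in L^1(\mathbb{R})$, $W_V(b)=W_0(b)-V$ denotes the self-adjoint, lower semibounded operator associated with the closed quadratic form $$2\|\psi\|^2+\int_{\mathbb{R}}|2\sinh(\pi bk)\widehat\psi(k)|^2\,dk-\int_{\mathbb{R}}V(x)|\psi(x)|^2\,dx,\qquad \psi\in Q_b .$$ The spectrum of $W_V(b)$ consists of the essential spectrum $[2,\infty)$ and discrete eigenvalues of finite multiplicity below $2$. "$W_V(b)\ge -2$" means $\langle\psi,W_V(b)\psi\rangle\ge -2\|\psi\|^2$ in the sense of quadratic forms. Convention: $0^{\gamma}:=0$ also for $\gamma=0$ in the sum (a possible eigenvalue equal to $2$ contributes nothing), and likewise $V(x)^{\gamma+1/2}=0$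 where $V(x)=0$. *)

theory Defs
  imports "HOL-Analysis.Analysis"
begin

text \<open>
  Elements of \<open>L\<^sup>2(\<real>)\<close> are represented by Borel functions \<open>\<real> \<Rightarrow> \<complex>\<close>; two functions that agree
  almost everywhere represent the same element, so ``nonzero'' and ``linearly independent''
  below are understood modulo null sets.
\<close>

definition L2 :: "(real \<Rightarrow> complex) set" where
  "L2 = {f. f \<in> borel_measurable lborel \<and> integrable lborel (\<lambda>x. (cmod (f x))\<^sup>2)}"

definition L2_inner :: "(real \<Rightarrow> complex) \<Rightarrow> (real \<Rightarrow> complex) \<Rightarrow> complex" where
  "L2_inner f g = (LINT x|lborel. cnj (f x) * g x)"

definition L2_norm_sq :: "(real \<Rightarrow> complex) \<Rightarrow> real" where
  "L2_norm_sq f = (LINT x|lborel. (cmod (f x))\<^sup>2)"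

definition fourier_trunc :: "real \<Rightarrow> (real \<Rightarrow> complex) \<Rightarrow> real \<Rightarrow> complex" where
  "fourier_trunc R \<psi> k = (LINT x:{-R..R}|lborel. exp (- 2 * pi * \<i> * k * x) * \<psi> x)"

text \<open>
  For \<open>\<psi> \<in> L\<^sup>2\<close> the integral \<open>\<integral> e\<^sup>-\<^sup>2\<^sup>\<pi>\<^sup>i\<^sup>k\<^sup>x \<psi>(x) dx\<close> need not converge absolutely. As usual, the Fourier
  transform is the limit in \<open>L\<^sup>2\<close>, as \<open>R \<rightarrow> \<infinity>\<close>, of the integrals over \<open>[-R, R]\<close> (Plancherel);
  it is determined up to a null set, and the choice operator picks a representative.
\<close>

definition fourier :: "(real \<Rightarrow> complex) \<Rightarrow> real \<Rightarrow> complex" where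
  "fourier \<psi> = (SOME g. g \<in> L2 \<and>
     ((\<lambda>R. \<integral>\<^sup>+ k. ennreal ((cmod (fourier_trunc R \<psi> k - g k))\<^sup>2) \<partial>lborel) \<longlongrightarrow> 0) at_top)"

definition form_dom :: "real \<Rightarrow> (real \<Rightarrow> complex) set" where
  "form_dom b = {\<psi> \<in> L2. (\<lambda>k. of_real (2 * cosh (pi * b * k)) * fourier \<psi> k) \<in> L2}"

definition qform :: "real \<Rightarrow> (real \<Rightarrow> real) \<Rightarrow> (real \<Rightarrow> complex) \<Rightarrow> real" where
  "qform b V \<psi> =
     2 * L2_norm_sq \<psi>
     + (LINT k|lborel. (cmod (of_real (2 * sinh (pi * b * k)) * fourier \<psi> k))\<^sup>2)
     - (LINT x|lborel. V x * (cmod (\<psi> x))\<^sup>2)"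

text \<open>The sesquilinear form of \<open>qform\<close>, antilinear in the first argument.\<close>

definition sesq :: "real \<Rightarrow> (real \<Rightarrow> real) \<Rightarrow> (real \<Rightarrow> complex) \<Rightarrow> (real \<Rightarrow> complex) \<Rightarrow> complex" where
  "sesq b V \<phi> \<psi> =
     2 * L2_inner \<phi> \<psi>
     + L2_inner (\<lambda>k. of_real (2 * sinh (pi * b * k)) * fourier \<phi> k)
                (\<lambda>k. of_real (2 * sinh (pi * b * k)) * fourier \<psi> k)
     - (LINT x|lborel. of_real (V x) * (cnj (\<phi> x) * \<psi> x))"

lemma sesq_diag: "sesq b V \<psi> \<psi> = of_real (qform b V \<psi>)"
proof -
  have c: "cnj z * z = of_real ((cmod z)\<^sup>2)" for z
    by (metis complex_norm_square mult.commute)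
  have v: "of_real r * of_real ((cmod z)\<^sup>2) = (of_real (r * (cmod z)\<^sup>2) :: complex)" for r z
    by simp
  show ?thesis
    unfolding sesq_def qform_def L2_inner_def L2_norm_sq_def c v integral_complex_of_real
    by simp
qed

text \<open>
  The operator associated with the form (first representation theorem), given by its graph:
  \<open>\<psi>\<close> lies in the operator domain and is mapped to \<open>\<eta>\<close> iff \<open>\<psi>\<close> lies in the form domain and
  \<open>\<eta> \<in> L\<^sup>2\<close> represents the functional \<open>\<phi> \<mapsto> sesq b V \<phi> \<psi>\<close>.
\<close>

definition W :: "real \<Rightarrow> (real \<Rightarrow> real) \<Rightarrow> ((real \<Rightarrow> complex) \<times> (real \<Rightarrow> complex)) set" where
  "W b V = {(\<psi>, \<eta>). \<psi> \<in> form_dom b \<and> \<eta> \<in> L2 \<and>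
                     (\<forall>\<phi> \<in> form_dom b. sesq b V \<phi> \<psi> = L2_inner \<phi> \<eta>)}"

definition W_ge :: "real \<Rightarrow> (real \<Rightarrow> real) \<Rightarrow> real \<Rightarrow> bool" where
  "W_ge b V c \<longleftrightarrow> (\<forall>\<psi> \<in> form_dom b. qform b V \<psi> \<ge> c * L2_norm_sq \<psi>)"

definition eigenspace :: "real \<Rightarrow> (real \<Rightarrow> real) \<Rightarrow> real \<Rightarrow> (real \<Rightarrow> complex) set" where
  "eigenspace b V \<mu> = {\<psi>. (\<psi>, \<lambda>x. of_real \<mu> * \<psi> x) \<in> W b V}"

definition eigenvalue :: "real \<Rightarrow> (real \<Rightarrow> real) \<Rightarrow> real \<Rightarrow> bool" where
  "eigenvalue b V \<mu> \<longleftrightarrow> (\<exists>\<psi> \<in> eigenspace b V \<mu>. \<not> (AE x in lborel. \<psi> x = 0))"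

definition ae_independent :: "nat \<Rightarrow> (nat \<Rightarrow> real \<Rightarrow> complex) \<Rightarrow> bool" where
  "ae_independent n f \<longleftrightarrow>
     (\<forall>c :: nat \<Rightarrow> complex. (AE x in lborel. (\<Sum>i<n. c i * f i x) = 0) \<longrightarrow> (\<forall>i<n. c i = 0))"

text \<open>Complex dimension of the eigenspace modulo null sets.\<close>

definition multiplicity :: "real \<Rightarrow> (real \<Rightarrow> real) \<Rightarrow> real \<Rightarrow> ennreal" where
  "multiplicity b V \<mu> =
     Sup {of_nat n | n. \<exists>f. (\<forall>i<n. f i \<in> eigenspace b V \<mu>) \<and> ae_independent n f}"

text \<open>
  The sum of \<open>\<bar>\<lambda>\<^sub>j - 2\<bar>\<^sup>\<gamma>\<close> over the eigenvalues at most 2, repeated with multiplicities. Since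
  \<open>0 powr \<gamma> = 0\<close> also for \<open>\<gamma> = 0\<close> (and \<open>\<infinity> * 0 = 0\<close>), an eigenvalue 2 contributes nothing.
\<close>

definition eigenvalue_sum :: "real \<Rightarrow> (real \<Rightarrow> real) \<Rightarrow> real \<Rightarrow> ennreal" where
  "eigenvalue_sum b V \<gamma> =
     (\<integral>\<^sup>+ \<mu>. multiplicity b V \<mu> * ennreal (\<bar>\<mu> - 2\<bar> powr \<gamma>)
        \<partial>count_space {\<mu>. eigenvalue b V \<mu> \<and> \<mu> \<le> 2})"

definition admissible :: "(real \<Rightarrow> real) \<Rightarrow> bool" where
  "admissible V \<longleftrightarrow> integrable lborel V \<and> (AE x in lborel. 0 \<le> V x) \<and>
     (\<exists>K. compact K \<and> (AE x in lborel. x \<notin> K \<longrightarrow> V x = 0))"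

end

theory Submission
  imports Defs "HOL-Probability.Probability" "HOL-Complex_Analysis.Great_Picard"
begin

text \<open>
  The free operator has a resonance at its threshold 2: in Fourier space the form excess
  \<open>\<integral> \<bar>2 sinh (\<pi> b k) \<psi>^(k)\<bar>\<^sup>2 dk\<close> vanishes to second order at \<open>k = 0\<close>, as for the one-dimensional
  Laplacian. A function with \<open>\<psi>^ = 1 / (2 d)\<close> on \<open>[- d, d]\<close> has excess of order \<open>d\<close>, squared norm
  \<open>1 / (2 d)\<close>, and \<open>\<psi>(x) \<rightarrow> 1\<close> as \<open>d \<rightarrow> 0\<close>. Hence \<open>\<integral> V \<bar>\<psi>\<bar>\<^sup>2\<close> tends to \<open>\<integral> V\<close>, and if this is positive, the
  quadratic form falls below \<open>2 \<parallel>\<psi>\<parallel>\<^sup>2\<close> (\<open>eigenvalue_below_2\<close>). For the potential \<open>V = e\<close> on \<open>[0, 1]\<close> the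
  choice \<open>d = \<eta> e\<close>, with \<open>\<eta>\<close> depending on \<open>b\<close> only, even yields an eigenvalue at most \<open>2 - c e\<^sup>2\<close> for
  all \<open>e \<le> 1\<close> (\<open>well_eigenvalue\<close>). So the sum in (ii) and (iii) is at least of order \<open>e\<^sup>2\<^sup>\<gamma>\<close>, while
  \<open>\<integral> V\<^sup>\<gamma>\<^sup>+\<^sup>1\<^sup>/\<^sup>2 = e\<^sup>\<gamma>\<^sup>+\<^sup>1\<^sup>/\<^sup>2\<close>; for \<open>\<gamma> < 1/2\<close> no constant survives \<open>e \<rightarrow> 0\<close> (\<open>no_Lieb_Thirring_bound\<close>).
  These potentials satisfy \<open>W\<^sub>V(b) \<ge> - 2\<close>, so (iii), and with it (ii), follows.

  That a test function produces an eigenvalue (\<open>eigenvalue_from_test_function\<close>) is shown by the direct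
  method. In terms of \<open>g = \<psi>^\<close> the form domain is a weighted \<open>L\<^sup>2\<close> space with weight
  \<open>cosh (\<pi> b k)\<close>. Its elements are integrable (\<open>energy_L1_bound\<close>), and their inverse transforms
  are Lipschitz (\<open>ift_Lipschitz\<close>), with bounds in terms of the energy; so an integrable potential is form-bounded with small bound
  (\<open>pot_form_bounded\<close>), and along some subsequence of a bounded sequence the potential energy of
  differences tends to 0 (\<open>pot_compact\<close>). If \<open>2 - s\<close> is the infimum of the Rayleigh quotients, the form minus
  \<open>(2 - s) \<parallel>\<psi>\<parallel>\<^sup>2\<close> is nonnegative, and the parallelogram law turns a minimising sequence with this property
  into a Cauchy sequence, whose limit is a minimiser (\<open>shifted_form_zero_attained\<close>). The Euler--Lagrange equation of the
  minimiser is the eigenvalue equation (\<open>minimiser_exists\<close>).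

  Passing between \<open>\<psi>\<close> and \<open>\<psi>^\<close> requires the Fourier transform on \<open>L\<^sup>2\<close>. By Gaussian regularisation
  (\<open>ft_mult_gauss\<close>) the transform is an \<open>L\<^sup>2\<close> contraction on integrable functions in \<open>L\<^sup>2\<close> (\<open>ft_L2\<close>) and pairs
  correctly with indicators of intervals (\<open>ft_interval_pairing\<close>). The contraction property gives the extension to
  \<open>L\<^sup>2\<close>, and the pairing gives inversion (\<open>fourier_inversion\<close>), as functions are determined by their
  integrals over intervals. Two contractions whose composition is the reflection are isometries
  (\<open>Plancherel\<close>).
\<close>

section \<open>The space of square-integrable functions\<close>

lemma L2I_dominated:
  assumes "f \<in> borel_measurable borel" "integrable lborel h" "\<And>x. (cmod (f x))\<^sup>2 \<le> h x"
  shows "f \<in> L2"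
  unfolding L2_def
  using assms(1) by (auto intro!: Bochner_Integration.integrable_bound[OF assms(2)] AE_I2
      intro: order_trans[OF assms(3)] simp: order_trans[OF assms(3) abs_ge_self])

lemma L2_measurable [measurable_dest]: "f \<in> L2 \<Longrightarrow> f \<in> borel_measurable borel"
  by (simp add: L2_def)

lemma L2_integrable_sq: "f \<in> L2 \<Longrightarrow> integrable lborel (\<lambda>x. (cmod (f x))\<^sup>2)"
  by (simp add: L2_def)

lemma borel_measurable_cnj [measurable]:
  fixes f :: "'a \<Rightarrow> complex"
  shows "f \<in> borel_measurable M \<Longrightarrow> (\<lambda>x. cnj (f x)) \<in> borel_measurable M"
  by (rule measurable_compose[of f M borel cnj borel])
     (auto intro: borel_measurable_continuous_onI continuous_intros)

lemma L2_norm_sq_nonneg [simp]: "0 \<le> L2_norm_sq f"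
  by (simp add: L2_norm_sq_def)

lemma cmod_sq_add_le: "(cmod (a + b))\<^sup>2 \<le> 2 * (cmod a)\<^sup>2 + 2 * (cmod b)\<^sup>2"
proof -
  have "(cmod (a + b))\<^sup>2 \<le> (cmod a + cmod b)\<^sup>2"
    by (intro power_mono norm_triangle_ineq) auto
  also have "\<dots> \<le> 2 * (cmod a)\<^sup>2 + 2 * (cmod b)\<^sup>2"
    using sum_squares_bound[of "cmod a" "cmod b"] by (simp add: power2_sum)
  finally show ?thesis .
qed

lemma L2_lincomb:
  assumes "f \<in> L2" "g \<in> L2"
  shows "(\<lambda>x. f x + c * g x) \<in> L2"
proof (rule L2I_dominated)
  show "(\<lambda>x. f x + c * g x) \<in> borel_measurable borel"
    using assms[THEN L2_measurable] by measurable
  show "integrable lborel (\<lambda>x. 2 * (cmod (f x))\<^sup>2 + 2 * (cmod c)\<^sup>2 * (cmod (g x))\<^sup>2)"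
    using assms[THEN L2_integrable_sq] by auto
  show "(cmod (f x + c * g x))\<^sup>2 \<le> 2 * (cmod (f x))\<^sup>2 + 2 * (cmod c)\<^sup>2 * (cmod (g x))\<^sup>2" for x
    using cmod_sq_add_le[of "f x" "c * g x"] by (simp add: norm_mult power_mult_distrib)
qed

lemma L2_add: "f \<in> L2 \<Longrightarrow> g \<in> L2 \<Longrightarrow> (\<lambda>x. f x + g x) \<in> L2"
  using L2_lincomb[of f g 1] by simp

lemma L2_diff: "f \<in> L2 \<Longrightarrow> g \<in> L2 \<Longrightarrow> (\<lambda>x. f x - g x) \<in> L2"
  using L2_lincomb[of f g "-1"] by simp

lemma L2_zero: "(\<lambda>x. 0) \<in> L2"
  by (simp add: L2_def)

lemma L2_cmult: "f \<in> L2 \<Longrightarrow> (\<lambda>x. c * f x) \<in> L2"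
  using L2_lincomb[OF L2_zero, of f c] by simp

lemma L2_cong_AE:
  assumes "f \<in> L2" "g \<in> borel_measurable borel" "AE x in lborel. f x = g x"
  shows "g \<in> L2"
proof -
  have "integrable lborel (\<lambda>x. (cmod (g x))\<^sup>2) \<longleftrightarrow> integrable lborel (\<lambda>x. (cmod (f x))\<^sup>2)"
    using assms L2_measurable[OF assms(1)] by (intro integrable_cong_AE) auto
  then show ?thesis using assms L2_integrable_sq[OF assms(1)] by (simp add: L2_def)
qed

lemma L2_norm_sq_cong_AE:
  assumes "f \<in> borel_measurable borel" "g \<in> borel_measurable borel" "AE x in lborel. f x = g x"
  shows "L2_norm_sq f = L2_norm_sq g"
  unfolding L2_norm_sq_def using assms by (intro integral_cong_AE) auto

lemma L2_mult_bounded: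
  assumes "f \<in> L2" "m \<in> borel_measurable borel" "\<And>x. cmod (m x) \<le> C"
  shows "(\<lambda>x. m x * f x) \<in> L2" "L2_norm_sq (\<lambda>x. m x * f x) \<le> C\<^sup>2 * L2_norm_sq f"
proof -
  have b: "(cmod (m x * f x))\<^sup>2 \<le> C\<^sup>2 * (cmod (f x))\<^sup>2" for x
    by (simp add: norm_mult power_mult_distrib mult_right_mono power_mono assms(3))
  show *: "(\<lambda>x. m x * f x) \<in> L2"
    by (rule L2I_dominated[OF _ _ b]) (use assms L2_measurable[OF assms(1)] L2_integrable_sq[OF assms(1)] in auto)
  show "L2_norm_sq (\<lambda>x. m x * f x) \<le> C\<^sup>2 * L2_norm_sq f"
    unfolding L2_norm_sq_def
    by (subst integral_mult_right_zero[symmetric], intro integral_mono b L2_integrable_sq[OF *])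
       (use L2_integrable_sq[OF assms(1)] in auto)
qed

lemma L2_norm_sq_add_le:
  assumes "f \<in> L2" "g \<in> L2"
  shows "L2_norm_sq (\<lambda>x. f x + g x) \<le> 2 * L2_norm_sq f + 2 * L2_norm_sq g"
proof -
  have "L2_norm_sq (\<lambda>x. f x + g x) \<le> (LINT x|lborel. 2 * (cmod (f x))\<^sup>2 + 2 * (cmod (g x))\<^sup>2)"
    unfolding L2_norm_sq_def
    by (intro integral_mono cmod_sq_add_le L2_integrable_sq L2_add Bochner_Integration.integrable_add
        integrable_mult_right assms)
  also have "\<dots> = 2 * L2_norm_sq f + 2 * L2_norm_sq g"
    using assms[THEN L2_integrable_sq] by (simp add: L2_norm_sq_def)
  finally show ?thesis .
qed

lemma L2_norm_sq_minus: "L2_norm_sq (\<lambda>x. f x - g x) = L2_norm_sq (\<lambda>x. g x - f x)"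
  by (simp add: L2_norm_sq_def norm_minus_commute)

lemma L2_norm_sq_triangle:
  assumes "f \<in> L2" "g \<in> L2" "h \<in> L2"
  shows "L2_norm_sq (\<lambda>x. f x - h x)
    \<le> 2 * L2_norm_sq (\<lambda>x. f x - g x) + 2 * L2_norm_sq (\<lambda>x. g x - h x)"
  using L2_norm_sq_add_le[OF L2_diff[OF assms(1,2)] L2_diff[OF assms(2,3)]] by simp

lemma L2_norm_sq_eq_0:
  assumes "f \<in> L2" "L2_norm_sq f = 0"
  shows "AE x in lborel. f x = 0"
proof -
  have "AE x in lborel. (cmod (f x))\<^sup>2 = 0"
    using assms L2_integrable_sq[OF assms(1)]
    by (subst integral_nonneg_eq_0_iff_AE[symmetric]) (auto simp: L2_norm_sq_def)
  then show ?thesis by simp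
qed

lemma L2_mult_integrable:
  assumes "f \<in> L2" "g \<in> L2"
  shows "integrable lborel (\<lambda>x. f x * g x)"
proof (rule Bochner_Integration.integrable_bound)
  show "integrable lborel (\<lambda>x. (cmod (f x))\<^sup>2 + (cmod (g x))\<^sup>2)"
    using assms[THEN L2_integrable_sq] by auto
  show "(\<lambda>x. f x * g x) \<in> borel_measurable lborel"
    using assms[THEN L2_measurable] by simp
  have "cmod (f x * g x) \<le> (cmod (f x))\<^sup>2 + (cmod (g x))\<^sup>2" for x
  proof -
    have "2 * cmod (f x * g x) \<le> (cmod (f x))\<^sup>2 + (cmod (g x))\<^sup>2"
      using sum_squares_bound[of "cmod (f x)" "cmod (g x)"] by (simp add: norm_mult mult.assoc)
    then show ?thesis using norm_ge_zero[of "f x * g x"] by linarith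
  qed
  then show "AE x in lborel. norm (f x * g x) \<le> norm ((cmod (f x))\<^sup>2 + (cmod (g x))\<^sup>2)"
    by (intro AE_I2) (simp add: order_trans)
qed

lemma L2_cnj: "f \<in> L2 \<Longrightarrow> (\<lambda>x. cnj (f x)) \<in> L2"
  by (simp add: L2_def borel_measurable_cnj)

lemma L2_Cauchy_Schwarz:
  assumes "f \<in> L2" "g \<in> L2"
  shows "(LINT x|lborel. cmod (f x) * cmod (g x))\<^sup>2 \<le> L2_norm_sq f * L2_norm_sq g"
proof -
  have i: "integrable lborel (\<lambda>x. cmod (f x) * cmod (g x))"
    using integrable_norm[OF L2_mult_integrable[OF assms]] by (simp add: norm_mult)
  have "(\<integral>\<^sup>+ x. ennreal (cmod (f x)) * ennreal (cmod (g x)) \<partial>lborel)\<^sup>2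
      \<le> (\<integral>\<^sup>+ x. (ennreal (cmod (f x)))\<^sup>2 \<partial>lborel) * (\<integral>\<^sup>+ x. (ennreal (cmod (g x)))\<^sup>2 \<partial>lborel)"
    using assms[THEN L2_measurable] by (intro Cauchy_Schwarz_nn_integral) auto
  then show ?thesis
    using assms[THEN L2_integrable_sq] i
    by (simp add: ennreal_mult[symmetric] ennreal_power nn_integral_eq_integral L2_norm_sq_def
        ennreal_le_iff)
qed

lemma L2_mult_integral_bound:
  assumes "f \<in> L2" "g \<in> L2"
  shows "(cmod (LINT x|lborel. f x * g x))\<^sup>2 \<le> L2_norm_sq f * L2_norm_sq g"
proof -
  have "cmod (LINT x|lborel. f x * g x) \<le> (LINT x|lborel. cmod (f x) * cmod (g x))"
    using integral_norm_bound[of lborel "\<lambda>x. f x * g x"] by (simp add: norm_mult)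
  then show ?thesis
    using L2_Cauchy_Schwarz[OF assms] by (meson norm_ge_zero order_trans power_mono)
qed

lemma tendsto_0_of_sq_le:
  fixes f :: "'a \<Rightarrow> complex"
  assumes "\<And>n. (cmod (f n))\<^sup>2 \<le> u n" "(u \<longlongrightarrow> 0) F"
  shows "(f \<longlongrightarrow> 0) F"
proof -
  have "((\<lambda>n. (cmod (f n))\<^sup>2) \<longlongrightarrow> 0) F"
    by (rule tendsto_sandwich[OF _ _ tendsto_const assms(2)]) (use assms(1) in auto)
  from tendsto_real_sqrt[OF this] show ?thesis
    by (simp add: tendsto_norm_zero_iff)
qed

lemma L2_tendsto_mult_integral:
  assumes "\<And>n. u n \<in> L2" "f \<in> L2" "h \<in> L2"
    and "((\<lambda>n. L2_norm_sq (\<lambda>x. u n x - f x)) \<longlongrightarrow> 0) F"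
  shows "((\<lambda>n. LINT x|lborel. u n x * h x) \<longlongrightarrow> (LINT x|lborel. f x * h x)) F"
proof -
  have "((\<lambda>n. LINT x|lborel. (u n x - f x) * h x) \<longlongrightarrow> 0) F"
    by (rule tendsto_0_of_sq_le[OF L2_mult_integral_bound[OF L2_diff[OF assms(1,2)] assms(3)]])
       (use tendsto_mult_right[OF assms(4), of "L2_norm_sq h"] in simp)
  moreover have "(LINT x|lborel. (u n x - f x) * h x)
      = (LINT x|lborel. u n x * h x) - (LINT x|lborel. f x * h x)" for n
    unfolding left_diff_distrib
    by (intro Bochner_Integration.integral_diff L2_mult_integrable assms)
  ultimately show ?thesis
    by (simp add: LIM_zero_iff)
qed

lemma cnj_mult_self: "cnj z * z = of_real ((cmod z)\<^sup>2)"
  by (metis complex_norm_square mult.commute)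

text \<open>Testing the limit against itself turns a bound on the sequence into one on the limit.\<close>

lemma L2_norm_sq_limit_le:
  assumes "\<And>n. u n \<in> L2" "f \<in> L2" "((\<lambda>n. L2_norm_sq (\<lambda>x. u n x - f x)) \<longlongrightarrow> 0) F"
    and "\<And>n. L2_norm_sq (u n) \<le> C" "F \<noteq> bot"
  shows "L2_norm_sq f \<le> C"
proof -
  have N: "(LINT x|lborel. f x * cnj (f x)) = of_real (L2_norm_sq f)"
    unfolding L2_norm_sq_def mult.commute[of _ "cnj _"] cnj_mult_self
    by (rule integral_complex_of_real)
  have "((\<lambda>n. (cmod (LINT x|lborel. u n x * cnj (f x)))\<^sup>2) \<longlongrightarrow> (cmod (of_real (L2_norm_sq f)))\<^sup>2) F"
    unfolding N[symmetric]
    by (intro tendsto_intros L2_tendsto_mult_integral assms L2_cnj)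
  moreover have "(cmod (LINT x|lborel. u n x * cnj (f x)))\<^sup>2 \<le> C * L2_norm_sq f" for n
    using L2_mult_integral_bound[OF assms(1) L2_cnj[OF assms(2)], of n]
      mult_right_mono[OF assms(4)[of n] L2_norm_sq_nonneg[of f]]
    by (simp add: L2_norm_sq_def)
  ultimately have "(cmod (of_real (L2_norm_sq f)))\<^sup>2 \<le> C * L2_norm_sq f"
    by (intro tendsto_upperbound[OF _ _ assms(5)]) auto
  then have *: "L2_norm_sq f * L2_norm_sq f \<le> C * L2_norm_sq f"
    by (simp add: power2_eq_square norm_mult[symmetric] abs_mult[symmetric])
  have "\<exists>n. 0 \<le> C" using assms(4) L2_norm_sq_nonneg by (meson order_trans)
  then show ?thesis
    using * L2_norm_sq_nonneg[of f] by (cases "L2_norm_sq f = 0") auto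
qed

text \<open>Along a subsequence whose successive differences \<open>d\<^sub>k\<close> have squared norm at most \<open>4\<^sup>-\<^sup>k\<close>,
  the series of \<open>2\<^sup>k \<bar>d\<^sub>k\<bar>\<^sup>2\<close> has a finite integral. Hence almost everywhere \<open>\<bar>d\<^sub>k\<bar>\<^sup>2 \<le> 2\<^sup>-\<^sup>k\<close>
  for large \<open>k\<close>, so that the subsequence converges pointwise, and Fatou's lemma identifies the
  pointwise limit as the limit in the mean of the whole sequence.\<close>

lemma Riesz_Fischer:
  assumes u: "\<And>n. u n \<in> L2"
    and cauchy: "\<And>e. e > 0 \<Longrightarrow> \<exists>M. \<forall>m\<ge>M. \<forall>n\<ge>M. L2_norm_sq (\<lambda>x. u m x - u n x) < e"
  obtains f where "f \<in> L2" "(\<lambda>n. L2_norm_sq (\<lambda>x. u n x - f x)) \<longlonglongrightarrow> 0"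
proof -
  note [measurable] = u[THEN L2_measurable]
  have "\<forall>k. \<exists>M. \<forall>m\<ge>M. \<forall>n\<ge>M. L2_norm_sq (\<lambda>x. u m x - u n x) < (1/4)^k"
    using cauchy by simp
  then obtain M where M: "\<And>k m n. m \<ge> M k \<Longrightarrow> n \<ge> M k \<Longrightarrow> L2_norm_sq (\<lambda>x. u m x - u n x) < (1/4)^k"
    by metis
  \<comment> \<open>Partial sums make the indices increasing and at least \<open>M k\<close> at once.\<close>
  define r where "r k = (\<Sum>i\<le>k. M i) + k" for k
  have rM: "M k \<le> r k" for k
    unfolding r_def by (simp add: sum.remove[of "{..k}" k])
  have rS: "r k \<le> r (Suc k)" for k by (simp add: r_def)
  have rk: "k \<le> r k" for k by (simp add: r_def)
  define d where "d k x = u (r (Suc k)) x - u (r k) x" for k x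
  have [measurable]: "d k \<in> borel_measurable borel" for k unfolding d_def by measurable
  have dL: "d k \<in> L2" for k unfolding d_def by (intro L2_diff u)
  have dN: "L2_norm_sq (d k) \<le> (1/4)^k" for k
    using M[of k "r (Suc k)" "r k"] rM[of k] rS[of k] unfolding d_def by simp
  have nn: "(\<integral>\<^sup>+x. ennreal (2^k * (cmod (d k x))\<^sup>2) \<partial>lborel) \<le> ennreal ((1/2)^k)" for k
  proof -
    have "(\<integral>\<^sup>+x. ennreal (2^k * (cmod (d k x))\<^sup>2) \<partial>lborel) = ennreal (2^k * L2_norm_sq (d k))"
      using L2_integrable_sq[OF dL[of k]]
      by (subst nn_integral_eq_integral) (auto simp: L2_norm_sq_def)
    also have "\<dots> \<le> ennreal (2^k * (1/4)^k)"
      by (intro ennreal_leI mult_left_mono dN) auto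
    also have "(2^k * (1/4)^k :: real) = (1/2)^k"
      by (simp add: power_mult_distrib[symmetric])
    finally show ?thesis .
  qed
  have "(\<integral>\<^sup>+x. (\<Sum>k. ennreal (2^k * (cmod (d k x))\<^sup>2)) \<partial>lborel)
      = (\<Sum>k. \<integral>\<^sup>+x. ennreal (2^k * (cmod (d k x))\<^sup>2) \<partial>lborel)"
    by (rule nn_integral_suminf) measurable
  also have "\<dots> \<le> (\<Sum>k. ennreal ((1/2)^k))"
    by (intro suminf_le nn) auto
  also have "\<dots> = ennreal (\<Sum>k. (1/2)^k)"
    by (intro suminf_ennreal2) auto
  also have "\<dots> < \<infinity>" by simp
  finally have fin: "(\<integral>\<^sup>+x. (\<Sum>k. ennreal (2^k * (cmod (d k x))\<^sup>2)) \<partial>lborel) \<noteq> \<infinity>" by simp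
  have "AE x in lborel. (\<Sum>k. ennreal (2^k * (cmod (d k x))\<^sup>2)) \<noteq> \<infinity>"
    by (rule nn_integral_PInf_AE[OF _ fin]) measurable
  then have conv: "AE x in lborel. convergent (\<lambda>k. u (r k) x)"
  proof eventually_elim
    case (elim x)
    have s: "summable (\<lambda>k. 2^k * (cmod (d k x))\<^sup>2)"
      using elim by (intro summable_suminf_not_top) auto
    have "(\<lambda>k. 2^k * (cmod (d k x))\<^sup>2) \<longlonglongrightarrow> 0" by (rule summable_LIMSEQ_zero[OF s])
    then have "eventually (\<lambda>k. 2^k * (cmod (d k x))\<^sup>2 < 1) sequentially"
      by (rule order_tendstoD) simp
    then have ev: "eventually (\<lambda>k. norm (d k x) \<le> (sqrt (1/2))^k) sequentially"
    proof eventually_elim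
      case (elim k)
      have "(cmod (d k x))\<^sup>2 \<le> (1/2)^k"
        using elim by (simp add: field_simps power_divide)
      then have "sqrt ((cmod (d k x))\<^sup>2) \<le> sqrt ((1/2)^k)" by (rule real_sqrt_le_mono)
      then show ?case by (simp add: real_sqrt_power)
    qed
    have "summable (\<lambda>k. (sqrt (1/2))^k)"
      by (rule summable_geometric) (simp add: real_sqrt_divide)
    then have "summable (\<lambda>k. d k x)"
      by (rule summable_comparison_test_ev[OF ev])
    then have "convergent (\<lambda>n. (\<Sum>k<n. d k x))" by (simp add: summable_iff_convergent)
    then have "convergent (\<lambda>n. (\<Sum>k<n. d k x) + u (r 0) x)"
      by (intro convergent_add convergent_const)
    moreover have "(\<Sum>k<n. d k x) = u (r n) x - u (r 0) x" for n
      unfolding d_def by (rule sum_lessThan_telescope)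
    ultimately show ?case by simp
  qed
  define f where "f x = lim (\<lambda>k. u (r k) x)" for x
  have fm [measurable]: "f \<in> borel_measurable borel"
    unfolding f_def by measurable
  have lim: "AE x in lborel. (\<lambda>k. u (r k) x) \<longlonglongrightarrow> f x"
    using conv by eventually_elim (simp add: f_def convergent_LIMSEQ_iff)
  have bound: "(\<integral>\<^sup>+x. ennreal ((cmod (u n x - f x))\<^sup>2) \<partial>lborel) \<le> ennreal ((1/4)^j)"
    if n: "n \<ge> M j" for n j
  proof -
    have "(\<integral>\<^sup>+x. ennreal ((cmod (u n x - f x))\<^sup>2) \<partial>lborel)
        = (\<integral>\<^sup>+x. liminf (\<lambda>k. ennreal ((cmod (u n x - u (r k) x))\<^sup>2)) \<partial>lborel)"
    proof (rule nn_integral_cong_AE, use lim in eventually_elim)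
      case (elim x)
      have "(\<lambda>k. ennreal ((cmod (u n x - u (r k) x))\<^sup>2)) \<longlonglongrightarrow> ennreal ((cmod (u n x - f x))\<^sup>2)"
        using elim by (intro tendsto_intros)
      from lim_imp_Liminf[OF _ this] show ?case by simp
    qed
    also have "\<dots> \<le> liminf (\<lambda>k. \<integral>\<^sup>+x. ennreal ((cmod (u n x - u (r k) x))\<^sup>2) \<partial>lborel)"
      by (rule nn_integral_liminf) measurable
    also have "\<dots> \<le> ennreal ((1/4)^j)"
    proof (rule Liminf_le, simp)
      show "\<forall>\<^sub>F k in sequentially. (\<integral>\<^sup>+x. ennreal ((cmod (u n x - u (r k) x))\<^sup>2) \<partial>lborel) \<le> ennreal ((1/4)^j)"
        using eventually_ge_at_top[of "M j"]
      proof eventually_elim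
        case (elim k)
        have "r k \<ge> M j" using elim rk[of k] by simp
        then show ?case
          using M[OF n, of "r k"] L2_integrable_sq[OF L2_diff[OF u[of n] u[of "r k"]]]
          by (subst nn_integral_eq_integral) (auto intro!: ennreal_leI simp: L2_norm_sq_def)
      qed
    qed
    finally show ?thesis .
  qed
  have L: "(\<lambda>x. u n x - f x) \<in> L2" if "n \<ge> M 0" for n
    using bound[OF that] unfolding L2_def
    by (auto intro!: integrableI_bounded elim: order.strict_trans1[OF _ ennreal_one_less_top])
  have "(\<lambda>x. u (M 0) x - (u (M 0) x - f x)) \<in> L2"
    by (intro L2_diff u L) simp
  then have fL: "f \<in> L2" by simp
  have "(\<lambda>n. L2_norm_sq (\<lambda>x. u n x - f x)) \<longlonglongrightarrow> 0"
  proof (rule LIMSEQ_I)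
    fix e :: real assume "e > 0"
    then obtain j where j: "(1/4::real)^j < e" using real_arch_pow_inv[of e "1/4"] by auto
    have "norm (L2_norm_sq (\<lambda>x. u n x - f x) - 0) < e" if "n \<ge> M j" for n
      using bound[OF that] j L2_integrable_sq[OF L2_diff[OF u[of n] fL]]
      by (subst (asm) nn_integral_eq_integral) (auto simp: L2_norm_sq_def)
    then show "\<exists>N. \<forall>n\<ge>N. norm (L2_norm_sq (\<lambda>x. u n x - f x) - 0) < e" by blast
  qed
  with fL show thesis by (rule that)
qed

section \<open>The Fourier transform on integrable functions\<close>

definition ft :: "(real \<Rightarrow> complex) \<Rightarrow> real \<Rightarrow> complex" where
  "ft f k = (LINT x|lborel. exp (- 2 * pi * \<i> * k * x) * f x)"

lemma cmod_character [simp]: "cmod (exp (- (2 * complex_of_real pi * \<i> * of_real k * of_real x))) = 1"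
  by (simp add: norm_exp_eq_Re)

lemma integrable_character_mult:
  assumes "integrable lborel f"
  shows "integrable lborel (\<lambda>x. exp (- 2 * complex_of_real pi * \<i> * of_real k * of_real x) * f x)"
  by (rule Bochner_Integration.integrable_bound[OF assms])
     (use assms in \<open>auto simp: norm_mult\<close>)

lemma ft_measurable:
  assumes [measurable]: "f \<in> borel_measurable borel"
  shows "ft f \<in> borel_measurable borel"
  unfolding ft_def by measurable

lemma ft_lincomb:
  assumes "integrable lborel f" "integrable lborel g"
  shows "ft (\<lambda>x. f x + c * g x) k = ft f k + c * ft g k"
  using integrable_character_mult[OF assms(1), of k] integrable_character_mult[OF assms(2), of k]
  by (simp add: ft_def distrib_left mult.left_commute[of _ c])

lemma ft_diff:
  assumes "integrable lborel f" "integrable lborel g"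
  shows "ft (\<lambda>x. f x - g x) k = ft f k - ft g k"
  using ft_lincomb[OF assms, of "-1" k] by simp

lemma ft_bound:
  assumes "integrable lborel f"
  shows "cmod (ft f k) \<le> (LINT x|lborel. cmod (f x))"
  unfolding ft_def
  using integral_norm_bound[of lborel "\<lambda>x. exp (- 2 * complex_of_real pi * \<i> * of_real k * of_real x) * f x"]
  by (simp add: norm_mult)

lemma ft_cong_AE:
  assumes "f \<in> borel_measurable borel" "g \<in> borel_measurable borel" "AE x in lborel. f x = g x"
  shows "ft f = ft g"
  unfolding ft_def using assms by (intro ext integral_cong_AE) auto

lemma lborel_integral_uminus: 
  fixes f :: "real \<Rightarrow> 'a :: {banach, second_countable_topology}"
  shows "(LINT x|lborel. f (- x)) = (LINT x|lborel. f x)"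
  using lborel_integral_real_affine[of "-1" f 0] by simp

lemma lborel_integrable_uminus:
  fixes f :: "real \<Rightarrow> 'a :: {banach, second_countable_topology}"
  shows "integrable lborel (\<lambda>x. f (- x)) \<longleftrightarrow> integrable lborel f"
  using lborel_integrable_real_affine_iff[of "-1" f 0] by simp

lemma ft_uminus: "ft (\<lambda>x. f (- x)) k = ft f (- k)"
  unfolding ft_def
  by (subst lborel_integral_uminus[symmetric]) simp

text \<open>The Fourier kernel is symmetric in \<open>k\<close> and \<open>x\<close>, so Fubini's theorem moves the transform from
  one factor to the other.\<close>

lemma ft_mult_integral:
  assumes u: "integrable lborel u" and v: "integrable lborel v"
  shows "(LINT k|lborel. ft u k * v k) = (LINT x|lborel. u x * ft v x)"
proof -
  note [measurable] = borel_measurable_integrable[OF u] borel_measurable_integrable[OF v]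
  let ?E = "\<lambda>k x. exp (- 2 * complex_of_real pi * \<i> * of_real k * of_real x)"
  have int: "integrable (lborel \<Otimes>\<^sub>M lborel) (case_prod (\<lambda>k x. ?E k x * u x * v k))"
  proof (rule lborel_pair.Fubini_integrable)
    show "case_prod (\<lambda>k x. ?E k x * u x * v k) \<in> borel_measurable (lborel \<Otimes>\<^sub>M lborel)"
      by measurable
    show "integrable lborel (\<lambda>k. LINT x|lborel. norm (case (k, x) of (k, x) \<Rightarrow> ?E k x * u x * v k))"
      using integrable_norm[OF v] by (simp add: norm_mult)
    show "AE k in lborel. integrable lborel (\<lambda>x. case (k, x) of (k, x) \<Rightarrow> ?E k x * u x * v k)"
      using integrable_character_mult[OF u] by simp
  qed
  have "(LINT k|lborel. ft u k * v k) = (LINT k|lborel. LINT x|lborel. ?E k x * u x * v k)"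
    by (simp add: ft_def)
  also have "\<dots> = (LINT x|lborel. LINT k|lborel. ?E k x * u x * v k)"
    using lborel_pair.Fubini_integral[OF int] by simp
  also have "\<dots> = (LINT x|lborel. u x * ft v x)"
    unfolding ft_def integral_mult_right_zero[symmetric] by (simp add: mult_ac)
  finally show ?thesis .
qed

subsection \<open>Gaussian regularisation\<close>

text \<open>The Fourier transform of \<open>\<lambda>k. exp (- (d * k)\<^sup>2 / 2)\<close>: a centred normal density of width
  \<open>d / (2\<pi>)\<close>, and thus an approximate identity as \<open>d \<rightarrow> 0\<close>.\<close>

definition gauss_kernel :: "real \<Rightarrow> real \<Rightarrow> real" where
  "gauss_kernel d u = (2 * pi / d) * std_normal_density (2 * pi / d * u)"

lemma gauss_kernel_nonneg: "d > 0 \<Longrightarrow> 0 \<le> gauss_kernel d u"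
  by (simp add: gauss_kernel_def std_normal_density_def)

lemma gauss_kernel_measurable [measurable]: "gauss_kernel d \<in> borel_measurable borel"
  unfolding gauss_kernel_def by measurable

lemma std_normal_integral: "integrable lborel std_normal_density" "(LINT x|lborel. std_normal_density x) = 1"
  using integrable_normal_moment[of 1 0 0] integral_std_normal_moment_even[of 0] by (auto)

lemma gauss_kernel_integral:
  assumes "d > 0"
  shows "(\<integral>\<^sup>+u. ennreal (gauss_kernel d (x + u)) \<partial>lborel) = 1"
proof -
  define c where "c = 2 * pi / d"
  have c: "c > 0" using assms by (simp add: c_def)
  have e: "gauss_kernel d (x + u) = c * std_normal_density (c * x + c * u)" for u
    by (simp add: gauss_kernel_def distrib_left c_def)
  have "(\<integral>\<^sup>+u. ennreal (gauss_kernel d (x + u)) \<partial>lborel)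
     = ennreal c * (\<integral>\<^sup>+u. ennreal (std_normal_density (c * x + c * u)) \<partial>lborel)"
    unfolding e using c by (subst nn_integral_cmult[symmetric]) (simp_all add: ennreal_mult')
  also have "\<dots> = (\<integral>\<^sup>+u. ennreal (std_normal_density u) \<partial>lborel)"
    using c by (subst nn_integral_real_affine[of "\<lambda>u. ennreal (std_normal_density u)" c "c * x"]) auto
  also have "\<dots> = 1"
    using std_normal_integral by (subst nn_integral_eq_integral) (auto simp: std_normal_density_def)
  finally show ?thesis .
qed

lemma ft_gauss:
  assumes d: "d > 0"
  shows "integrable lborel (\<lambda>k. complex_of_real (exp (- (d * k)\<^sup>2 / 2)))"
    and "ft (\<lambda>k. of_real (exp (- (d * k)\<^sup>2 / 2))) u = of_real (gauss_kernel d u)"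
proof -
  let ?w = "\<lambda>k. complex_of_real (exp (- (d * k)\<^sup>2 / 2))"
  have w: "?w k = of_real (sqrt (2 * pi) * std_normal_density (0 + d * k))" for k
    by (simp add: std_normal_density_def)
  have "integrable lborel (\<lambda>k. std_normal_density (0 + d * k))"
    by (rule lborel_integrable_real_affine[OF std_normal_integral(1)]) (use d in simp)
  then show "integrable lborel ?w"
    unfolding w by (intro integrable_of_real integrable_mult_right)
  let ?t = "- (2 * pi * u / d)"
  have "char std_normal_distribution ?t = of_real (exp (- (?t\<^sup>2) / 2))"
    by (simp only: char_std_normal_distribution)
  then have ch: "(LINT s|lborel. std_normal_density s *\<^sub>R iexp (?t * s)) = of_real (exp (- (?t\<^sup>2) / 2))"
    unfolding char_def by (subst (asm) integral_density) (auto simp: std_normal_density_def)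
  have "ft ?w u = (LINT k|lborel. exp (- 2 * pi * \<i> * u * k) * ?w k)"
    by (simp add: ft_def)
  also have "\<dots> = of_real (sqrt (2 * pi)) * (LINT k|lborel. std_normal_density (0 + d * k) *\<^sub>R iexp (?t * (0 + d * k)))"
    unfolding w integral_mult_right_zero[symmetric] using d
    by (intro Bochner_Integration.integral_cong) (auto simp: scaleR_conv_of_real field_simps)
  also have "\<dots> = of_real (sqrt (2 * pi)) * (of_real (1 / d) * of_real (exp (- (?t\<^sup>2) / 2)))"
    using d lborel_integral_real_affine[of d "\<lambda>s. std_normal_density s *\<^sub>R iexp (?t * s)" 0] ch
    by (simp add: scaleR_conv_of_real field_simps)
  also have "\<dots> = of_real (gauss_kernel d u)"
  proof -
    have "sqrt (2 * pi) * (1 / d * exp (- (?t\<^sup>2) / 2)) = gauss_kernel d u"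
      using d real_sqrt_pow2[of "2*pi"] by (simp add: gauss_kernel_def std_normal_density_def field_simps
          power2_eq_square)
    then show ?thesis by (metis of_real_mult)
  qed
  finally show "ft ?w u = of_real (gauss_kernel d u)" .
qed

text \<open>Applying the multiplication formula twice moves both transforms onto the Gaussian. This is
  the regularised form of \<open>\<integral> ft f k * ft h k \<partial>k = \<integral> f x * h (- x) \<partial>x\<close>.\<close>

lemma ft_mult_gauss:
  assumes f: "integrable lborel f" and h: "integrable lborel h" and d: "d > 0"
  shows "(LINT k|lborel. ft f k * (ft h k * of_real (exp (- (d * k)\<^sup>2 / 2))))
    = (LINT x|lborel. f x * (LINT y|lborel. h y * of_real (gauss_kernel d (x + y))))"
proof -
  note [measurable] = borel_measurable_integrable[OF f] borel_measurable_integrable[OF h]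
  let ?w = "\<lambda>k. complex_of_real (exp (- (d * k)\<^sup>2 / 2))"
  have hw: "integrable lborel (\<lambda>k. ft h k * ?w k)"
  proof (rule Bochner_Integration.integrable_bound)
    show "integrable lborel (\<lambda>k. of_real (LINT x|lborel. cmod (h x)) * ?w k)"
      by (intro integrable_mult_right ft_gauss d)
    show "(\<lambda>k. ft h k * ?w k) \<in> borel_measurable lborel"
      using ft_measurable[of h] by measurable
    show "AE k in lborel. norm (ft h k * ?w k) \<le> norm (of_real (LINT x|lborel. cmod (h x)) * ?w k)"
      using ft_bound[OF h] by (auto simp: norm_mult intro!: AE_I2 mult_right_mono order_trans[OF ft_bound[OF h]])
  qed
  have in_eq: "ft (\<lambda>k. ft h k * ?w k) x = (LINT y|lborel. h y * of_real (gauss_kernel d (x + y)))" for x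
  proof -
    have "ft (\<lambda>k. ft h k * ?w k) x
        = (LINT k|lborel. ft h k * (exp (- 2 * complex_of_real pi * \<i> * of_real x * of_real k) * ?w k))"
      by (simp add: ft_def mult_ac)
    also have "\<dots> = (LINT y|lborel. h y * ft (\<lambda>k. exp (- 2 * complex_of_real pi * \<i> * of_real x * of_real k) * ?w k) y)"
      by (rule ft_mult_integral[OF h integrable_character_mult[OF ft_gauss(1)[OF d]]])
    also have "(\<lambda>y. ft (\<lambda>k. exp (- 2 * complex_of_real pi * \<i> * of_real x * of_real k) * ?w k) y)
        = (\<lambda>y. ft ?w (x + y))"
      unfolding ft_def mult.assoc[symmetric] mult_exp_exp
      by (simp add: algebra_simps)
    finally show ?thesis by (simp only: ft_gauss(2)[OF d])
  qed
  show ?thesis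
    using ft_mult_integral[OF f hw] unfolding in_eq .
qed

text \<open>Split the product by \<open>2 u v \<le> u\<^sup>2 + v\<^sup>2\<close>; in either term the variable that no longer occurs
  outside the kernel is integrated out, and the kernel has total mass 1.\<close>

lemma nn_integral_gauss_form_le:
  fixes u v :: "real \<Rightarrow> real"
  assumes [measurable]: "u \<in> borel_measurable borel" "v \<in> borel_measurable borel"
    and nonneg: "\<And>x. 0 \<le> u x" "\<And>x. 0 \<le> v x" and d: "d > 0"
  shows "(\<integral>\<^sup>+x. (\<integral>\<^sup>+y. ennreal (u x * v y * gauss_kernel d (x + y)) \<partial>lborel) \<partial>lborel)
    \<le> (\<integral>\<^sup>+x. ennreal ((u x)\<^sup>2 / 2) \<partial>lborel) + (\<integral>\<^sup>+y. ennreal ((v y)\<^sup>2 / 2) \<partial>lborel)"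
proof -
  note G = gauss_kernel_nonneg[OF d] gauss_kernel_integral[OF d]
  have "(\<integral>\<^sup>+x. (\<integral>\<^sup>+y. ennreal (u x * v y * gauss_kernel d (x + y)) \<partial>lborel) \<partial>lborel)
    \<le> (\<integral>\<^sup>+x. (\<integral>\<^sup>+y. ennreal ((u x)\<^sup>2 / 2) * ennreal (gauss_kernel d (x + y))
          + ennreal ((v y)\<^sup>2 / 2) * ennreal (gauss_kernel d (y + x)) \<partial>lborel) \<partial>lborel)"
  proof (intro nn_integral_mono)
    fix x y
    have "u x * v y \<le> (u x)\<^sup>2 / 2 + (v y)\<^sup>2 / 2"
      using sum_squares_bound[of "u x" "v y"] by simp
    from mult_right_mono[OF this G(1)[of "x + y"]]
    have "u x * v y * gauss_kernel d (x + y)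
        \<le> (u x)\<^sup>2 / 2 * gauss_kernel d (x + y) + (v y)\<^sup>2 / 2 * gauss_kernel d (y + x)"
      unfolding add.commute[of y x] distrib_right .
    then have "ennreal (u x * v y * gauss_kernel d (x + y))
        \<le> ennreal ((u x)\<^sup>2 / 2 * gauss_kernel d (x + y) + (v y)\<^sup>2 / 2 * gauss_kernel d (y + x))"
      by (rule ennreal_leI)
    also have "\<dots> = ennreal ((u x)\<^sup>2 / 2) * ennreal (gauss_kernel d (x + y))
          + ennreal ((v y)\<^sup>2 / 2) * ennreal (gauss_kernel d (y + x))"
      using G(1) by (simp add: ennreal_mult'[symmetric] ennreal_plus[symmetric] del: ennreal_plus)
    finally show "ennreal (u x * v y * gauss_kernel d (x + y))
        \<le> ennreal ((u x)\<^sup>2 / 2) * ennreal (gauss_kernel d (x + y))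
          + ennreal ((v y)\<^sup>2 / 2) * ennreal (gauss_kernel d (y + x))" .
  qed
  moreover have "\<dots> = (\<integral>\<^sup>+x. ennreal ((u x)\<^sup>2 / 2) \<partial>lborel) + (\<integral>\<^sup>+y. ennreal ((v y)\<^sup>2 / 2) \<partial>lborel)"
  proof -
    have E: "(\<integral>\<^sup>+y. ennreal c * ennreal (gauss_kernel d (x + y)) \<partial>lborel) = ennreal c" for x c
      by (subst nn_integral_cmult) (simp_all add: G(2))
    have F: "(\<integral>\<^sup>+x. (\<integral>\<^sup>+y. ennreal ((v y)\<^sup>2 / 2) * ennreal (gauss_kernel d (y + x)) \<partial>lborel) \<partial>lborel)
        = (\<integral>\<^sup>+y. ennreal ((v y)\<^sup>2 / 2) \<partial>lborel)"
      using lborel_pair.Fubini'[of "\<lambda>x y. ennreal ((v y)\<^sup>2 / 2) * ennreal (gauss_kernel d (y + x))"]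
      by (simp add: E)
    show ?thesis
      by (simp add: nn_integral_add E F)
  qed
  ultimately show ?thesis by simp
qed

lemma cmod_integral_le_nn_integral:
  fixes f :: "real \<Rightarrow> complex"
  shows "ennreal (cmod (LINT x|lborel. f x)) \<le> (\<integral>\<^sup>+x. ennreal (cmod (f x)) \<partial>lborel)"
  using integral_norm_bound_ennreal[of lborel f]
  by (cases "integrable lborel f") (auto simp: not_integrable_integral_eq)

text \<open>The contraction half of Plancherel's theorem. For \<open>h y = cnj (f (- y))\<close> the regularised
  formula expresses the Gaussian-weighted integral of \<open>\<bar>ft f\<bar>\<^sup>2\<close> by a double integral that is at
  most the squared norm of \<open>f\<close>, and Fatou's lemma removes the weight. Equality follows later from
  inversion.\<close>

lemma ft_L2:
  assumes f1: "integrable lborel f" and f2: "f \<in> L2"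
  shows "ft f \<in> L2" "L2_norm_sq (ft f) \<le> L2_norm_sq f"
proof -
  note [measurable] = L2_measurable[OF f2] ft_measurable[OF L2_measurable[OF f2]]
  define h where "h y = cnj (f (- y))" for y
  have h1: "integrable lborel h"
    unfolding h_def using f1 by (intro integrable_cnj) (simp add: lborel_integrable_uminus)
  have [measurable]: "h \<in> borel_measurable borel" using borel_measurable_integrable[OF h1] by simp
  have fth: "ft h k = cnj (ft f k)" for k
  proof -
    have "cnj (ft f k) = (LINT x|lborel. exp (- 2 * complex_of_real pi * \<i> * of_real k * of_real (- x)) * cnj (f x))"
      unfolding ft_def
      using Bochner_Integration.integral_cnj[of lborel "\<lambda>x. exp (- 2 * complex_of_real pi * \<i> * of_real k * of_real x) * f x"]
      by (simp add: exp_cnj)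
    also have "\<dots> = ft h k"
      unfolding ft_def h_def by (subst lborel_integral_uminus[symmetric]) simp
    finally show ?thesis by simp
  qed
  have N: "L2_norm_sq h = L2_norm_sq f"
    using lborel_integral_uminus[of "\<lambda>x. (cmod (f x))\<^sup>2"] by (simp add: L2_norm_sq_def h_def)
  have "h \<in> L2"
    using L2_integrable_sq[OF f2] lborel_integrable_uminus[of "\<lambda>x. (cmod (f x))\<^sup>2"]
    by (simp add: L2_def h_def[symmetric]) (simp add: h_def)
  then have half: "(\<integral>\<^sup>+x. ennreal ((cmod (g x))\<^sup>2 / 2) \<partial>lborel) = ennreal (L2_norm_sq f / 2)"
    if "g = f \<or> g = h" for g
    using that N L2_integrable_sq[OF f2] L2_integrable_sq[of h]
    by (subst nn_integral_eq_integral) (auto simp: L2_norm_sq_def)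
  have bound: "(\<integral>\<^sup>+k. ennreal ((cmod (ft f k))\<^sup>2 * exp (- (d * k)\<^sup>2 / 2)) \<partial>lborel) \<le> ennreal (L2_norm_sq f)"
    if d: "d > 0" for d
  proof -
    note G = gauss_kernel_nonneg[OF d] gauss_kernel_integral[OF d]
    let ?w = "\<lambda>k. exp (- (d * k)\<^sup>2 / 2)"
    have int: "integrable lborel (\<lambda>k. (cmod (ft f k))\<^sup>2 * ?w k)"
    proof (rule Bochner_Integration.integrable_bound)
      show "integrable lborel (\<lambda>k. of_real ((LINT x|lborel. cmod (f x))\<^sup>2) * complex_of_real (?w k))"
        by (intro integrable_mult_right ft_gauss d)
      show "(\<lambda>k. (cmod (ft f k))\<^sup>2 * ?w k) \<in> borel_measurable lborel"
        by measurable
      show "AE k in lborel. norm ((cmod (ft f k))\<^sup>2 * ?w k) \<le> norm (of_real ((LINT x|lborel. cmod (f x))\<^sup>2) * complex_of_real (?w k))"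
        by (auto simp: norm_mult norm_power intro!: AE_I2 mult_right_mono power_mono ft_bound[OF f1])
    qed
    have "(LINT k|lborel. ft f k * (ft h k * of_real (?w k))) = (LINT k|lborel. of_real ((cmod (ft f k))\<^sup>2 * ?w k))"
      by (intro Bochner_Integration.integral_cong) (simp_all add: fth mult.assoc[symmetric] complex_norm_square[symmetric])
    then have eq: "(LINT k|lborel. ft f k * (ft h k * of_real (?w k))) = of_real (LINT k|lborel. (cmod (ft f k))\<^sup>2 * ?w k)"
      by (simp only: integral_complex_of_real)
    have "(\<integral>\<^sup>+k. ennreal ((cmod (ft f k))\<^sup>2 * ?w k) \<partial>lborel) = ennreal (LINT k|lborel. (cmod (ft f k))\<^sup>2 * ?w k)"
      by (rule nn_integral_eq_integral[OF int]) auto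
    also have "\<dots> \<le> ennreal (cmod (of_real (LINT k|lborel. (cmod (ft f k))\<^sup>2 * ?w k)))"
      by (intro ennreal_leI) simp
    also have "\<dots> = ennreal (cmod (LINT x|lborel. f x * (LINT y|lborel. h y * of_real (gauss_kernel d (x + y)))))"
      using eq ft_mult_gauss[OF f1 h1 d] by simp
    also have "\<dots> \<le> (\<integral>\<^sup>+x. ennreal (cmod (f x * (LINT y|lborel. h y * of_real (gauss_kernel d (x + y))))) \<partial>lborel)"
      by (rule cmod_integral_le_nn_integral)
    also have "\<dots> \<le> (\<integral>\<^sup>+x. (\<integral>\<^sup>+y. ennreal (cmod (f x) * cmod (h y) * gauss_kernel d (x + y)) \<partial>lborel) \<partial>lborel)"
    proof (intro nn_integral_mono)
      fix x
      have "ennreal (cmod (f x * (LINT y|lborel. h y * of_real (gauss_kernel d (x + y)))))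
          = ennreal (cmod (LINT y|lborel. f x * (h y * of_real (gauss_kernel d (x + y)))))"
        by simp
      also have "\<dots> \<le> (\<integral>\<^sup>+y. ennreal (cmod (f x * (h y * of_real (gauss_kernel d (x + y))))) \<partial>lborel)"
        by (rule cmod_integral_le_nn_integral)
      also have "\<dots> = (\<integral>\<^sup>+y. ennreal (cmod (f x) * cmod (h y) * gauss_kernel d (x + y)) \<partial>lborel)"
        by (simp add: norm_mult G(1) mult.assoc)
      finally show "ennreal (cmod (f x * (LINT y|lborel. h y * of_real (gauss_kernel d (x + y)))))
          \<le> (\<integral>\<^sup>+y. ennreal (cmod (f x) * cmod (h y) * gauss_kernel d (x + y)) \<partial>lborel)" .
    qed
    also have "\<dots> \<le> (\<integral>\<^sup>+x. ennreal ((cmod (f x))\<^sup>2 / 2) \<partial>lborel) + (\<integral>\<^sup>+y. ennreal ((cmod (h y))\<^sup>2 / 2) \<partial>lborel)"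
      by (rule nn_integral_gauss_form_le[OF _ _ _ _ d]) auto
    also have "\<dots> = ennreal (L2_norm_sq f / 2 + L2_norm_sq f / 2)"
      by (simp add: half flip: ennreal_plus)
    finally show ?thesis by simp
  qed
  have le: "(\<integral>\<^sup>+k. ennreal ((cmod (ft f k))\<^sup>2) \<partial>lborel) \<le> ennreal (L2_norm_sq f)"
  proof -
    have "(\<integral>\<^sup>+k. ennreal ((cmod (ft f k))\<^sup>2) \<partial>lborel)
        = (\<integral>\<^sup>+k. liminf (\<lambda>n. ennreal ((cmod (ft f k))\<^sup>2 * exp (- (inverse (real (Suc n)) * k)\<^sup>2 / 2))) \<partial>lborel)"
    proof (rule nn_integral_cong)
      fix k
      have "(\<lambda>n. ennreal ((cmod (ft f k))\<^sup>2 * exp (- (inverse (real (Suc n)) * k)\<^sup>2 / 2)))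
           \<longlonglongrightarrow> ennreal ((cmod (ft f k))\<^sup>2 * exp (- (0 * k)\<^sup>2 / 2))"
        by (intro tendsto_intros LIMSEQ_inverse_real_of_nat) auto
      from lim_imp_Liminf[OF _ this] show "ennreal ((cmod (ft f k))\<^sup>2)
         = liminf (\<lambda>n. ennreal ((cmod (ft f k))\<^sup>2 * exp (- (inverse (real (Suc n)) * k)\<^sup>2 / 2)))"
        by simp
    qed
    also have "\<dots> \<le> liminf (\<lambda>n. \<integral>\<^sup>+k. ennreal ((cmod (ft f k))\<^sup>2 * exp (- (inverse (real (Suc n)) * k)\<^sup>2 / 2)) \<partial>lborel)"
      by (rule nn_integral_liminf) measurable
    also have "\<dots> \<le> ennreal (L2_norm_sq f)"
      by (rule Liminf_le[OF _ always_eventually[OF allI[OF bound]]]) simp_all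
    finally show ?thesis .
  qed
  then show L: "ft f \<in> L2"
    unfolding L2_def by (auto intro!: integrableI_bounded elim: order.strict_trans1[OF _ ennreal_less_top])
  show "L2_norm_sq (ft f) \<le> L2_norm_sq f"
    using le L2_integrable_sq[OF L]
    by (subst (asm) nn_integral_eq_integral) (auto simp: L2_norm_sq_def)
qed

section \<open>The Fourier transform on \<open>L\<^sup>2\<close>\<close>

text \<open>The substitution \<open>y = - x + d s / (2\<pi>)\<close> turns the kernel into a fixed normal density and puts
  the dependence on \<open>d\<close> into the indicator, so that dominated convergence applies as \<open>d \<rightarrow> 0\<close>.\<close>

lemma gauss_interval_integral:
  assumes d: "d > 0"
  shows "(LINT y|lborel. indicator {p..q} y * complex_of_real (gauss_kernel d (x + y)))
    = of_real (LINT s|lborel. indicator {p..q} (- x + d / (2 * pi) * s) * std_normal_density s)"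
proof -
  define c where "c = d / (2 * pi)"
  have c: "c > 0" "2 * pi / d = 1 / c" using d by (simp_all add: c_def)
  have "(LINT y|lborel. indicator {p..q} y * complex_of_real (gauss_kernel d (x + y)))
      = (LINT y|lborel. complex_of_real (indicator {p..q} y * gauss_kernel d (x + y)))"
    by (intro Bochner_Integration.integral_cong) (auto simp: indicator_def)
  also have "\<dots> = of_real (LINT y|lborel. indicator {p..q} y * gauss_kernel d (x + y))"
    by (rule integral_complex_of_real)
  also have "(LINT y|lborel. indicator {p..q} y * gauss_kernel d (x + y))
      = c * (LINT s|lborel. indicator {p..q} (- x + c * s) * gauss_kernel d (x + (- x + c * s)))"
    using c lborel_integral_real_affine[of c "\<lambda>y. indicator {p..q} y * gauss_kernel d (x + y)" "- x"] by simp
  also have "\<dots> = (LINT s|lborel. indicator {p..q} (- x + c * s) * std_normal_density s)"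
    unfolding integral_mult_right_zero[symmetric] gauss_kernel_def c(2)
    using c(1) by (intro Bochner_Integration.integral_cong) auto
  finally show ?thesis by (simp add: c_def)
qed

lemma gauss_interval_tendsto:
  assumes "- x \<noteq> p" "- x \<noteq> q"
  shows "(\<lambda>n. LINT y|lborel. indicator {p..q} y * complex_of_real (gauss_kernel (inverse (real (Suc n))) (x + y)))
    \<longlonglongrightarrow> indicator {p..q} (- x)"
proof -
  have "(\<lambda>n. LINT s|lborel. indicator {p..q} (- x + inverse (real (Suc n)) / (2 * pi) * s) * std_normal_density s)
     \<longlonglongrightarrow> (LINT s|lborel. indicator {p..q} (- x) * std_normal_density s)"
  proof (rule integral_dominated_convergence)
    show "integrable lborel std_normal_density" by (rule std_normal_integral)
    show "AE s in lborel. (\<lambda>n. indicator {p..q} (- x + inverse (real (Suc n)) / (2 * pi) * s) * std_normal_density s)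
        \<longlonglongrightarrow> indicator {p..q} (- x) * std_normal_density s"
    proof (intro AE_I2 tendsto_mult_right)
      fix s :: real
      have "(\<lambda>n. - x + inverse (real (Suc n)) / (2 * pi) * s) \<longlonglongrightarrow> - x + 0 / (2 * pi) * s"
        by (intro tendsto_intros LIMSEQ_inverse_real_of_nat) auto
      then have lim: "(\<lambda>n. - x + inverse (real (Suc n)) / (2 * pi) * s) \<longlonglongrightarrow> - x" by simp
      have "isCont (indicator {p..q} :: real \<Rightarrow> real) (- x)"
        using assms by (subst isCont_indicator) (auto simp: frontier_def interior_atLeastAtMost_real)
      from isCont_tendsto_compose[OF this lim]
      show "(\<lambda>n. indicator {p..q} (- x + inverse (real (Suc n)) / (2 * pi) * s)) \<longlonglongrightarrow> (indicator {p..q} (- x) :: real)" .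
    qed
    show "AE s in lborel. norm (indicator {p..q} (- x + inverse (real (Suc n)) / (2 * pi) * s) * std_normal_density s)
        \<le> std_normal_density s" for n
      by (intro AE_I2) (auto simp: indicator_def)
  qed auto
  then have "(\<lambda>n. complex_of_real (LINT s|lborel. indicator {p..q} (- x + inverse (real (Suc n)) / (2 * pi) * s) * std_normal_density s))
     \<longlonglongrightarrow> of_real (indicator {p..q} (- x))"
    using std_normal_integral by (intro tendsto_of_real) simp
  moreover have "complex_of_real (indicator {p..q} (- x)) = indicator {p..q} (- x)"
    by (auto simp: indicator_def)
  ultimately show ?thesis
    by (simp add: gauss_interval_integral del: of_nat_Suc)
qed

lemma interval_indicator_L2: "(indicator {a..b} :: real \<Rightarrow> complex) \<in> L2"
proof (rule L2I_dominated)
  show "integrable lborel (indicator {a..b} :: real \<Rightarrow> real)"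
    by (intro integrable_real_indicator) (auto simp: emeasure_lborel_Icc_eq)
qed (auto simp: indicator_def)

lemma interval_indicator_integrable: "integrable lborel (indicator {a..b} :: real \<Rightarrow> complex)"
proof -
  have "integrable lborel (\<lambda>x. indicator {a..b} x * indicator {a..b} x :: complex)"
    by (intro L2_mult_integrable interval_indicator_L2)
  then show ?thesis unfolding indicator_inter_arith[symmetric] by simp
qed

text \<open>The limit \<open>d \<rightarrow> 0\<close> of the regularised formula, with an indicator as the second function. Its
  Gaussian averages are at most 1 and converge at every point except the two end points, which form
  a null set.\<close>

lemma ft_interval_pairing:
  assumes f1: "integrable lborel f" and f2: "f \<in> L2"
  shows "(LINT k|lborel. ft f k * ft (indicator {- b..- a}) k) = (LINT x|lborel. indicator {a..b} x * f x)"
proof -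
  let ?h = "indicator {- b..- a} :: real \<Rightarrow> complex"
  let ?d = "\<lambda>n. inverse (real (Suc n))"
  note h = interval_indicator_integrable[of "-b" "-a"] interval_indicator_L2[of "-b" "-a"]
  note [measurable] = L2_measurable[OF f2] ft_measurable[OF L2_measurable[OF f2]] ft_measurable[OF L2_measurable[OF h(2)]]
  have int: "integrable lborel (\<lambda>k. ft f k * ft ?h k)"
    by (intro L2_mult_integrable ft_L2 f1 f2 h)
  have "(\<lambda>n. LINT k|lborel. ft f k * (ft ?h k * of_real (exp (- (?d n * k)\<^sup>2 / 2))))
      \<longlonglongrightarrow> (LINT k|lborel. ft f k * ft ?h k)"
  proof (rule integral_dominated_convergence)
    show "integrable lborel (\<lambda>k. norm (ft f k * ft ?h k))" using int by (rule integrable_norm)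
    show "AE k in lborel. (\<lambda>n. ft f k * (ft ?h k * of_real (exp (- (?d n * k)\<^sup>2 / 2)))) \<longlonglongrightarrow> ft f k * ft ?h k"
    proof (intro AE_I2)
      fix k
      have "(\<lambda>n. ft f k * (ft ?h k * of_real (exp (- (?d n * k)\<^sup>2 / 2))))
         \<longlonglongrightarrow> ft f k * (ft ?h k * of_real (exp (- (0 * k)\<^sup>2 / 2)))"
        by (intro tendsto_intros LIMSEQ_inverse_real_of_nat) auto
      then show "(\<lambda>n. ft f k * (ft ?h k * of_real (exp (- (?d n * k)\<^sup>2 / 2)))) \<longlonglongrightarrow> ft f k * ft ?h k"
        by simp
    qed
    show "AE k in lborel. norm (ft f k * (ft ?h k * of_real (exp (- (?d n * k)\<^sup>2 / 2)))) \<le> norm (ft f k * ft ?h k)" for n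
    proof (intro AE_I2)
      fix k
      have "norm (ft f k * ft ?h k) * exp (- (?d n * k)\<^sup>2 / 2) \<le> norm (ft f k * ft ?h k) * 1"
        by (intro mult_left_mono) auto
      then show "norm (ft f k * (ft ?h k * of_real (exp (- (?d n * k)\<^sup>2 / 2)))) \<le> norm (ft f k * ft ?h k)"
        by (simp add: norm_mult mult.assoc)
    qed
  qed measurable
  moreover have "(\<lambda>n. LINT x|lborel. f x * (LINT y|lborel. ?h y * of_real (gauss_kernel (?d n) (x + y))))
      \<longlonglongrightarrow> (LINT x|lborel. f x * indicator {a..b} x)"
  proof (rule integral_dominated_convergence)
    show "integrable lborel (\<lambda>x. norm (f x))" using f1 by (rule integrable_norm)
    have "AE x in lborel. x \<noteq> a \<and> x \<noteq> b"
      using AE_lborel_singleton[of a] AE_lborel_singleton[of b] by eventually_elim auto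
    then show "AE x in lborel. (\<lambda>n. f x * (LINT y|lborel. ?h y * of_real (gauss_kernel (?d n) (x + y))))
      \<longlonglongrightarrow> f x * indicator {a..b} x"
    proof eventually_elim
      case (elim x)
      have "(indicator {- b..- a} (- x) :: complex) = indicator {a..b} x" by (auto simp: indicator_def)
      then show ?case
        using gauss_interval_tendsto[of x "-b" "-a"] elim by (intro tendsto_mult_left) auto
    qed
    show "AE x in lborel. norm (f x * (LINT y|lborel. ?h y * of_real (gauss_kernel (?d n) (x + y)))) \<le> norm (f x)" for n
    proof (intro AE_I2)
      fix x
      let ?S = "\<lambda>s. indicator {-b..-a} (- x + ?d n / (2 * pi) * s) * std_normal_density s"
      have "integrable lborel ?S"
        by (rule Bochner_Integration.integrable_bound[OF std_normal_integral(1)])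
           (auto simp: indicator_def)
      then have "(LINT s|lborel. ?S s) \<le> (LINT s|lborel. std_normal_density s)"
        by (intro integral_mono std_normal_integral) (auto simp: indicator_def)
      moreover have "0 \<le> (LINT s|lborel. ?S s)" by (intro Bochner_Integration.integral_nonneg) auto
      ultimately have "norm (LINT y|lborel. ?h y * of_real (gauss_kernel (?d n) (x + y))) \<le> 1"
        using std_normal_integral(2) by (simp add: gauss_interval_integral del: of_nat_Suc)
      then show "norm (f x * (LINT y|lborel. ?h y * of_real (gauss_kernel (?d n) (x + y)))) \<le> norm (f x)"
        by (simp add: norm_mult mult_left_le del: of_nat_Suc)
    qed
  qed measurable
  ultimately have "(LINT k|lborel. ft f k * ft ?h k) = (LINT x|lborel. f x * indicator {a..b} x)"
    using ft_mult_gauss[OF f1 h(1)] by (intro LIMSEQ_unique) (auto simp del: of_nat_Suc)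
  then show ?thesis by (simp add: mult.commute)
qed

subsection \<open>Functions are determined by their integrals over intervals\<close>

text \<open>The positive and the negative part of \<open>h\<close> are densities of finite measures with the same
  distribution function, hence of the same measure.\<close>

lemma AE_zero_of_interval_integrals_real:
  fixes h :: "real \<Rightarrow> real"
  assumes int: "integrable lborel h" and zero: "\<And>a b. (LINT x|lborel. indicator {a..b} x * h x) = 0"
  shows "AE x in lborel. h x = 0"
proof -
  note [measurable] = borel_measurable_integrable[OF int]
  define p where "p x = max 0 (h x)" for x
  define q where "q x = max 0 (- h x)" for x
  have p: "integrable lborel p" and q: "integrable lborel q"
    unfolding p_def q_def using int by (auto intro: integrable_max)
  have [measurable]: "p \<in> borel_measurable borel" "q \<in> borel_measurable borel"
    unfolding p_def q_def by measurable
  have nn: "p x \<ge> 0" "q x \<ge> 0" for x by (auto simp: p_def q_def)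
  have half: "(LINT x|lborel. indicator {..t} x * h x) = 0" for t
  proof -
    have "(\<lambda>n. LINT x|lborel. indicator {- real n..t} x * h x) \<longlonglongrightarrow> (LINT x|lborel. indicator {..t} x * h x)"
    proof (rule integral_dominated_convergence)
      show "integrable lborel (\<lambda>x. norm (h x))" using int by (rule integrable_norm)
      show "AE x in lborel. (\<lambda>n. indicator {- real n..t} x * h x) \<longlonglongrightarrow> indicator {..t} x * h x"
      proof (intro AE_I2 tendsto_eventually)
        fix x
        obtain N :: nat where "- x \<le> real N" using real_arch_simple by blast
        then show "eventually (\<lambda>n. indicator {- real n..t} x * h x = indicator {..t} x * h x) sequentially"
          by (intro eventually_sequentiallyI[of N]) (auto simp: indicator_def)
      qed
    qed (auto simp: indicator_def)
    then show ?thesis using zero by (simp add: LIMSEQ_const_iff)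
  qed
  have pq: "(LINT x|lborel. indicator {..t} x * p x) = (LINT x|lborel. indicator {..t} x * q x)" for t
  proof -
    have ip: "integrable lborel (\<lambda>x. indicator {..t} x * p x)"
      by (rule Bochner_Integration.integrable_bound[OF p]) (auto simp: indicator_def)
    have iq: "integrable lborel (\<lambda>x. indicator {..t} x * q x)"
      by (rule Bochner_Integration.integrable_bound[OF q]) (auto simp: indicator_def)
    have "(LINT x|lborel. indicator {..t} x * p x) - (LINT x|lborel. indicator {..t} x * q x)
        = (LINT x|lborel. indicator {..t} x * h x)"
      by (subst Bochner_Integration.integral_diff[symmetric, OF ip iq])
         (auto intro!: Bochner_Integration.integral_cong simp: p_def q_def indicator_def)
    then show ?thesis using half by simp
  qed
  have em: "emeasure (density lborel (\<lambda>x. ennreal (g x))) {..t} = ennreal (LINT x|lborel. indicator {..t} x * g x)"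
    if "integrable lborel g" "\<And>x. g x \<ge> 0" for g :: "real \<Rightarrow> real" and t
  proof -
    note [measurable] = borel_measurable_integrable[OF that(1)]
    have i: "integrable lborel (\<lambda>x. indicator {..t} x * g x)"
      by (rule Bochner_Integration.integrable_bound[OF that(1)]) (auto simp: indicator_def)
    have "emeasure (density lborel (\<lambda>x. ennreal (g x))) {..t}
        = (\<integral>\<^sup>+x. ennreal (g x) * indicator {..t} x \<partial>lborel)"
      by (rule emeasure_density) auto
    also have "\<dots> = (\<integral>\<^sup>+x. ennreal (indicator {..t} x * g x) \<partial>lborel)"
      by (intro nn_integral_cong) (auto simp: indicator_def)
    also have "\<dots> = ennreal (LINT x|lborel. indicator {..t} x * g x)"
      using i that(2) by (intro nn_integral_eq_integral) auto
    finally show ?thesis .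
  qed
  have fb: "finite_borel_measure (density lborel (\<lambda>x. ennreal (g x)))"
    if "integrable lborel g" "\<And>x. g x \<ge> 0" for g :: "real \<Rightarrow> real"
  proof (intro finite_borel_measure.intro finite_measureI finite_borel_measure_axioms.intro)
    show "emeasure (density lborel (\<lambda>x. ennreal (g x))) (space (density lborel (\<lambda>x. ennreal (g x)))) \<noteq> \<infinity>"
      using that borel_measurable_integrable[OF that(1)]
      by (simp add: emeasure_density nn_integral_eq_integral)
  qed simp
  have "density lborel (\<lambda>x. ennreal (p x)) = density lborel (\<lambda>x. ennreal (q x))"
  proof (rule cdf_unique'[OF fb[OF p nn(1)] fb[OF q nn(2)]])
    show "cdf (density lborel (\<lambda>x. ennreal (p x))) = cdf (density lborel (\<lambda>x. ennreal (q x)))"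
      by (intro ext) (simp add: cdf_def measure_def em[OF p nn(1)] em[OF q nn(2)] pq)
  qed
  then have "AE x in lborel. ennreal (p x) = ennreal (q x)"
    by (intro sigma_finite_measure.density_unique[OF sigma_finite_lborel]) auto
  then show ?thesis
    by eventually_elim (use nn in \<open>auto simp: p_def q_def max_def split: if_splits\<close>)
qed

lemma AE_eq_of_interval_integrals:
  assumes f: "f \<in> L2" and g: "g \<in> L2"
    and eq: "\<And>a b. (LINT x|lborel. indicator {a..b} x * f x) = (LINT x|lborel. indicator {a..b} x * g x)"
  shows "AE x in lborel. f x = g x"
proof -
  note [measurable] = f[THEN L2_measurable] g[THEN L2_measurable]
  define h where "h n x = indicator {- real n..real n} x * (f x - g x)" for n :: nat and x
  have hi: "integrable lborel (h n)" for n
    unfolding h_def by (intro L2_mult_integrable interval_indicator_L2 L2_diff f g)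
  have hz: "(LINT x|lborel. indicator {a..b} x * h n x) = 0" for n a b
  proof -
    have "(LINT x|lborel. indicator {a..b} x * h n x)
      = (LINT x|lborel. indicator {max a (- real n)..min b (real n)} x * f x
           - indicator {max a (- real n)..min b (real n)} x * g x)"
      by (intro Bochner_Integration.integral_cong) (auto simp: h_def indicator_def)
    also have "\<dots> = 0"
      by (subst Bochner_Integration.integral_diff)
         (auto intro!: L2_mult_integrable interval_indicator_L2 f g simp: eq)
    finally show ?thesis .
  qed
  have "AE x in lborel. h n x = 0" for n
  proof -
    have i: "integrable lborel (\<lambda>x. indicator {a..b} x * h n x)" for a b
      by (rule Bochner_Integration.integrable_bound[OF hi[of n]])
         (use borel_measurable_integrable[OF hi[of n]] in \<open>auto simp: indicator_def\<close>)
    have "AE x in lborel. Re (h n x) = 0"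
    proof (rule AE_zero_of_interval_integrals_real)
      show "integrable lborel (\<lambda>x. Re (h n x))" using hi by simp
      show "(LINT x|lborel. indicator {a..b} x * Re (h n x)) = 0" for a b
      proof -
        have "(LINT x|lborel. indicator {a..b} x * Re (h n x)) = (LINT x|lborel. Re (indicator {a..b} x * h n x))"
          by (intro Bochner_Integration.integral_cong) (auto simp: indicator_def)
        then show ?thesis using integral_Re[OF i[of a b]] hz[of a b n] by simp
      qed
    qed
    moreover have "AE x in lborel. Im (h n x) = 0"
    proof (rule AE_zero_of_interval_integrals_real)
      show "integrable lborel (\<lambda>x. Im (h n x))" using hi by simp
      show "(LINT x|lborel. indicator {a..b} x * Im (h n x)) = 0" for a b
      proof -
        have "(LINT x|lborel. indicator {a..b} x * Im (h n x)) = (LINT x|lborel. Im (indicator {a..b} x * h n x))"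
          by (intro Bochner_Integration.integral_cong) (auto simp: indicator_def)
        then show ?thesis using integral_Im[OF i[of a b]] hz[of a b n] by simp
      qed
    qed
    ultimately show ?thesis by eventually_elim (simp add: complex_eq_iff)
  qed
  then have "AE x in lborel. \<forall>n. h n x = 0" by (simp add: AE_all_countable)
  then show ?thesis
  proof eventually_elim
    case (elim x)
    obtain n :: nat where "\<bar>x\<bar> \<le> real n" using real_arch_simple by blast
    then show ?case using elim[rule_format, of n] by (auto simp: h_def indicator_def abs_le_iff split: if_splits)
  qed
qed

subsection \<open>Existence, inversion and Plancherel's theorem\<close>

definition cutoff :: "real \<Rightarrow> (real \<Rightarrow> complex) \<Rightarrow> real \<Rightarrow> complex" where
  "cutoff R f x = indicator {- R..R} x * f x"

lemma cutoff_L2: "f \<in> L2 \<Longrightarrow> cutoff R f \<in> L2"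
  unfolding cutoff_def by (rule L2_mult_bounded(1)[where C = 1]) (auto simp: indicator_def)

lemma cutoff_integrable: "f \<in> L2 \<Longrightarrow> integrable lborel (cutoff R f)"
  unfolding cutoff_def[abs_def] by (intro L2_mult_integrable interval_indicator_L2)

lemma fourier_trunc_eq_ft: "fourier_trunc R f = ft (cutoff R f)"
  by (intro ext) (simp add: fourier_trunc_def ft_def cutoff_def set_lebesgue_integral_def
      scaleR_conv_of_real mult_ac of_real_indicator)

lemma cutoff_tendsto:
  assumes "f \<in> L2"
  shows "((\<lambda>R. L2_norm_sq (\<lambda>x. cutoff R f x - f x)) \<longlongrightarrow> 0) at_top"
proof -
  note [measurable] = assms[THEN L2_measurable]
  have "((\<lambda>R. LINT x|lborel. (cmod (cutoff R f x - f x))\<^sup>2) \<longlongrightarrow> (LINT (x::real)|lborel. 0)) at_top"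
  proof (rule integral_dominated_convergence_at_top)
    show "integrable lborel (\<lambda>x. (cmod (f x))\<^sup>2)" by (rule L2_integrable_sq[OF assms])
    show "(\<lambda>x. (cmod (cutoff R f x - f x))\<^sup>2) \<in> borel_measurable lborel" for R
      unfolding cutoff_def by measurable
    show "\<forall>\<^sub>F R in at_top. AE x in lborel. norm ((cmod (cutoff R f x - f x))\<^sup>2) \<le> (cmod (f x))\<^sup>2"
      by (intro always_eventually allI AE_I2) (auto simp: cutoff_def indicator_def)
    show "AE x in lborel. ((\<lambda>R. (cmod (cutoff R f x - f x))\<^sup>2) \<longlongrightarrow> 0) at_top"
    proof (intro AE_I2 tendsto_eventually)
      fix x
      show "\<forall>\<^sub>F R in at_top. (cmod (cutoff R f x - f x))\<^sup>2 = 0"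
        using eventually_ge_at_top[of "\<bar>x\<bar>"]
        by eventually_elim (auto simp: cutoff_def indicator_def)
    qed
  qed measurable
  then show ?thesis by (simp add: L2_norm_sq_def)
qed

lemma fourier_trunc_L2: "f \<in> L2 \<Longrightarrow> fourier_trunc R f \<in> L2"
  unfolding fourier_trunc_eq_ft by (intro ft_L2 cutoff_L2 cutoff_integrable)

lemma fourier_trunc_diff_le:
  assumes "f \<in> L2"
  shows "L2_norm_sq (\<lambda>k. fourier_trunc R f k - fourier_trunc S f k)
    \<le> 2 * L2_norm_sq (\<lambda>x. cutoff R f x - f x) + 2 * L2_norm_sq (\<lambda>x. cutoff S f x - f x)"
proof -
  have "L2_norm_sq (\<lambda>k. fourier_trunc R f k - fourier_trunc S f k)
      = L2_norm_sq (ft (\<lambda>x. cutoff R f x - cutoff S f x))"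
    unfolding fourier_trunc_eq_ft by (simp add: L2_norm_sq_def ft_diff cutoff_integrable assms)
  also have "\<dots> \<le> L2_norm_sq (\<lambda>x. cutoff R f x - cutoff S f x)"
    by (intro ft_L2 L2_diff cutoff_L2 cutoff_integrable Bochner_Integration.integrable_diff assms)
  also have "\<dots> \<le> 2 * L2_norm_sq (\<lambda>x. cutoff R f x - f x) + 2 * L2_norm_sq (\<lambda>x. f x - cutoff S f x)"
    by (intro L2_norm_sq_triangle cutoff_L2 assms)
  finally show ?thesis by (simp add: L2_norm_sq_minus[of f "cutoff S f"])
qed

text \<open>The transforms of the truncations are Cauchy in \<open>L\<^sup>2\<close> because \<open>ft\<close> is a contraction and the
  truncations converge to \<open>f\<close>. Completeness gives a limit along the integers, which the same
  estimate extends to real \<open>R\<close>.\<close>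

lemma fourier_limit_exists:
  assumes f: "f \<in> L2"
  obtains g where "g \<in> L2" "((\<lambda>R. L2_norm_sq (\<lambda>k. fourier_trunc R f k - g k)) \<longlongrightarrow> 0) at_top"
proof -
  define t where "t R = L2_norm_sq (\<lambda>x. cutoff R f x - f x)" for R
  have t0: "(t \<longlongrightarrow> 0) at_top" unfolding t_def[abs_def] by (rule cutoff_tendsto[OF f])
  have tn: "(\<lambda>n. t (real n)) \<longlonglongrightarrow> 0"
    by (rule filterlim_compose[OF t0 filterlim_real_sequentially])
  obtain g where g: "g \<in> L2" "(\<lambda>n. L2_norm_sq (\<lambda>k. fourier_trunc (real n) f k - g k)) \<longlonglongrightarrow> 0"
  proof (rule Riesz_Fischer[of "\<lambda>n. fourier_trunc (real n) f"])
    fix e :: real assume "e > 0"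
    then obtain M where M: "\<And>n. n \<ge> M \<Longrightarrow> t (real n) < e / 4"
      using order_tendstoD(2)[OF tn, of "e / 4"] by (auto simp: eventually_sequentially)
    have "L2_norm_sq (\<lambda>k. fourier_trunc (real m) f k - fourier_trunc (real n) f k) < e"
      if "m \<ge> M" "n \<ge> M" for m n
      using fourier_trunc_diff_le[OF f, of "real m" "real n"] M[OF that(1)] M[OF that(2)]
      by (simp add: t_def)
    then show "\<exists>M. \<forall>m\<ge>M. \<forall>n\<ge>M. L2_norm_sq (\<lambda>k. fourier_trunc (real m) f k - fourier_trunc (real n) f k) < e"
      by blast
  qed (auto intro: fourier_trunc_L2 f)
  let ?n = "\<lambda>R. nat \<lceil>R :: real\<rceil>"
  have n: "filterlim ?n sequentially at_top"
    unfolding filterlim_at_top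
  proof
    fix Z :: nat
    show "\<forall>\<^sub>F R in at_top. Z \<le> ?n R"
      using eventually_ge_at_top[of "real Z"] by eventually_elim linarith
  qed
  have le: "L2_norm_sq (\<lambda>k. fourier_trunc R f k - g k)
      \<le> 2 * (2 * t R + 2 * t S) + 2 * L2_norm_sq (\<lambda>k. fourier_trunc S f k - g k)" for R S
  proof -
    have arith: "A \<le> 2 * B + 2 * C \<Longrightarrow> B \<le> D \<Longrightarrow> A \<le> 2 * D + 2 * C" for A B C D :: real
      by linarith
    show ?thesis
      unfolding t_def
      by (rule arith[OF L2_norm_sq_triangle[OF fourier_trunc_L2[OF f] fourier_trunc_L2[OF f] g(1)]
            fourier_trunc_diff_le[OF f]])
  qed
  have "((\<lambda>R. L2_norm_sq (\<lambda>k. fourier_trunc R f k - g k)) \<longlongrightarrow> 0) at_top"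
  proof (rule tendsto_sandwich[OF _ _ tendsto_const])
    show "\<forall>\<^sub>F R in at_top. L2_norm_sq (\<lambda>k. fourier_trunc R f k - g k)
      \<le> 2 * (2 * t R + 2 * t (real (?n R))) + 2 * L2_norm_sq (\<lambda>k. fourier_trunc (real (?n R)) f k - g k)"
      by (intro always_eventually allI le)
    show "((\<lambda>R. 2 * (2 * t R + 2 * t (real (?n R)))
        + 2 * L2_norm_sq (\<lambda>k. fourier_trunc (real (?n R)) f k - g k)) \<longlongrightarrow> 0) at_top"
      using tendsto_add[OF tendsto_mult_left[OF tendsto_add[OF tendsto_mult_left[OF t0, of 2]
            tendsto_mult_left[OF filterlim_compose[OF tn n], of 2]], of 2]
          tendsto_mult_left[OF filterlim_compose[OF g(2) n], of 2]] by simp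
  qed auto
  with g(1) show thesis by (rule that)
qed

lemma L2_limit_nn_integral_iff:
  assumes "\<And>R. u R \<in> L2" "g \<in> L2"
  shows "((\<lambda>R. \<integral>\<^sup>+ k. ennreal ((cmod (u R k - g k))\<^sup>2) \<partial>lborel) \<longlongrightarrow> 0) F
    \<longleftrightarrow> ((\<lambda>R. L2_norm_sq (\<lambda>k. u R k - g k)) \<longlongrightarrow> 0) F"
proof -
  have "(\<integral>\<^sup>+ k. ennreal ((cmod (u R k - g k))\<^sup>2) \<partial>lborel) = ennreal (L2_norm_sq (\<lambda>k. u R k - g k))" for R
    using L2_integrable_sq[OF L2_diff[OF assms(1) assms(2)], of R]
    by (simp add: nn_integral_eq_integral L2_norm_sq_def)
  then show ?thesis
    by (simp add: tendsto_ennreal_iff[of _ _ 0, simplified])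
qed

lemma fourier_L2: 
  assumes "f \<in> L2"
  shows "fourier f \<in> L2"
    and "((\<lambda>R. L2_norm_sq (\<lambda>k. fourier_trunc R f k - fourier f k)) \<longlongrightarrow> 0) at_top"
proof -
  obtain g where "g \<in> L2" "((\<lambda>R. L2_norm_sq (\<lambda>k. fourier_trunc R f k - g k)) \<longlongrightarrow> 0) at_top"
    by (rule fourier_limit_exists[OF assms])
  then have "\<exists>g. g \<in> L2 \<and>
     ((\<lambda>R. \<integral>\<^sup>+ k. ennreal ((cmod (fourier_trunc R f k - g k))\<^sup>2) \<partial>lborel) \<longlongrightarrow> 0) at_top"
    using L2_limit_nn_integral_iff[of "\<lambda>R. fourier_trunc R f", OF fourier_trunc_L2[OF assms]] by blast
  from someI_ex[OF this, folded fourier_def]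
  show *: "fourier f \<in> L2"
    and "((\<lambda>R. L2_norm_sq (\<lambda>k. fourier_trunc R f k - fourier f k)) \<longlongrightarrow> 0) at_top"
    using L2_limit_nn_integral_iff[of "\<lambda>R. fourier_trunc R f", OF fourier_trunc_L2[OF assms]] by blast+
qed

lemma fourier_measurable [measurable_dest]: "f \<in> L2 \<Longrightarrow> fourier f \<in> borel_measurable borel"
  by (intro L2_measurable fourier_L2)

text \<open>The representative chosen in \<open>fourier\<close> is known only up to null sets. This is how
  linearity, the behaviour under reflection and the agreement with \<open>ft\<close> reach it.\<close>

lemma fourier_unique:
  assumes f: "f \<in> L2" and g: "g \<in> L2"
    and lim: "((\<lambda>R. L2_norm_sq (\<lambda>k. fourier_trunc R f k - g k)) \<longlongrightarrow> 0) at_top"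
  shows "AE k in lborel. fourier f k = g k"
proof -
  let ?t = "\<lambda>R. fourier_trunc R f"
  have "L2_norm_sq (\<lambda>k. fourier f k - g k) \<le> 0"
  proof (rule tendsto_lowerbound)
    show "((\<lambda>R. 2 * L2_norm_sq (\<lambda>k. ?t R k - fourier f k) + 2 * L2_norm_sq (\<lambda>k. ?t R k - g k)) \<longlongrightarrow> 0) at_top"
      using tendsto_add[OF tendsto_mult_left[OF fourier_L2(2)[OF f], of 2] tendsto_mult_left[OF lim, of 2]] by simp
    show "\<forall>\<^sub>F R in at_top. L2_norm_sq (\<lambda>k. fourier f k - g k)
        \<le> 2 * L2_norm_sq (\<lambda>k. ?t R k - fourier f k) + 2 * L2_norm_sq (\<lambda>k. ?t R k - g k)"
    proof (intro always_eventually allI)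
      fix R
      show "L2_norm_sq (\<lambda>k. fourier f k - g k)
        \<le> 2 * L2_norm_sq (\<lambda>k. ?t R k - fourier f k) + 2 * L2_norm_sq (\<lambda>k. ?t R k - g k)"
        using L2_norm_sq_triangle[OF fourier_L2(1)[OF f] fourier_trunc_L2[OF f, of R] g]
        by (simp add: L2_norm_sq_minus[of "fourier f"])
    qed
  qed auto
  then have "L2_norm_sq (\<lambda>k. fourier f k - g k) = 0"
    using L2_norm_sq_nonneg by (simp add: order_antisym)
  from L2_norm_sq_eq_0[OF L2_diff[OF fourier_L2(1)[OF f] g] this] show ?thesis by simp
qed

lemma fourier_lincomb:
  assumes f: "f \<in> L2" and g: "g \<in> L2"
  shows "AE k in lborel. fourier (\<lambda>x. f x + c * g x) k = fourier f k + c * fourier g k"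
proof (rule fourier_unique)
  let ?T = "\<lambda>R k. fourier_trunc R f k - fourier f k" and ?S = "\<lambda>R k. fourier_trunc R g k - fourier g k"
  have cutoff: "cutoff R (\<lambda>x. f x + c * g x) = (\<lambda>x. cutoff R f x + c * cutoff R g x)" for R
    by (auto simp: cutoff_def algebra_simps)
  have "L2_norm_sq (\<lambda>k. fourier_trunc R (\<lambda>x. f x + c * g x) k - (fourier f k + c * fourier g k))
      = L2_norm_sq (\<lambda>k. ?T R k + c * ?S R k)" for R
    unfolding fourier_trunc_eq_ft cutoff
    by (simp add: L2_norm_sq_def ft_lincomb cutoff_integrable f g algebra_simps)
  also have "\<dots> R \<le> 2 * L2_norm_sq (?T R) + 2 * ((cmod c)\<^sup>2 * L2_norm_sq (?S R))" for R
    using L2_norm_sq_add_le[of "?T R" "\<lambda>k. c * ?S R k"]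
      L2_diff[OF fourier_trunc_L2[OF f] fourier_L2(1)[OF f], of R]
      L2_cmult[OF L2_diff[OF fourier_trunc_L2[OF g] fourier_L2(1)[OF g]], of c R]
    by (simp add: L2_norm_sq_def norm_mult power_mult_distrib)
  finally have le: "L2_norm_sq (\<lambda>k. fourier_trunc R (\<lambda>x. f x + c * g x) k - (fourier f k + c * fourier g k))
      \<le> 2 * L2_norm_sq (?T R) + 2 * ((cmod c)\<^sup>2 * L2_norm_sq (?S R))" for R .
  show "((\<lambda>R. L2_norm_sq (\<lambda>k. fourier_trunc R (\<lambda>x. f x + c * g x) k - (fourier f k + c * fourier g k))) \<longlongrightarrow> 0) at_top"
  proof (rule tendsto_sandwich[OF _ _ tendsto_const])
    show "((\<lambda>R. 2 * L2_norm_sq (?T R) + 2 * ((cmod c)\<^sup>2 * L2_norm_sq (?S R))) \<longlongrightarrow> 0) at_top"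
      using tendsto_add[OF tendsto_mult_left[OF fourier_L2(2)[OF f], of 2]
          tendsto_mult_left[OF tendsto_mult_left[OF fourier_L2(2)[OF g], of "(cmod c)\<^sup>2"], of 2]] by simp
  qed (auto intro!: always_eventually le)
qed (intro L2_lincomb fourier_L2 f g)+

lemma L2_uminus_arg:
  assumes "f \<in> L2"
  shows "(\<lambda>x. f (- x)) \<in> L2" "L2_norm_sq (\<lambda>x. f (- x)) = L2_norm_sq f"
  using assms lborel_integrable_uminus[of "\<lambda>x. (cmod (f x))\<^sup>2"]
    lborel_integral_uminus[of "\<lambda>x. (cmod (f x))\<^sup>2"]
  by (auto simp: L2_def L2_norm_sq_def)

lemma AE_lborel_uminus:
  assumes "AE x in lborel. P (x :: real)"
  shows "AE x in lborel. P (- x)"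
proof -
  have "AE x in distr lborel borel uminus. P (x :: real)"
    unfolding lborel_distr_uminus by (rule assms)
  then show ?thesis
    by (rule AE_distrD[rotated]) simp
qed

lemma fourier_uminus:
  assumes f: "f \<in> L2"
  shows "AE k in lborel. fourier (\<lambda>x. f (- x)) k = fourier f (- k)"
proof (rule fourier_unique)
  have cutoff: "cutoff R (\<lambda>x. f (- x)) = (\<lambda>x. cutoff R f (- x))" for R
    by (intro ext) (auto simp: cutoff_def indicator_def)
  have "L2_norm_sq (\<lambda>k. fourier_trunc R (\<lambda>x. f (- x)) k - fourier f (- k))
      = L2_norm_sq (\<lambda>k. fourier_trunc R f k - fourier f k)" for R
    unfolding fourier_trunc_eq_ft cutoff ft_uminus
    using L2_uminus_arg(2)[OF L2_diff[OF fourier_trunc_L2[OF f] fourier_L2(1)[OF f]], of R]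
    by (simp add: fourier_trunc_eq_ft)
  then show "((\<lambda>R. L2_norm_sq (\<lambda>k. fourier_trunc R (\<lambda>x. f (- x)) k - fourier f (- k))) \<longlongrightarrow> 0) at_top"
    using fourier_L2(2)[OF f] by simp
qed (intro L2_uminus_arg fourier_L2 f)+

lemma fourier_eq_ft:
  assumes f: "f \<in> L2" and i: "integrable lborel f"
  shows "AE k in lborel. fourier f k = ft f k"
proof (rule fourier_unique[OF f ft_L2(1)[OF i f]])
  have le: "L2_norm_sq (\<lambda>k. fourier_trunc R f k - ft f k) \<le> L2_norm_sq (\<lambda>x. cutoff R f x - f x)" for R
  proof -
    have "L2_norm_sq (\<lambda>k. fourier_trunc R f k - ft f k) = L2_norm_sq (ft (\<lambda>x. cutoff R f x - f x))"
      unfolding fourier_trunc_eq_ft by (simp add: L2_norm_sq_def ft_diff cutoff_integrable f i)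
    also have "\<dots> \<le> L2_norm_sq (\<lambda>x. cutoff R f x - f x)"
      by (intro ft_L2 L2_diff cutoff_L2 f i Bochner_Integration.integrable_diff cutoff_integrable)
    finally show ?thesis .
  qed
  show "((\<lambda>R. L2_norm_sq (\<lambda>k. fourier_trunc R f k - ft f k)) \<longlongrightarrow> 0) at_top"
    by (rule tendsto_sandwich[OF _ _ tendsto_const cutoff_tendsto[OF f]]) (auto intro!: always_eventually le)
qed

lemma fourier_cong_AE:
  assumes "f \<in> borel_measurable borel" "g \<in> borel_measurable borel" "AE x in lborel. f x = g x"
  shows "fourier f = fourier g"
proof -
  have "ft (cutoff R f) = ft (cutoff R g)" for R
    unfolding cutoff_def[abs_def] using assms by (intro ft_cong_AE) auto
  then show ?thesis unfolding fourier_def fourier_trunc_eq_ft by simp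
qed

lemma fourier_norm_le:
  assumes f: "f \<in> L2"
  shows "L2_norm_sq (fourier f) \<le> L2_norm_sq f"
proof (rule L2_norm_sq_limit_le[OF fourier_trunc_L2[OF f] fourier_L2[OF f]])
  show "L2_norm_sq (fourier_trunc R f) \<le> L2_norm_sq f" for R
  proof -
    have "L2_norm_sq (fourier_trunc R f) \<le> L2_norm_sq (cutoff R f)"
      unfolding fourier_trunc_eq_ft by (intro ft_L2 cutoff_L2 cutoff_integrable f)
    also have "\<dots> \<le> 1\<^sup>2 * L2_norm_sq f"
      unfolding cutoff_def[abs_def] by (rule L2_mult_bounded(2)[OF f]) (auto simp: indicator_def)
    finally show ?thesis by simp
  qed
qed auto

lemma fourier_pairing:
  assumes f: "f \<in> L2" and h: "h \<in> L2" "integrable lborel h"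
  shows "(LINT k|lborel. fourier f k * h k) = (LINT x|lborel. f x * ft h x)"
proof (rule tendsto_unique)
  show "((\<lambda>R. LINT k|lborel. fourier_trunc R f k * h k) \<longlongrightarrow> (LINT k|lborel. fourier f k * h k)) at_top"
    by (rule L2_tendsto_mult_integral[OF fourier_trunc_L2[OF f] fourier_L2(1)[OF f] h(1) fourier_L2(2)[OF f]])
  have "((\<lambda>R. LINT x|lborel. cutoff R f x * ft h x) \<longlongrightarrow> (LINT x|lborel. f x * ft h x)) at_top"
    by (rule L2_tendsto_mult_integral[OF cutoff_L2[OF f] f ft_L2(1)[OF h(2,1)] cutoff_tendsto[OF f]])
  then show "((\<lambda>R. LINT k|lborel. fourier_trunc R f k * h k) \<longlongrightarrow> (LINT x|lborel. f x * ft h x)) at_top"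
    by (simp add: fourier_trunc_eq_ft ft_mult_integral[OF cutoff_integrable[OF f] h(2)])
qed simp

lemma fourier_interval_pairing:
  assumes f: "f \<in> L2"
  shows "(LINT k|lborel. fourier f k * ft (indicator {- b..- a}) k) = (LINT x|lborel. indicator {a..b} x * f x)"
proof (rule tendsto_unique)
  note I = ft_L2(1)[OF interval_indicator_integrable interval_indicator_L2]
  show "((\<lambda>R. LINT k|lborel. fourier_trunc R f k * ft (indicator {- b..- a}) k)
      \<longlongrightarrow> (LINT k|lborel. fourier f k * ft (indicator {- b..- a}) k)) at_top"
    by (rule L2_tendsto_mult_integral[OF fourier_trunc_L2[OF f] fourier_L2(1)[OF f] I fourier_L2(2)[OF f]])
  have "((\<lambda>R. LINT x|lborel. cutoff R f x * indicator {a..b} x) \<longlongrightarrow> (LINT x|lborel. f x * indicator {a..b} x)) at_top"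
    by (rule L2_tendsto_mult_integral[OF cutoff_L2[OF f] f interval_indicator_L2 cutoff_tendsto[OF f]])
  then show "((\<lambda>R. LINT k|lborel. fourier_trunc R f k * ft (indicator {- b..- a}) k)
      \<longlongrightarrow> (LINT x|lborel. indicator {a..b} x * f x)) at_top"
    by (simp add: fourier_trunc_eq_ft ft_interval_pairing[OF cutoff_integrable[OF f] cutoff_L2[OF f]] mult.commute)
qed simp

text \<open>Tested on an interval, the outer transform moves onto the indicator, and what remains is the
  integral of \<open>f\<close> over the reflected interval.\<close>

theorem fourier_inversion:
  assumes f: "f \<in> L2"
  shows "AE x in lborel. fourier (fourier f) x = f (- x)"
proof (rule AE_eq_of_interval_integrals)
  fix a b
  have "(LINT x|lborel. indicator {a..b} x * fourier (fourier f) x)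
      = (LINT x|lborel. fourier f x * ft (indicator {a..b}) x)"
    using fourier_pairing[OF fourier_L2(1)[OF f] interval_indicator_L2 interval_indicator_integrable, of a b]
    by (simp add: mult.commute)
  also have "\<dots> = (LINT x|lborel. indicator {- b..- a} x * f x)"
    using fourier_interval_pairing[OF f, of "- a" "- b"] by simp
  also have "\<dots> = (LINT x|lborel. indicator {- b..- a} (- x) * f (- x))"
    by (rule lborel_integral_uminus[symmetric])
  also have "\<dots> = (LINT x|lborel. indicator {a..b} x * f (- x))"
    by (intro Bochner_Integration.integral_cong) (auto simp: indicator_def)
  finally show "(LINT x|lborel. indicator {a..b} x * fourier (fourier f) x)
      = (LINT x|lborel. indicator {a..b} x * f (- x))" .
qed (intro fourier_L2 L2_uminus_arg f)+

text \<open>Applying the contraction \<open>fourier\<close> twice gives back \<open>f\<close> up to reflection, so neither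
  application can decrease the norm.\<close>

theorem Plancherel:
  assumes f: "f \<in> L2"
  shows "L2_norm_sq (fourier f) = L2_norm_sq f"
proof (rule antisym[OF fourier_norm_le[OF f]])
  note [measurable] = L2_measurable[OF f] L2_measurable[OF fourier_L2(1)[OF fourier_L2(1)[OF f]]]
  have "L2_norm_sq f = L2_norm_sq (\<lambda>x. f (- x))"
    by (rule L2_uminus_arg(2)[OF f, symmetric])
  also have "\<dots> = L2_norm_sq (fourier (fourier f))"
    by (rule L2_norm_sq_cong_AE[symmetric]) (use fourier_inversion[OF f] in auto)
  also have "\<dots> \<le> L2_norm_sq (fourier f)"
    by (rule fourier_norm_le[OF fourier_L2(1)[OF f]])
  finally show "L2_norm_sq f \<le> L2_norm_sq (fourier f)" .
qed

section \<open>The energy space\<close>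

text \<open>The Fourier transforms of the form domain.\<close>

definition energy_dom :: "real \<Rightarrow> (real \<Rightarrow> complex) set" where
  "energy_dom b = {g \<in> L2. (\<lambda>k. of_real (2 * cosh (pi * b * k)) * g k) \<in> L2}"

definition ift :: "(real \<Rightarrow> complex) \<Rightarrow> real \<Rightarrow> complex" where
  "ift g x = ft g (- x)"

definition sinh_mult :: "real \<Rightarrow> (real \<Rightarrow> complex) \<Rightarrow> real \<Rightarrow> complex" where
  "sinh_mult b g k = of_real (2 * sinh (pi * b * k)) * g k"

definition cosh_mult :: "real \<Rightarrow> (real \<Rightarrow> complex) \<Rightarrow> real \<Rightarrow> complex" where
  "cosh_mult b g k = of_real (2 * cosh (pi * b * k)) * g k"

lemma sinh_measurable [measurable]: "(sinh :: real \<Rightarrow> real) \<in> borel_measurable borel"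
  by (intro borel_measurable_continuous_onI continuous_intros)

lemma cosh_measurable [measurable]: "(cosh :: real \<Rightarrow> real) \<in> borel_measurable borel"
  by (intro borel_measurable_continuous_onI continuous_intros)

lemma energy_dom_iff: "g \<in> energy_dom b \<longleftrightarrow> g \<in> L2 \<and> cosh_mult b g \<in> L2"
  by (simp add: energy_dom_def cosh_mult_def[abs_def])

lemma energy_dom_L2: "g \<in> energy_dom b \<Longrightarrow> g \<in> L2"
  by (simp add: energy_dom_iff)

lemma sinh_mult_lincomb: "sinh_mult b (\<lambda>k. g k + c * h k) = (\<lambda>k. sinh_mult b g k + c * sinh_mult b h k)"
  by (auto simp: sinh_mult_def algebra_simps)

lemma cosh_mult_lincomb: "cosh_mult b (\<lambda>k. g k + c * h k) = (\<lambda>k. cosh_mult b g k + c * cosh_mult b h k)"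
  by (auto simp: cosh_mult_def algebra_simps)

lemma energy_dom_lincomb:
  "g \<in> energy_dom b \<Longrightarrow> h \<in> energy_dom b \<Longrightarrow> (\<lambda>k. g k + c * h k) \<in> energy_dom b"
  by (simp add: energy_dom_iff L2_lincomb cosh_mult_lincomb)

lemma energy_dom_diff:
  "g \<in> energy_dom b \<Longrightarrow> h \<in> energy_dom b \<Longrightarrow> (\<lambda>k. g k - h k) \<in> energy_dom b"
  using energy_dom_lincomb[of g b h "-1"] by simp

lemma abs_sinh_le_cosh: "\<bar>sinh t\<bar> \<le> cosh (t :: real)"
  using sinh_le_cosh_real[of t] sinh_le_cosh_real[of "- t"] by auto

lemma one_le_two_cosh: "1 + t\<^sup>2 / 2 \<le> 2 * cosh (t :: real)"
proof -
  have "1 + \<bar>t\<bar> + \<bar>t\<bar>\<^sup>2 / 2 \<le> exp \<bar>t\<bar>" by (rule exp_lower_Taylor_quadratic) simp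
  also have "exp \<bar>t\<bar> \<le> exp \<bar>t\<bar> + exp (- \<bar>t\<bar>)" by simp
  also have "\<dots> = 2 * cosh \<bar>t\<bar>" by (simp add: cosh_field_def)
  also have "\<dots> = 2 * cosh t" by simp
  finally show ?thesis by simp
qed

text \<open>The product is \<open>cosh_mult b g\<close> times the bounded function \<open>m k / (2 cosh (\<pi> b k))\<close>.\<close>

lemma cosh_dominated_mult:
  assumes g: "cosh_mult b g \<in> L2" and m: "m \<in> borel_measurable borel"
    and le: "\<And>k. cmod (m k) \<le> C * (2 * cosh (pi * b * k))"
  shows "(\<lambda>k. m k * g k) \<in> L2" "L2_norm_sq (\<lambda>k. m k * g k) \<le> C\<^sup>2 * L2_norm_sq (cosh_mult b g)"
proof -
  have c: "2 * cosh (pi * b * k) > 0" for k by simp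
  have eq: "(\<lambda>k. m k * g k) = (\<lambda>k. (m k / of_real (2 * cosh (pi * b * k))) * cosh_mult b g k)"
    using c by (intro ext) (simp add: cosh_mult_def del: of_real_mult)
  have mm: "(\<lambda>k. m k / of_real (2 * cosh (pi * b * k))) \<in> borel_measurable borel"
    using m by measurable
  have bb: "cmod (m k / of_real (2 * cosh (pi * b * k))) \<le> C" for k
    using le[of k] c[of k] by (simp add: norm_divide divide_le_eq del: of_real_mult)
  show "(\<lambda>k. m k * g k) \<in> L2" "L2_norm_sq (\<lambda>k. m k * g k) \<le> C\<^sup>2 * L2_norm_sq (cosh_mult b g)"
    unfolding eq by (rule L2_mult_bounded[OF g mm bb])+
qed

lemma sinh_mult_L2: "g \<in> energy_dom b \<Longrightarrow> sinh_mult b g \<in> L2"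
  using cosh_dominated_mult(1)[of b g "\<lambda>k. of_real (2 * sinh (pi * b * k))" 1]
  by (simp add: energy_dom_iff sinh_mult_def[abs_def] abs_sinh_le_cosh norm_mult)

lemma energy_dom_I_cosh:
  assumes "cosh_mult b g \<in> L2"
  shows "g \<in> energy_dom b" "L2_norm_sq g \<le> L2_norm_sq (cosh_mult b g)"
    "L2_norm_sq (sinh_mult b g) \<le> L2_norm_sq (cosh_mult b g)"
proof -
  have 1: "1 \<le> 2 * cosh (t :: real)" for t
    using cosh_real_ge_1[of t] by linarith
  show "g \<in> energy_dom b" "L2_norm_sq g \<le> L2_norm_sq (cosh_mult b g)"
    using cosh_dominated_mult[OF assms, of "\<lambda>_. 1" 1] assms 1 by (auto simp: energy_dom_iff)
  show "L2_norm_sq (sinh_mult b g) \<le> L2_norm_sq (cosh_mult b g)"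
    using cosh_dominated_mult(2)[OF assms, of "\<lambda>k. of_real (2 * sinh (pi * b * k))" 1]
    by (simp add: sinh_mult_def[abs_def] abs_sinh_le_cosh norm_mult)
qed

lemma cosh_mult_norm:
  assumes g: "g \<in> energy_dom b"
  shows "L2_norm_sq (cosh_mult b g) = 4 * L2_norm_sq g + L2_norm_sq (sinh_mult b g)"
proof -
  have "(cmod (cosh_mult b g k))\<^sup>2 = 4 * (cmod (g k))\<^sup>2 + (cmod (sinh_mult b g k))\<^sup>2" for k
    by (simp add: cosh_mult_def sinh_mult_def norm_mult power_mult_distrib cosh_square_eq algebra_simps)
  then show ?thesis
    using L2_integrable_sq[OF energy_dom_L2[OF g]] L2_integrable_sq[OF sinh_mult_L2[OF g]]
    by (simp add: L2_norm_sq_def)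
qed

subsection \<open>Sobolev-type bounds\<close>

text \<open>The value is \<open>\<pi>\<close>.\<close>

definition lorentz_const :: real where
  "lorentz_const = (LINT k|lborel. 1 / (1 + k\<^sup>2))"

lemma lorentz_integrable: "integrable lborel (\<lambda>k::real. 1 / (1 + k\<^sup>2))"
  using integrable_inverse_1_plus_square
  by (simp add: set_integrable_def inverse_eq_divide einterval_eq)

lemma lorentz_const_nonneg: "0 \<le> lorentz_const"
  unfolding lorentz_const_def by (intro Bochner_Integration.integral_nonneg) auto

lemma lorentz_scaled:
  assumes m: "m > 0"
  shows "(\<lambda>k. of_real (1 / sqrt (m\<^sup>2 + k\<^sup>2))) \<in> L2"
    and "L2_norm_sq (\<lambda>k. of_real (1 / sqrt (m\<^sup>2 + k\<^sup>2))) = lorentz_const / m"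
proof -
  have sq: "(cmod (of_real (1 / sqrt (m\<^sup>2 + k\<^sup>2))))\<^sup>2 = 1 / (m\<^sup>2 + k\<^sup>2)" for k
    by (simp add: norm_divide power_divide add_nonneg_nonneg)
  have eq: "1 / (m\<^sup>2 + k\<^sup>2) = 1 / m\<^sup>2 * (1 / (1 + (0 + 1 / m * k)\<^sup>2))" for k
    using m by (simp add: field_simps)
  have "integrable lborel (\<lambda>k. 1 / (1 + (0 + 1 / m * k)\<^sup>2))"
    using m by (intro lborel_integrable_real_affine[OF lorentz_integrable]) simp
  then show "(\<lambda>k. of_real (1 / sqrt (m\<^sup>2 + k\<^sup>2))) \<in> L2"
    unfolding L2_def mem_Collect_eq sq unfolding eq by (intro conjI integrable_mult_right) auto
  have "L2_norm_sq (\<lambda>k. of_real (1 / sqrt (m\<^sup>2 + k\<^sup>2))) = 1 / m\<^sup>2 * (LINT k|lborel. 1 / (1 + (0 + 1 / m * k)\<^sup>2))"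
    unfolding L2_norm_sq_def sq unfolding eq by (rule integral_mult_right_zero)
  also have "\<dots> = lorentz_const / m"
    using m lborel_integral_real_affine[of "1 / m" "\<lambda>k. 1 / (1 + k\<^sup>2)" 0]
    by (simp add: lorentz_const_def power2_eq_square field_simps)
  finally show "L2_norm_sq (\<lambda>k. of_real (1 / sqrt (m\<^sup>2 + k\<^sup>2))) = lorentz_const / m" .
qed

text \<open>Both Sobolev bounds come from Cauchy--Schwarz against \<open>(m\<^sup>2 + k\<^sup>2)\<^sup>-\<^sup>1\<^sup>/\<^sup>2\<close>. In the first,
  the parameter \<open>m\<close> makes the kinetic contribution as small as desired.\<close>

lemma energy_L1_bound:
  assumes b: "b > 0" and g: "g \<in> energy_dom b" and m: "m > 0"
  shows "integrable lborel g"
    and "(LINT k|lborel. cmod (g k))\<^sup>2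
      \<le> lorentz_const / m * (m\<^sup>2 * L2_norm_sq g + L2_norm_sq (sinh_mult b g) / (4 * pi\<^sup>2 * b\<^sup>2))"
proof -
  note [measurable] = L2_measurable[OF energy_dom_L2[OF g]]
  let ?u = "\<lambda>k. complex_of_real (1 / sqrt (m\<^sup>2 + k\<^sup>2))"
  let ?v = "\<lambda>k. complex_of_real (sqrt (m\<^sup>2 + k\<^sup>2)) * g k"
  let ?h = "\<lambda>k. m\<^sup>2 * (cmod (g k))\<^sup>2 + (cmod (sinh_mult b g k))\<^sup>2 / (4 * pi\<^sup>2 * b\<^sup>2)"
  have pos: "m\<^sup>2 + k\<^sup>2 > 0" for k using m by (simp add: add_pos_nonneg)
  have hi: "integrable lborel ?h"
    using L2_integrable_sq[OF energy_dom_L2[OF g]] L2_integrable_sq[OF sinh_mult_L2[OF g]] by auto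
  have vh: "(cmod (?v k))\<^sup>2 \<le> ?h k" for k
  proof -
    have "\<bar>pi * b * k\<bar>\<^sup>2 \<le> \<bar>sinh (pi * b * k)\<bar>\<^sup>2"
      using real_le_abs_sinh[of "pi * b * k"]
      by (intro power_mono) (auto simp: sinh_field_def exp_minus)
    then have "k\<^sup>2 \<le> (2 * sinh (pi * b * k))\<^sup>2 / (4 * pi\<^sup>2 * b\<^sup>2)"
      using b by (simp add: field_simps power_mult_distrib)
    then have "k\<^sup>2 * (cmod (g k))\<^sup>2 \<le> (2 * sinh (pi * b * k))\<^sup>2 / (4 * pi\<^sup>2 * b\<^sup>2) * (cmod (g k))\<^sup>2"
      by (intro mult_right_mono) auto
    moreover have "(cmod (?v k))\<^sup>2 = m\<^sup>2 * (cmod (g k))\<^sup>2 + k\<^sup>2 * (cmod (g k))\<^sup>2"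
      using pos[of k] by (simp add: norm_mult power_mult_distrib algebra_simps)
    moreover have "(cmod (sinh_mult b g k))\<^sup>2 = (2 * sinh (pi * b * k))\<^sup>2 * (cmod (g k))\<^sup>2"
      by (simp add: sinh_mult_def norm_mult power_mult_distrib)
    ultimately show ?thesis by simp
  qed
  have v: "?v \<in> L2"
    by (rule L2I_dominated[OF _ hi vh]) measurable
  have uv: "?u k * ?v k = g k" for k
    using pos[of k] m by (simp add: mult.assoc[symmetric] of_real_mult[symmetric] del: of_real_mult)
  have "integrable lborel (\<lambda>k. ?u k * ?v k)"
    by (rule L2_mult_integrable[OF lorentz_scaled(1)[OF m] v])
  then show "integrable lborel g" unfolding uv .
  have "(LINT k|lborel. cmod (g k))\<^sup>2 = (LINT k|lborel. cmod (?u k) * cmod (?v k))\<^sup>2"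
    unfolding norm_mult[symmetric] uv ..
  also have "\<dots> \<le> L2_norm_sq ?u * L2_norm_sq ?v"
    by (rule L2_Cauchy_Schwarz[OF lorentz_scaled(1)[OF m] v])
  also have "\<dots> \<le> lorentz_const / m * (LINT k|lborel. ?h k)"
    unfolding lorentz_scaled(2)[OF m] using m lorentz_const_nonneg
    by (intro mult_left_mono) (auto simp: L2_norm_sq_def intro!: integral_mono hi vh L2_integrable_sq[OF v])
  also have "(LINT k|lborel. ?h k) = m\<^sup>2 * L2_norm_sq g + L2_norm_sq (sinh_mult b g) / (4 * pi\<^sup>2 * b\<^sup>2)"
    using L2_integrable_sq[OF energy_dom_L2[OF g]] L2_integrable_sq[OF sinh_mult_L2[OF g]]
    by (simp add: L2_norm_sq_def)
  finally show "(LINT k|lborel. cmod (g k))\<^sup>2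
      \<le> lorentz_const / m * (m\<^sup>2 * L2_norm_sq g + L2_norm_sq (sinh_mult b g) / (4 * pi\<^sup>2 * b\<^sup>2))" .
qed

lemmas energy_dom_integrable = energy_L1_bound(1)[OF _ _ zero_less_one]

lemma ift_bound: "integrable lborel g \<Longrightarrow> cmod (ift g x) \<le> (LINT k|lborel. cmod (g k))"
  unfolding ift_def by (rule ft_bound)

lemma ift_measurable: "g \<in> borel_measurable borel \<Longrightarrow> ift g \<in> borel_measurable borel"
  unfolding ift_def[abs_def]
  by (rule measurable_compose[OF borel_measurable_uminus[OF measurable_ident_sets[OF refl]] ft_measurable])

lemma ift_lincomb:
  assumes "integrable lborel g" "integrable lborel h"
  shows "ift (\<lambda>k. g k + c * h k) x = ift g x + c * ift h x"
  unfolding ift_def by (rule ft_lincomb[OF assms])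

lemma ift_diff:
  assumes "integrable lborel g" "integrable lborel h"
  shows "ift (\<lambda>k. g k - h k) x = ift g x - ift h x"
  unfolding ift_def by (rule ft_diff[OF assms])

lemma cmod_character_diff_le:
  "cmod (exp (- 2 * complex_of_real pi * \<i> * of_real s * of_real k)
     - exp (- 2 * complex_of_real pi * \<i> * of_real t * of_real k)) \<le> 2 * pi * \<bar>s - t\<bar> * \<bar>k\<bar>"
proof -
  have e: "exp (- 2 * complex_of_real pi * \<i> * of_real s * of_real k) = iexp (- 2 * pi * s * k)" for s
    by (simp add: mult_ac)
  have "iexp (- 2 * pi * s * k) - iexp (- 2 * pi * t * k)
      = iexp (- 2 * pi * t * k) * (iexp (- 2 * pi * (s - t) * k) - 1)"
    by (simp add: right_diff_distrib mult_exp_exp algebra_simps)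
  then have "cmod (iexp (- 2 * pi * s * k) - iexp (- 2 * pi * t * k)) = cmod (iexp (- 2 * pi * (s - t) * k) - 1)"
    by (simp add: norm_mult del: of_real_mult)
  also have "\<dots> \<le> \<bar>- 2 * pi * (s - t) * k\<bar>"
    using iexp_approx1[of "- 2 * pi * (s - t) * k" 0] by simp
  finally show ?thesis unfolding e by (simp add: abs_mult)
qed

text \<open>Since \<open>cosh\<close> grows faster than \<open>1 + k\<^sup>2\<close>, also \<open>k * g k\<close> is integrable, uniformly over sets of
  bounded energy.\<close>

lemma ift_Lipschitz:
  assumes b: "b > 0" and g: "g \<in> energy_dom b"
  shows "(cmod (ift g x - ift g y))\<^sup>2
     \<le> (2 * pi * \<bar>x - y\<bar>)\<^sup>2 * (lorentz_const * ((1 + 2 / (pi * b)\<^sup>2)\<^sup>2 * L2_norm_sq (cosh_mult b g)))"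
proof -
  note [measurable] = L2_measurable[OF energy_dom_L2[OF g]]
  have cg: "cosh_mult b g \<in> L2" using g by (simp add: energy_dom_iff)
  define C where "C = 1 + 2 / (pi * b)\<^sup>2"
  let ?u = "\<lambda>k. complex_of_real (1 / sqrt (1\<^sup>2 + k\<^sup>2))"
  let ?v = "\<lambda>k. complex_of_real (1 + k\<^sup>2) * g k"
  have le: "cmod (complex_of_real (1 + k\<^sup>2)) \<le> C * (2 * cosh (pi * b * k))" for k
  proof -
    have pb: "(pi * b)\<^sup>2 > 0" using b by simp
    have "1 + k\<^sup>2 \<le> C * (1 + (pi * b * k)\<^sup>2 / 2)"
      using pb b by (simp add: C_def field_simps power_mult_distrib)
    also have "\<dots> \<le> C * (2 * cosh (pi * b * k))"
      by (intro mult_left_mono one_le_two_cosh) (simp add: C_def)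
    finally show ?thesis by (simp only: norm_of_real) simp
  qed
  have v: "?v \<in> L2" "L2_norm_sq ?v \<le> C\<^sup>2 * L2_norm_sq (cosh_mult b g)"
    by (rule cosh_dominated_mult[OF cg _ le], measurable)+
  have u: "?u \<in> L2" "L2_norm_sq ?u = lorentz_const"
    using lorentz_scaled[of 1] by simp_all
  have kuv: "\<bar>k\<bar> * cmod (g k) \<le> cmod (?u k) * cmod (?v k)" for k
  proof -
    have p: "1 + k\<^sup>2 > 0" by (simp add: add_pos_nonneg)
    have "\<bar>k\<bar> = sqrt (k\<^sup>2)" by simp
    also have "\<dots> \<le> sqrt (1 + k\<^sup>2)" by (intro real_sqrt_le_mono) simp
    also have "\<dots> = (1 / sqrt (1 + k\<^sup>2)) * (1 + k\<^sup>2)"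
      using p by (simp add: real_div_sqrt)
    finally have "\<bar>k\<bar> * cmod (g k) \<le> (1 / sqrt (1 + k\<^sup>2)) * (1 + k\<^sup>2) * cmod (g k)"
      by (intro mult_right_mono) auto
    also have "\<dots> = cmod (?u k) * cmod (?v k)"
      unfolding norm_mult norm_of_real using p by simp
    finally show ?thesis .
  qed
  have uvi: "integrable lborel (\<lambda>k. cmod (?u k) * cmod (?v k))"
    using integrable_norm[OF L2_mult_integrable[OF u(1) v(1)]] by (simp only: norm_mult)
  have gi: "integrable lborel g" by (rule energy_dom_integrable[OF b g])
  let ?E = "\<lambda>s k. exp (- 2 * complex_of_real pi * \<i> * of_real s * of_real k)"
  have "cmod (ift g x - ift g y) = cmod (LINT k|lborel. (?E (- x) k - ?E (- y) k) * g k)"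
    unfolding ift_def ft_def left_diff_distrib
    by (subst Bochner_Integration.integral_diff[OF integrable_character_mult[OF gi] integrable_character_mult[OF gi]]) simp
  also have "\<dots> \<le> (LINT k|lborel. 2 * pi * \<bar>x - y\<bar> * (cmod (?u k) * cmod (?v k)))"
  proof (rule order_trans[OF integral_norm_bound], rule integral_mono)
    show "integrable lborel (\<lambda>k. cmod ((?E (- x) k - ?E (- y) k) * g k))"
      unfolding left_diff_distrib
      by (intro integrable_norm Bochner_Integration.integrable_diff integrable_character_mult gi)
    show "integrable lborel (\<lambda>k. 2 * pi * \<bar>x - y\<bar> * (cmod (?u k) * cmod (?v k)))"
      by (intro integrable_mult_right uvi)
    fix k
    have "cmod (?E (- x) k - ?E (- y) k) \<le> 2 * pi * \<bar>x - y\<bar> * \<bar>k\<bar>"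
      using cmod_character_diff_le[of "- x" k "- y"] by (simp add: abs_minus_commute)
    then have "cmod ((?E (- x) k - ?E (- y) k) * g k) \<le> 2 * pi * \<bar>x - y\<bar> * \<bar>k\<bar> * cmod (g k)"
      unfolding norm_mult by (rule mult_right_mono) simp
    also have "\<dots> \<le> 2 * pi * \<bar>x - y\<bar> * (cmod (?u k) * cmod (?v k))"
      unfolding mult.assoc[of _ "\<bar>k\<bar>"] by (intro mult_left_mono kuv) simp
    finally show "cmod ((?E (- x) k - ?E (- y) k) * g k) \<le> 2 * pi * \<bar>x - y\<bar> * (cmod (?u k) * cmod (?v k))" .
  qed
  also have "\<dots> = 2 * pi * \<bar>x - y\<bar> * (LINT k|lborel. cmod (?u k) * cmod (?v k))"
    by (rule integral_mult_right_zero)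
  finally have "(cmod (ift g x - ift g y))\<^sup>2
      \<le> (2 * pi * \<bar>x - y\<bar> * (LINT k|lborel. cmod (?u k) * cmod (?v k)))\<^sup>2"
    by (intro power_mono) auto
  also have "\<dots> = (2 * pi * \<bar>x - y\<bar>)\<^sup>2 * (LINT k|lborel. cmod (?u k) * cmod (?v k))\<^sup>2"
    by (rule power_mult_distrib)
  also have "\<dots> \<le> (2 * pi * \<bar>x - y\<bar>)\<^sup>2 * (lorentz_const * (C\<^sup>2 * L2_norm_sq (cosh_mult b g)))"
  proof (rule mult_left_mono)
    have "(LINT k|lborel. cmod (?u k) * cmod (?v k))\<^sup>2 \<le> L2_norm_sq ?u * L2_norm_sq ?v"
      by (rule L2_Cauchy_Schwarz[OF u(1) v(1)])
    also have "\<dots> \<le> lorentz_const * (C\<^sup>2 * L2_norm_sq (cosh_mult b g))"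
      unfolding u(2) by (intro mult_left_mono v lorentz_const_nonneg)
    finally show "(LINT k|lborel. cmod (?u k) * cmod (?v k))\<^sup>2 \<le> lorentz_const * (C\<^sup>2 * L2_norm_sq (cosh_mult b g))" .
  qed simp
  finally show ?thesis unfolding C_def .
qed

section \<open>The quadratic form on the Fourier side\<close>

definition pot :: "(real \<Rightarrow> real) \<Rightarrow> (real \<Rightarrow> complex) \<Rightarrow> real" where
  "pot V g = (LINT x|lborel. V x * (cmod (ift g x))\<^sup>2)"

text \<open>For \<open>s = 2 - \<mu>\<close> and \<open>g = fourier \<psi>\<close> this is \<open>qform b V \<psi> - \<mu> * L2_norm_sq \<psi>\<close>.\<close>

definition shifted_form :: "real \<Rightarrow> real \<Rightarrow> (real \<Rightarrow> real) \<Rightarrow> (real \<Rightarrow> complex) \<Rightarrow> real" where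
  "shifted_form b s V g = s * L2_norm_sq g + L2_norm_sq (sinh_mult b g) - pot V g"

definition shifted_sesq :: "real \<Rightarrow> real \<Rightarrow> (real \<Rightarrow> real) \<Rightarrow> (real \<Rightarrow> complex) \<Rightarrow> (real \<Rightarrow> complex) \<Rightarrow> complex" where
  "shifted_sesq b s V h g = of_real s * L2_inner h g + L2_inner (sinh_mult b h) (sinh_mult b g)
     - (LINT x|lborel. of_real (V x) * (cnj (ift h x) * ift g x))"

lemma cmod_sq_expand:
  "(cmod (u + c * v))\<^sup>2 = (cmod u)\<^sup>2 + 2 * Re (cnj c * (cnj v * u)) + (cmod c)\<^sup>2 * (cmod v)\<^sup>2"
proof -
  have "(cmod (u + c * v))\<^sup>2 = (cmod u)\<^sup>2 + 2 * Re (cnj c * (cnj v * u)) + (cmod (c * v))\<^sup>2"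
    unfolding cmod_power2 by (simp add: power2_eq_square algebra_simps)
  then show ?thesis by (simp add: norm_mult power_mult_distrib)
qed

lemma L2_norm_sq_expand:
  assumes f: "f \<in> L2" and h: "h \<in> L2"
  shows "L2_norm_sq (\<lambda>x. f x + c * h x)
    = L2_norm_sq f + 2 * Re (cnj c * L2_inner h f) + (cmod c)\<^sup>2 * L2_norm_sq h"
proof -
  have i: "integrable lborel (\<lambda>x. cnj c * (cnj (h x) * f x))"
    by (intro integrable_mult_right L2_mult_integrable L2_cnj f h)
  have "(LINT x|lborel. Re (cnj c * (cnj (h x) * f x))) = Re (cnj c * L2_inner h f)"
    using integral_Re[OF i] by (simp only: integral_mult_right_zero L2_inner_def)
  then show ?thesis
    using L2_integrable_sq[OF f] L2_integrable_sq[OF h] integrable_Re[OF i]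
    unfolding L2_norm_sq_def cmod_sq_expand
    by (simp del: Re_complex_of_real times_complex.sel)
qed

lemma pot_integrable:
  assumes V: "integrable lborel V" and g: "integrable lborel g" and h: "integrable lborel h"
  shows "integrable lborel (\<lambda>x. of_real (V x) * (cnj (ift h x) * ift g x) :: complex)"
proof (rule Bochner_Integration.integrable_bound)
  note [measurable] = borel_measurable_integrable[OF V] borel_measurable_integrable[OF g] borel_measurable_integrable[OF h]
  let ?G = "LINT k|lborel. cmod (g k)" and ?H = "LINT k|lborel. cmod (h k)"
  show "integrable lborel (\<lambda>x. \<bar>V x\<bar> * (?H * ?G))"
    using V by (intro integrable_mult_left integrable_abs)
  have [measurable]: "ift g \<in> borel_measurable borel" "ift h \<in> borel_measurable borel"
    by (auto intro!: ift_measurable)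
  show "(\<lambda>x. of_real (V x) * (cnj (ift h x) * ift g x) :: complex) \<in> borel_measurable lborel"
    by measurable
  show "AE x in lborel. norm (of_real (V x) * (cnj (ift h x) * ift g x) :: complex) \<le> norm (\<bar>V x\<bar> * (?H * ?G))"
  proof (intro AE_I2)
    fix x
    have "cmod (ift h x) * cmod (ift g x) \<le> ?H * ?G"
      using ift_bound[OF g, of x] ift_bound[OF h, of x]
      by (intro mult_mono) (auto intro: order_trans[OF norm_ge_zero])
    then have "\<bar>V x\<bar> * (cmod (ift h x) * cmod (ift g x)) \<le> \<bar>V x\<bar> * (?H * ?G)"
      by (rule mult_left_mono) simp
    then show "norm (of_real (V x) * (cnj (ift h x) * ift g x) :: complex) \<le> norm (\<bar>V x\<bar> * (?H * ?G))"
      by (simp add: norm_mult) 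
  qed
qed

lemma pot_sq_integrable:
  assumes "integrable lborel V" "integrable lborel g"
  shows "integrable lborel (\<lambda>x. V x * (cmod (ift g x))\<^sup>2)"
proof -
  have "integrable lborel (\<lambda>x. complex_of_real (V x * (cmod (ift g x))\<^sup>2))"
    using pot_integrable[OF assms assms(2)] unfolding cnj_mult_self of_real_mult[symmetric] .
  then show ?thesis by (rule complex_of_real_integrable_eq[THEN iffD1])
qed

lemma pot_expand:
  assumes V: "integrable lborel V" and g: "integrable lborel g" and h: "integrable lborel h"
  shows "pot V (\<lambda>k. g k + c * h k)
    = pot V g + 2 * Re (cnj c * (LINT x|lborel. of_real (V x) * (cnj (ift h x) * ift g x))) + (cmod c)\<^sup>2 * pot V h"
proof -
  note i = integrable_mult_right[OF pot_integrable[OF V g h], of "cnj c"]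
  have R: "Re (cnj c * (of_real v * z)) = v * Re (cnj c * z)" for v z
    by (simp add: algebra_simps)
  have "(LINT x|lborel. V x * Re (cnj c * (cnj (ift h x) * ift g x)))
      = Re (cnj c * (LINT x|lborel. of_real (V x) * (cnj (ift h x) * ift g x)))"
    unfolding R[symmetric] integral_mult_right_zero[symmetric] by (rule integral_Re[OF i])
  moreover have "integrable lborel (\<lambda>x. V x * Re (cnj c * (cnj (ift h x) * ift g x)))"
    using integrable_Re[OF i] unfolding R .
  moreover have "V x * (cmod (ift (\<lambda>k. g k + c * h k) x))\<^sup>2
     = V x * (cmod (ift g x))\<^sup>2 + 2 * (V x * Re (cnj c * (cnj (ift h x) * ift g x)))
       + (cmod c)\<^sup>2 * (V x * (cmod (ift h x))\<^sup>2)" for x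
    unfolding ift_lincomb[OF g h] cmod_sq_expand by (simp only: algebra_simps)
  ultimately show ?thesis
    using pot_sq_integrable[OF V g] pot_sq_integrable[OF V h] unfolding pot_def
    by (simp del: Re_complex_of_real times_complex.sel)
qed

lemma shifted_form_expand:
  assumes b: "b > 0" and V: "integrable lborel V" and g: "g \<in> energy_dom b" and h: "h \<in> energy_dom b"
  shows "shifted_form b s V (\<lambda>k. g k + c * h k)
    = shifted_form b s V g + 2 * Re (cnj c * shifted_sesq b s V h g) + (cmod c)\<^sup>2 * shifted_form b s V h"
proof -
  have lin: "Re (cnj c * (of_real s * x + y - z)) = s * Re (cnj c * x) + Re (cnj c * y) - Re (cnj c * z)" for x y z
    by (simp add: algebra_simps)
  show ?thesis
    unfolding shifted_form_def shifted_sesq_def lin sinh_mult_lincomb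
      L2_norm_sq_expand[OF energy_dom_L2[OF g] energy_dom_L2[OF h]]
      L2_norm_sq_expand[OF sinh_mult_L2[OF g] sinh_mult_L2[OF h]]
      pot_expand[OF V energy_dom_integrable[OF b g] energy_dom_integrable[OF b h]]
    by (simp only: algebra_simps)
qed

lemma shifted_form_parallelogram:
  assumes b: "b > 0" and V: "integrable lborel V" and g: "g \<in> energy_dom b" and h: "h \<in> energy_dom b"
  shows "shifted_form b s V (\<lambda>k. g k + h k) + shifted_form b s V (\<lambda>k. g k - h k)
    = 2 * shifted_form b s V g + 2 * shifted_form b s V h"
  using shifted_form_expand[OF assms, of s 1] shifted_form_expand[OF assms, of s "-1"] by simp

lemma pot_le_abs:
  assumes V: "integrable lborel V" and g: "integrable lborel g"
  shows "\<bar>pot V g\<bar> \<le> pot (\<lambda>x. \<bar>V x\<bar>) g"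
  using integral_norm_bound[of lborel "\<lambda>x. V x * (cmod (ift g x))\<^sup>2"]
  by (simp add: pot_def abs_mult)

lemma pot_abs_bound:
  assumes V: "integrable lborel V" and g: "integrable lborel g"
  shows "pot (\<lambda>x. \<bar>V x\<bar>) g \<le> (LINT x|lborel. \<bar>V x\<bar>) * (LINT k|lborel. cmod (g k))\<^sup>2"
proof -
  have "pot (\<lambda>x. \<bar>V x\<bar>) g \<le> (LINT x|lborel. \<bar>V x\<bar> * (LINT k|lborel. cmod (g k))\<^sup>2)"
    unfolding pot_def
    by (intro integral_mono pot_sq_integrable integrable_abs integrable_mult_left V g mult_left_mono
        power_mono ift_bound) auto
  then show ?thesis by simp
qed

text \<open>In the bound for the integral of \<open>\<bar>g\<bar>\<close>, take the parameter \<open>m\<close> so large that the kinetic part gets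
  a coefficient at most \<open>1/2\<close>; any other positive relative bound can be reached in the same way.\<close>

lemma pot_form_bounded:
  assumes b: "b > 0" and V: "integrable lborel V"
  obtains K where "K \<ge> 0" "\<And>g. g \<in> energy_dom b \<Longrightarrow>
    pot (\<lambda>x. \<bar>V x\<bar>) g \<le> L2_norm_sq (sinh_mult b g) / 2 + K * L2_norm_sq g"
proof -
  define v where "v = (LINT x|lborel. \<bar>V x\<bar>)"
  have v: "v \<ge> 0" unfolding v_def by simp
  define q where "q = 4 * pi\<^sup>2 * b\<^sup>2"
  have q: "q > 0" using b by (simp add: q_def)
  define m where "m = 1 + 2 * v * lorentz_const / q"
  have vl: "v * lorentz_const \<ge> 0" using v lorentz_const_nonneg by simp
  then have m: "m > 0" using q by (simp add: m_def add_pos_nonneg mult.assoc)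
  show thesis
  proof (rule that)
    show "v * lorentz_const * m \<ge> 0" using vl m by simp
    fix g assume g: "g \<in> energy_dom b"
    let ?N = "L2_norm_sq g" and ?T = "L2_norm_sq (sinh_mult b g)"
    have "pot (\<lambda>x. \<bar>V x\<bar>) g \<le> v * (LINT k|lborel. cmod (g k))\<^sup>2"
      unfolding v_def by (rule pot_abs_bound[OF V energy_dom_integrable[OF b g]])
    also have "\<dots> \<le> v * (lorentz_const / m * (m\<^sup>2 * ?N + ?T / q))"
      unfolding q_def by (intro mult_left_mono energy_L1_bound b g m v)
    also have "\<dots> = v * lorentz_const * m * ?N + (v * lorentz_const / (m * q)) * ?T"
      using m q by (simp add: field_simps power2_eq_square)
    also have "(v * lorentz_const / (m * q)) * ?T \<le> 1 / 2 * ?T"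
    proof (rule mult_right_mono)
      have "2 * (v * lorentz_const) \<le> m * q" using q by (simp add: m_def field_simps)
      then show "v * lorentz_const / (m * q) \<le> 1 / 2" using m q by (simp add: field_simps)
    qed simp
    finally show "pot (\<lambda>x. \<bar>V x\<bar>) g \<le> ?T / 2 + v * lorentz_const * m * ?N" by simp
  qed
qed

subsection \<open>Compactness of the potential energy\<close>

text \<open>A diagonal subsequence converges at all rational points, and the common Lipschitz constant carries
  convergence over to every real point.\<close>

lemma equi_Lipschitz_convergent_subsequence:
  fixes u :: "nat \<Rightarrow> real \<Rightarrow> complex"
  assumes bound: "\<And>n x. cmod (u n x) \<le> B"
    and lip: "\<And>n x y. cmod (u n x - u n y) \<le> D * \<bar>x - y\<bar>" and D: "D \<ge> 0"
  obtains r :: "nat \<Rightarrow> nat" where "strict_mono r" "\<And>x. convergent (\<lambda>n. u (r n) x)"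
proof -
  obtain r :: "nat \<Rightarrow> nat" where r: "strict_mono r" "\<And>x. x \<in> (\<rat> :: real set) \<Longrightarrow> \<exists>l. (\<lambda>n. u (r n) x) \<longlonglongrightarrow> l"
    by (rule function_convergent_subsequence[of "\<rat> :: real set" u B]) (auto simp: countable_rat bound)
  have "Cauchy (\<lambda>n. u (r n) x)" for x
  proof (rule metric_CauchyI)
    fix e :: real assume e: "e > 0"
    have "x < x + e / (4 * (D + 1))" using e D by simp
    then obtain q where q: "q \<in> \<rat>" "x < q" "q < x + e / (4 * (D + 1))"
      using Rats_dense_in_real by blast
    have "D * \<bar>x - q\<bar> \<le> (D + 1) * (e / (4 * (D + 1)))"
      using q D by (intro mult_mono) auto
    also have "\<dots> = e / 4"
    proof -
      have "c * (e / (4 * c)) = e / 4" if "c > 0" for c :: real using that by simp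
      from this[of "D + 1"] D show ?thesis by linarith
    qed
    finally have near: "cmod (u n x - u n q) \<le> e / 4" for n
      using lip[of n x q] by linarith
    have "Cauchy (\<lambda>n. u (r n) q)"
      using r(2)[OF q(1)] LIMSEQ_imp_Cauchy by blast
    then obtain M where M: "\<And>m n. m \<ge> M \<Longrightarrow> n \<ge> M \<Longrightarrow> dist (u (r m) q) (u (r n) q) < e / 4"
      using metric_CauchyD[of "\<lambda>n. u (r n) q" "e / 4"] e by auto
    have "dist (u (r m) x) (u (r n) x) < e" if "m \<ge> M" "n \<ge> M" for m n
    proof -
      have "cmod (u (r m) x - u (r n) x) \<le> cmod (u (r m) x - u (r m) q) + cmod (u (r m) q - u (r n) q) + cmod (u (r n) x - u (r n) q)"
        using norm_triangle_ineq[of "u (r m) x - u (r m) q" "u (r m) q - u (r n) q"]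
          norm_triangle_ineq4[of "u (r m) x - u (r n) q" "u (r n) x - u (r n) q"] by simp
      then show ?thesis
        using near[of "r m"] near[of "r n"] M[OF that] e unfolding dist_norm by linarith
    qed
    then show "\<exists>M. \<forall>m\<ge>M. \<forall>n\<ge>M. dist (u (r m) x) (u (r n) x) < e" by blast
  qed
  then show thesis using that r(1) by (simp add: Cauchy_convergent_iff)
qed

text \<open>Bounded energy makes the functions \<open>ift (g n)\<close> uniformly bounded and uniformly Lipschitz, so
  that a subsequence converges pointwise; dominated convergence against \<open>\<bar>V\<bar>\<close> does the rest.\<close>

lemma pot_compact:
  assumes b: "b > 0" and V: "integrable lborel V" and g: "\<And>n. g n \<in> energy_dom b"
    and A: "\<And>n. L2_norm_sq (cosh_mult b (g n)) \<le> A"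
  obtains r :: "nat \<Rightarrow> nat" where "strict_mono r"
    "\<And>e. e > 0 \<Longrightarrow> \<exists>M. \<forall>m\<ge>M. \<forall>n\<ge>M. pot (\<lambda>x. \<bar>V x\<bar>) (\<lambda>k. g (r m) k - g (r n) k) < e"
proof -
  have gi: "integrable lborel (g n)" for n by (rule energy_dom_integrable[OF b g])
  have cg: "cosh_mult b (g n) \<in> L2" for n using g by (simp add: energy_dom_iff)
  define B where "B = sqrt (lorentz_const * (A + A / (4 * pi\<^sup>2 * b\<^sup>2)))"
  have bound: "cmod (ift (g n) x) \<le> B" for n x
  proof -
    have "(LINT k|lborel. cmod (g n k))\<^sup>2
      \<le> lorentz_const / 1 * (1\<^sup>2 * L2_norm_sq (g n) + L2_norm_sq (sinh_mult b (g n)) / (4 * pi\<^sup>2 * b\<^sup>2))"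
      by (rule energy_L1_bound(2)[OF b g zero_less_one])
    also have "\<dots> \<le> lorentz_const / 1 * (1\<^sup>2 * A + A / (4 * pi\<^sup>2 * b\<^sup>2))"
      using energy_dom_I_cosh(2,3)[OF cg[of n]] A[of n] lorentz_const_nonneg
      by (intro mult_left_mono add_mono divide_right_mono) auto
    finally have "(LINT k|lborel. cmod (g n k)) \<le> B"
      unfolding B_def by (intro real_le_rsqrt) simp
    then show ?thesis using ift_bound[OF gi, of n x] by linarith
  qed
  define D where "D = 2 * pi * sqrt (lorentz_const * ((1 + 2 / (pi * b)\<^sup>2)\<^sup>2 * A))"
  have A0: "A \<ge> 0" using A[of 0] L2_norm_sq_nonneg order_trans by blast
  have D: "D \<ge> 0" using A0 lorentz_const_nonneg by (simp add: D_def)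
  have lip: "cmod (ift (g n) x - ift (g n) y) \<le> D * \<bar>x - y\<bar>" for n x y
  proof (rule power2_le_imp_le)
    have "(cmod (ift (g n) x - ift (g n) y))\<^sup>2
       \<le> (2 * pi * \<bar>x - y\<bar>)\<^sup>2 * (lorentz_const * ((1 + 2 / (pi * b)\<^sup>2)\<^sup>2 * L2_norm_sq (cosh_mult b (g n))))"
      by (rule ift_Lipschitz[OF b g])
    also have "\<dots> \<le> (2 * pi * \<bar>x - y\<bar>)\<^sup>2 * (lorentz_const * ((1 + 2 / (pi * b)\<^sup>2)\<^sup>2 * A))"
      by (intro mult_left_mono A lorentz_const_nonneg) auto
    also have "\<dots> = (D * \<bar>x - y\<bar>)\<^sup>2"
      using A0 lorentz_const_nonneg by (simp add: D_def power_mult_distrib)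
    finally show "(cmod (ift (g n) x - ift (g n) y))\<^sup>2 \<le> (D * \<bar>x - y\<bar>)\<^sup>2" .
  qed (use D in simp)
  obtain r where r: "strict_mono r" and conv: "\<And>x. convergent (\<lambda>n. ift (g (r n)) x)"
    by (rule equi_Lipschitz_convergent_subsequence[of "\<lambda>n. ift (g n)", OF bound lip D]) blast
  define \<phi> where "\<phi> x = lim (\<lambda>n. ift (g (r n)) x)" for x
  have lim: "(\<lambda>n. ift (g (r n)) x) \<longlonglongrightarrow> \<phi> x" for x
    using conv unfolding \<phi>_def by (simp add: convergent_LIMSEQ_iff)
  have \<phi>B: "cmod (\<phi> x) \<le> B" for x
    using tendsto_upperbound[OF tendsto_norm[OF lim[of x]], of B] bound by simp
  note [measurable] = borel_measurable_integrable[OF V]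
  have [measurable]: "ift (g n) \<in> borel_measurable borel" for n
    using ift_measurable borel_measurable_integrable[OF gi] by simp
  have [measurable]: "\<phi> \<in> borel_measurable borel"
    unfolding \<phi>_def by measurable
  define a where "a n = (LINT x|lborel. \<bar>V x\<bar> * (cmod (ift (g (r n)) x - \<phi> x))\<^sup>2)" for n
  have dom: "\<bar>V x\<bar> * (cmod (ift (g (r n)) x - \<phi> x))\<^sup>2 \<le> \<bar>V x\<bar> * (2 * B)\<^sup>2" for n x
  proof (intro mult_left_mono power_mono)
    show "cmod (ift (g (r n)) x - \<phi> x) \<le> 2 * B"
      using norm_triangle_ineq4[of "ift (g (r n)) x" "\<phi> x"] bound[of "r n" x] \<phi>B[of x] by linarith
  qed auto
  have domn: "norm (\<bar>V x\<bar> * (cmod (ift (g (r n)) x - \<phi> x))\<^sup>2) \<le> \<bar>V x\<bar> * (2 * B)\<^sup>2" for n x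
    using dom[of x n] by (subst real_norm_def, subst abs_of_nonneg) simp_all
  have domi: "integrable lborel (\<lambda>x. \<bar>V x\<bar> * (2 * B)\<^sup>2)"
    by (intro integrable_mult_left integrable_abs V)
  have ai: "integrable lborel (\<lambda>x. \<bar>V x\<bar> * (cmod (ift (g (r n)) x - \<phi> x))\<^sup>2)" for n
    by (rule Bochner_Integration.integrable_bound[OF domi _ AE_I2[OF order_trans[OF domn]]]) simp_all
  have "a \<longlonglongrightarrow> (LINT (x::real)|lborel. 0)"
    unfolding a_def
  proof (rule integral_dominated_convergence[OF _ _ domi])
    show "AE x in lborel. (\<lambda>n. \<bar>V x\<bar> * (cmod (ift (g (r n)) x - \<phi> x))\<^sup>2) \<longlonglongrightarrow> 0"
    proof (intro AE_I2)
      fix x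
      have "(\<lambda>n. \<bar>V x\<bar> * (cmod (ift (g (r n)) x - \<phi> x))\<^sup>2) \<longlonglongrightarrow> \<bar>V x\<bar> * (cmod (\<phi> x - \<phi> x))\<^sup>2"
        by (intro tendsto_intros lim)
      then show "(\<lambda>n. \<bar>V x\<bar> * (cmod (ift (g (r n)) x - \<phi> x))\<^sup>2) \<longlonglongrightarrow> 0" by simp
    qed
    show "AE x in lborel. norm (\<bar>V x\<bar> * (cmod (ift (g (r n)) x - \<phi> x))\<^sup>2) \<le> \<bar>V x\<bar> * (2 * B)\<^sup>2" for n
      by (intro AE_I2 domn)
  qed simp_all
  then have a0: "a \<longlonglongrightarrow> 0" by simp
  have tri: "pot (\<lambda>x. \<bar>V x\<bar>) (\<lambda>k. g (r m) k - g (r n) k) \<le> 2 * a m + 2 * a n" for m n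
  proof -
    have "pot (\<lambda>x. \<bar>V x\<bar>) (\<lambda>k. g (r m) k - g (r n) k)
      \<le> (LINT x|lborel. 2 * (\<bar>V x\<bar> * (cmod (ift (g (r m)) x - \<phi> x))\<^sup>2) + 2 * (\<bar>V x\<bar> * (cmod (ift (g (r n)) x - \<phi> x))\<^sup>2))"
      unfolding pot_def
    proof (rule integral_mono)
      show "integrable lborel (\<lambda>x. \<bar>V x\<bar> * (cmod (ift (\<lambda>k. g (r m) k - g (r n) k) x))\<^sup>2)"
        by (intro pot_sq_integrable integrable_abs V Bochner_Integration.integrable_diff gi)
      show "integrable lborel (\<lambda>x. 2 * (\<bar>V x\<bar> * (cmod (ift (g (r m)) x - \<phi> x))\<^sup>2) + 2 * (\<bar>V x\<bar> * (cmod (ift (g (r n)) x - \<phi> x))\<^sup>2))"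
        by (intro Bochner_Integration.integrable_add integrable_mult_right ai)
      fix x
      have "(cmod (ift (g (r m)) x - ift (g (r n)) x))\<^sup>2
          \<le> 2 * (cmod (ift (g (r m)) x - \<phi> x))\<^sup>2 + 2 * (cmod (ift (g (r n)) x - \<phi> x))\<^sup>2"
        using cmod_sq_add_le[of "ift (g (r m)) x - \<phi> x" "\<phi> x - ift (g (r n)) x"]
        by (simp add: norm_minus_commute)
      from mult_left_mono[OF this, of "\<bar>V x\<bar>"]
      show "\<bar>V x\<bar> * (cmod (ift (\<lambda>k. g (r m) k - g (r n) k) x))\<^sup>2
         \<le> 2 * (\<bar>V x\<bar> * (cmod (ift (g (r m)) x - \<phi> x))\<^sup>2) + 2 * (\<bar>V x\<bar> * (cmod (ift (g (r n)) x - \<phi> x))\<^sup>2)"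
        by (simp add: ift_diff gi algebra_simps)
    qed
    also have "\<dots> = 2 * a m + 2 * a n"
      unfolding a_def using ai by simp
    finally show ?thesis .
  qed
  show thesis
  proof (rule that[OF r])
    fix e :: real assume "e > 0"
    then obtain M where M: "\<And>n. n \<ge> M \<Longrightarrow> a n < e / 4"
      using order_tendstoD(2)[OF a0, of "e / 4"] by (auto simp: eventually_sequentially)
    have "pot (\<lambda>x. \<bar>V x\<bar>) (\<lambda>k. g (r m) k - g (r n) k) < e" if "m \<ge> M" "n \<ge> M" for m n
      using tri[of m n] M[OF that(1)] M[OF that(2)] by linarith
    then show "\<exists>M. \<forall>m\<ge>M. \<forall>n\<ge>M. pot (\<lambda>x. \<bar>V x\<bar>) (\<lambda>k. g (r m) k - g (r n) k) < e" by blast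
  qed
qed

section \<open>Existence of a minimiser\<close>

lemma L2_norm_sq_scale: "L2_norm_sq (\<lambda>k. c * g k) = (cmod c)\<^sup>2 * L2_norm_sq g"
  by (simp add: L2_norm_sq_def norm_mult power_mult_distrib)

lemma shifted_form_scale:
  "shifted_form b s V (\<lambda>k. c * g k) = (cmod c)\<^sup>2 * shifted_form b s V g"
proof -
  have i: "ift (\<lambda>k. c * g k) x = c * ift g x" for x
    by (simp add: ift_def ft_def mult.left_commute[of _ c])
  have "sinh_mult b (\<lambda>k. c * g k) = (\<lambda>k. c * sinh_mult b g k)"
    by (simp add: sinh_mult_def[abs_def] mult.left_commute[of _ c])
  moreover have "pot V (\<lambda>k. c * g k) = (cmod c)\<^sup>2 * pot V g"
    by (simp add: pot_def i norm_mult power_mult_distrib mult.left_commute[of _ "(cmod c)\<^sup>2"])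
  ultimately show ?thesis by (simp add: shifted_form_def L2_norm_sq_scale algebra_simps)
qed

lemma energy_dom_cmult: "g \<in> energy_dom b \<Longrightarrow> (\<lambda>k. c * g k) \<in> energy_dom b"
  using energy_dom_lincomb[of "\<lambda>_. 0" b g c]
  by (simp add: energy_dom_iff L2_zero cosh_mult_def[abs_def])

text \<open>Along \<open>c = - t * \<beta>\<close> with \<open>t > 0\<close> small the linear term is negative and dominates the quadratic
  one.\<close>

lemma quadratic_form_minimum_stationary:
  fixes \<beta> :: complex
  assumes "\<And>c :: complex. 0 \<le> 2 * Re (cnj c * \<beta>) + (cmod c)\<^sup>2 * H"
  shows "\<beta> = 0"
proof (rule ccontr)
  assume "\<beta> \<noteq> 0"
  then have p: "(cmod \<beta>)\<^sup>2 > 0" by simp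
  define t where "t = 1 / (1 + \<bar>H\<bar>)"
  have t: "t > 0" "t * H < 1" by (simp_all add: t_def field_simps add_pos_nonneg)
  have "0 \<le> 2 * Re (cnj (of_real (- t) * \<beta>) * \<beta>) + (cmod (of_real (- t) * \<beta>))\<^sup>2 * H"
    by (rule assms)
  also have "\<dots> = t * (cmod \<beta>)\<^sup>2 * (t * H - 2)"
    unfolding norm_mult norm_of_real power_mult_distrib power2_abs
    unfolding cmod_power2 by (simp add: power2_eq_square algebra_simps)
  also have "\<dots> < 0"
    using t p by (intro mult_pos_neg) auto
  finally show False by simp
qed

text \<open>If the energy is nonnegative, then it controls itself along a minimising sequence: by the
  parallelogram law the energy of a difference is at most twice the sum of the energies, and as the
  potential energy of differences vanishes along a subsequence by compactness, the sequence is
  Cauchy in the energy norm. Its limit minimises.\<close>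

lemma shifted_form_zero_attained:
  assumes b: "b > 0" and V: "integrable lborel V" and s: "s > 0"
    and nonneg: "\<And>g. g \<in> energy_dom b \<Longrightarrow> 0 \<le> shifted_form b s V g"
    and seq: "\<And>n. g n \<in> energy_dom b" "\<And>n. L2_norm_sq (g n) = 1"
      "(\<lambda>n. shifted_form b s V (g n)) \<longlonglongrightarrow> 0"
  obtains g0 where "g0 \<in> energy_dom b" "L2_norm_sq g0 > 0" "shifted_form b s V g0 = 0"
proof -
  let ?F = "shifted_form b s V"
  obtain K where K: "K \<ge> 0" "\<And>g. g \<in> energy_dom b \<Longrightarrow>
      pot (\<lambda>x. \<bar>V x\<bar>) g \<le> L2_norm_sq (sinh_mult b g) / 2 + K * L2_norm_sq g"
    by (rule pot_form_bounded[OF b V]) blast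
  have potK: "\<bar>pot V g\<bar> \<le> L2_norm_sq (sinh_mult b g) / 2 + K * L2_norm_sq g" if "g \<in> energy_dom b" for g
    using pot_le_abs[OF V energy_dom_integrable[OF b that]] K(2)[OF that] by linarith
  obtain C where C: "\<And>n. ?F (g n) \<le> C"
    using convergent_imp_Bseq[OF convergentI[OF seq(3)]] by (metis BseqE abs_le_D1 real_norm_def)
  have A: "L2_norm_sq (cosh_mult b (g n)) \<le> 4 + 2 * (C + K)" for n
    using cosh_mult_norm[OF seq(1)[of n]] seq(2)[of n] C[of n] potK[OF seq(1)[of n]] s
    unfolding shifted_form_def by (simp add: abs_le_iff)
  obtain r :: "nat \<Rightarrow> nat" where r: "strict_mono r" and
    rpot: "\<And>e. e > 0 \<Longrightarrow> \<exists>M. \<forall>m\<ge>M. \<forall>n\<ge>M. pot (\<lambda>x. \<bar>V x\<bar>) (\<lambda>k. g (r m) k - g (r n) k) < e"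
    by (rule pot_compact[of b V g, OF b V seq(1) A]) blast
  define G where "G n = g (r n)" for n
  have G: "G n \<in> energy_dom b" "L2_norm_sq (G n) = 1" for n
    using seq by (simp_all add: G_def)
  have GF: "(\<lambda>n. ?F (G n)) \<longlonglongrightarrow> 0"
    using LIMSEQ_subseq_LIMSEQ[OF seq(3) r] by (simp add: G_def comp_def)
  have GC: "cosh_mult b (G n) \<in> L2" for n using G by (simp add: energy_dom_iff)
  have diffC: "cosh_mult b (\<lambda>k. g k - h k) = (\<lambda>k. cosh_mult b g k - cosh_mult b h k)" for g h
    using cosh_mult_lincomb[of b g "-1" h] by simp
  \<comment> \<open>The parallelogram law, with the energy of the sum dropped.\<close>
  have FL: "?F (\<lambda>k. g k - h k) \<le> 2 * ?F g + 2 * ?F h" if "g \<in> energy_dom b" "h \<in> energy_dom b" for g h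
    using shifted_form_parallelogram[OF b V that, of s] nonneg[of "\<lambda>k. g k + h k"]
      energy_dom_lincomb[OF that, of 1] by simp
  define c where "c = 1 + 4 / s"
  have c: "c > 0" using s by (simp add: c_def add_pos_pos)
  have coshF: "L2_norm_sq (cosh_mult b h) \<le> c * (?F h + pot (\<lambda>x. \<bar>V x\<bar>) h)" if h: "h \<in> energy_dom b" for h
  proof -
    let ?Q = "s * L2_norm_sq h + L2_norm_sq (sinh_mult b h)"
    have "L2_norm_sq (cosh_mult b h) = (4 / s) * (s * L2_norm_sq h) + L2_norm_sq (sinh_mult b h)"
      using cosh_mult_norm[OF h] s by simp
    also have "\<dots> \<le> (4 / s) * ?Q + ?Q"
      using s by (intro add_mono mult_left_mono) auto
    also have "\<dots> = c * ?Q" by (simp add: c_def algebra_simps)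
    also have "\<dots> \<le> c * (?F h + pot (\<lambda>x. \<bar>V x\<bar>) h)"
      using pot_le_abs[OF V energy_dom_integrable[OF b h]] c
      by (intro mult_left_mono) (auto simp: shifted_form_def)
    finally show ?thesis .
  qed
  obtain u where u: "u \<in> L2" "(\<lambda>n. L2_norm_sq (\<lambda>k. cosh_mult b (G n) k - u k)) \<longlonglongrightarrow> 0"
  proof (rule Riesz_Fischer[of "\<lambda>n. cosh_mult b (G n)", OF GC])
    fix e :: real assume e: "e > 0"
    \<comment> \<open>Five terms: the parallelogram law contributes each energy twice, the potential counts once.\<close>
    define e' where "e' = e / (5 * c)"
    have e': "e' > 0" using e c by (simp add: e'_def)
    obtain M1 where M1: "\<And>n. n \<ge> M1 \<Longrightarrow> ?F (G n) < e'"
      using order_tendstoD(2)[OF GF e'] by (auto simp: eventually_sequentially)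
    obtain M2 where M2: "\<And>m n. m \<ge> M2 \<Longrightarrow> n \<ge> M2 \<Longrightarrow> pot (\<lambda>x. \<bar>V x\<bar>) (\<lambda>k. G m k - G n k) < e'"
      using rpot[OF e'] unfolding G_def by blast
    have "L2_norm_sq (\<lambda>k. cosh_mult b (G m) k - cosh_mult b (G n) k) < e"
      if "m \<ge> max M1 M2" "n \<ge> max M1 M2" for m n
    proof -
      have "L2_norm_sq (\<lambda>k. cosh_mult b (G m) k - cosh_mult b (G n) k)
          \<le> c * (?F (\<lambda>k. G m k - G n k) + pot (\<lambda>x. \<bar>V x\<bar>) (\<lambda>k. G m k - G n k))"
        using coshF[OF energy_dom_diff[OF G(1)[of m] G(1)[of n]]] by (simp add: diffC)
      also have "\<dots> < c * (5 * e')"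
        using FL[OF G(1)[of m] G(1)[of n]] M1[of m] M1[of n] M2[of m n] that c
        by (intro mult_strict_left_mono) auto
      also have "\<dots> = e" using c by (simp add: e'_def)
      finally show ?thesis .
    qed
    then show "\<exists>M. \<forall>m\<ge>M. \<forall>n\<ge>M. L2_norm_sq (\<lambda>k. cosh_mult b (G m) k - cosh_mult b (G n) k) < e" by blast
  qed blast
  define g0 where "g0 k = u k / of_real (2 * cosh (pi * b * k))" for k
  have ug: "cosh_mult b g0 = u"
    by (intro ext) (simp add: cosh_mult_def g0_def)
  then have g0: "g0 \<in> energy_dom b" using energy_dom_I_cosh(1)[of b g0] u(1) by simp
  define d where "d n = (\<lambda>k. G n k - g0 k)" for n
  have dE: "d n \<in> energy_dom b" for n unfolding d_def by (intro energy_dom_diff G g0)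
  have dC: "(\<lambda>n. L2_norm_sq (cosh_mult b (d n))) \<longlonglongrightarrow> 0"
    using u(2) by (simp add: d_def diffC ug)
  have dC2: "cosh_mult b (d n) \<in> L2" for n using dE by (simp add: energy_dom_iff)
  have Fd: "?F (d n) \<le> (s + 2 + K) * L2_norm_sq (cosh_mult b (d n))" for n
  proof -
    let ?X = "L2_norm_sq (cosh_mult b (d n))"
    note X = energy_dom_I_cosh(2,3)[OF dC2[of n]]
    have "?F (d n) \<le> s * L2_norm_sq (d n) + 2 * L2_norm_sq (sinh_mult b (d n)) + K * L2_norm_sq (d n)"
      using potK[OF dE[of n]] L2_norm_sq_nonneg[of "sinh_mult b (d n)"]
      unfolding shifted_form_def by linarith
    also have "\<dots> \<le> s * ?X + 2 * ?X + K * ?X"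
      using X s K(1) by (intro add_mono mult_left_mono) auto
    finally show ?thesis by (simp add: algebra_simps)
  qed
  have "?F g0 \<le> 0"
  proof (rule tendsto_lowerbound)
    show "(\<lambda>n. 2 * ?F (G n) + 2 * ((s + 2 + K) * L2_norm_sq (cosh_mult b (d n)))) \<longlonglongrightarrow> 0"
      using tendsto_add[OF tendsto_mult_left[OF GF, of 2]
          tendsto_mult_left[OF tendsto_mult_left[OF dC, of "s + 2 + K"], of 2]] by simp
    show "\<forall>\<^sub>F n in sequentially. ?F g0 \<le> 2 * ?F (G n) + 2 * ((s + 2 + K) * L2_norm_sq (cosh_mult b (d n)))"
    proof (intro always_eventually allI)
      fix n
      show "?F g0 \<le> 2 * ?F (G n) + 2 * ((s + 2 + K) * L2_norm_sq (cosh_mult b (d n)))"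
        using FL[OF G(1)[of n] dE[of n]] Fd[of n] by (simp add: d_def)
    qed
  qed simp
  then have F0: "?F g0 = 0" using nonneg[OF g0] by simp
  have "1 \<le> 2 * L2_norm_sq g0"
  proof (rule tendsto_lowerbound)
    show "(\<lambda>n. 2 * L2_norm_sq (cosh_mult b (d n)) + 2 * L2_norm_sq g0) \<longlonglongrightarrow> 2 * L2_norm_sq g0"
      using tendsto_add[OF tendsto_mult_left[OF dC, of 2] tendsto_const[of "2 * L2_norm_sq g0"]] by simp
    show "\<forall>\<^sub>F n in sequentially. 1 \<le> 2 * L2_norm_sq (cosh_mult b (d n)) + 2 * L2_norm_sq g0"
    proof (intro always_eventually allI)
      fix n
      show "1 \<le> 2 * L2_norm_sq (cosh_mult b (d n)) + 2 * L2_norm_sq g0"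
        using L2_norm_sq_add_le[OF energy_dom_L2[OF dE[of n]] energy_dom_L2[OF g0]]
          energy_dom_I_cosh(2)[OF dC2[of n]] G(2)[of n] by (simp add: d_def)
    qed
  qed simp
  then show thesis using that[OF g0 _ F0] by linarith
qed

text \<open>Take for \<open>s\<close> the supremum of the Rayleigh quotients \<open>(potential - kinetic) / norm\<close>, finite by form
  boundedness and positive by the test function. Then the shifted form is nonnegative, its infimum 0
  over the unit sphere is attained, and the minimiser solves the Euler--Lagrange equation.\<close>

theorem minimiser_exists:
  assumes b: "b > 0" and V: "integrable lborel V"
    and g1: "g1 \<in> energy_dom b" "L2_norm_sq g1 > 0" and neg: "L2_norm_sq (sinh_mult b g1) < pot V g1"
  obtains s g0 where "s \<ge> (pot V g1 - L2_norm_sq (sinh_mult b g1)) / L2_norm_sq g1"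
    "g0 \<in> energy_dom b" "L2_norm_sq g0 > 0" "\<And>h. h \<in> energy_dom b \<Longrightarrow> shifted_sesq b s V h g0 = 0"
proof -
  define R where "R g = (pot V g - L2_norm_sq (sinh_mult b g)) / L2_norm_sq g" for g
  define X where "X = R ` {g \<in> energy_dom b. L2_norm_sq g > 0}"
  define s where "s = Sup X"
  obtain K where K: "K \<ge> 0" "\<And>g. g \<in> energy_dom b \<Longrightarrow>
      pot (\<lambda>x. \<bar>V x\<bar>) g \<le> L2_norm_sq (sinh_mult b g) / 2 + K * L2_norm_sq g"
    by (rule pot_form_bounded[OF b V]) blast
  have RK: "R g \<le> K" if g: "g \<in> energy_dom b" "L2_norm_sq g > 0" for g
  proof -
    have "pot V g - L2_norm_sq (sinh_mult b g) \<le> K * L2_norm_sq g"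
      using pot_le_abs[OF V energy_dom_integrable[OF b g(1)]] K(2)[OF g(1)]
        L2_norm_sq_nonneg[of "sinh_mult b g"] by linarith
    then show ?thesis using g(2) by (simp add: R_def divide_le_eq)
  qed
  have bdd: "bdd_above X" unfolding X_def by (rule bdd_aboveI2[of _ _ K]) (use RK in auto)
  have Rs: "R g \<le> s" if "g \<in> energy_dom b" "L2_norm_sq g > 0" for g
    unfolding s_def by (rule cSup_upper[OF _ bdd]) (use that in \<open>auto simp: X_def\<close>)
  have "R g1 > 0" using neg g1 by (simp add: R_def)
  then have s: "s > 0" using Rs[OF g1] by linarith
  have FR: "shifted_form b s V g = (s - R g) * L2_norm_sq g" if "L2_norm_sq g > 0" for g s
    using that by (simp add: shifted_form_def R_def field_simps)
  have nonneg: "0 \<le> shifted_form b s V g" if g: "g \<in> energy_dom b" for g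
  proof (cases "L2_norm_sq g > 0")
    case True
    then show ?thesis using FR[OF True, of s] Rs[OF g True] by simp
  next
    case False
    then have "L2_norm_sq g = 0" using L2_norm_sq_nonneg[of g] by simp
    then have z: "AE k in lborel. g k = 0" by (rule L2_norm_sq_eq_0[OF energy_dom_L2[OF g]])
    then have "ft g = ft (\<lambda>_. 0)"
      by (intro ft_cong_AE L2_measurable[OF energy_dom_L2[OF g]]) auto
    then have "pot V g = 0" by (simp add: pot_def ift_def ft_def)
    then show ?thesis using s by (simp add: shifted_form_def)
  qed
  have "\<exists>g. g \<in> energy_dom b \<and> L2_norm_sq g = 1 \<and> shifted_form b s V g < inverse (real (Suc n))" for n
  proof -
    have "X \<noteq> {}" using g1 by (auto simp: X_def)
    then obtain g where g: "g \<in> energy_dom b" "L2_norm_sq g > 0" "s - inverse (real (Suc n)) < R g"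
      using less_cSup_iff[OF _ bdd, of "s - inverse (real (Suc n))"] unfolding s_def X_def by auto
    define a where "a = complex_of_real (1 / sqrt (L2_norm_sq g))"
    have a: "(cmod a)\<^sup>2 = 1 / L2_norm_sq g"
      using g(2) by (simp add: a_def norm_divide power_divide)
    have "L2_norm_sq (\<lambda>k. a * g k) = 1" "shifted_form b s V (\<lambda>k. a * g k) < inverse (real (Suc n))"
      unfolding L2_norm_sq_scale shifted_form_scale a using g FR[OF g(2), of s] by simp_all
    then show ?thesis using energy_dom_cmult[OF g(1), of a] by blast
  qed
  then obtain g where g: "\<And>n. g n \<in> energy_dom b" "\<And>n. L2_norm_sq (g n) = 1"
    "\<And>n. shifted_form b s V (g n) < inverse (real (Suc n))"
    by metis
  have lim: "(\<lambda>n. shifted_form b s V (g n)) \<longlonglongrightarrow> 0"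
    by (rule tendsto_sandwich[OF _ _ tendsto_const LIMSEQ_inverse_real_of_nat])
       (use nonneg[OF g(1)] less_imp_le[OF g(3)] in \<open>auto intro!: always_eventually\<close>)
  obtain g0 where g0: "g0 \<in> energy_dom b" "L2_norm_sq g0 > 0" "shifted_form b s V g0 = 0"
    by (rule shifted_form_zero_attained[OF b V s nonneg g(1,2) lim])
  show thesis
  proof (rule that[of s g0])
    show "s \<ge> (pot V g1 - L2_norm_sq (sinh_mult b g1)) / L2_norm_sq g1"
      using Rs[OF g1] by (simp add: R_def)
    fix h assume h: "h \<in> energy_dom b"
    show "shifted_sesq b s V h g0 = 0"
    proof (rule quadratic_form_minimum_stationary)
      fix c
      show "0 \<le> 2 * Re (cnj c * shifted_sesq b s V h g0) + (cmod c)\<^sup>2 * shifted_form b s V h"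
        using nonneg[OF energy_dom_lincomb[OF g0(1) h, of c]] shifted_form_expand[OF b V g0(1) h, of s c] g0(3)
        by linarith
    qed
  qed (use g0 in auto)
qed

section \<open>From minimisers to eigenvalues\<close>

lemma L2_inner_cong_AE:
  assumes "f \<in> borel_measurable borel" "f' \<in> borel_measurable borel"
    "h \<in> borel_measurable borel" "h' \<in> borel_measurable borel"
    "AE x in lborel. f x = f' x" "AE x in lborel. h x = h' x"
  shows "L2_inner f h = L2_inner f' h'"
  unfolding L2_inner_def
proof (rule integral_cong_AE)
  show "AE x in lborel. cnj (f x) * h x = cnj (f' x) * h' x"
    using assms(5,6) by eventually_elim simp
qed (use assms borel_measurable_cnj in auto)

text \<open>Polarisation of Plancherel's theorem.\<close>

lemma Parseval:
  assumes f: "f \<in> L2" and h: "h \<in> L2"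
  shows "L2_inner (fourier f) (fourier h) = L2_inner f h"
proof -
  note [measurable] = fourier_measurable[OF f] fourier_measurable[OF h]
    fourier_measurable[OF L2_lincomb[OF h f]]
  have "Re (cnj c * L2_inner (fourier f) (fourier h)) = Re (cnj c * L2_inner f h)" for c
  proof -
    have "L2_norm_sq (\<lambda>k. fourier h k + c * fourier f k) = L2_norm_sq (fourier (\<lambda>x. h x + c * f x))"
      by (rule L2_norm_sq_cong_AE[symmetric]) (use fourier_lincomb[OF h f, of c] in auto)
    also have "\<dots> = L2_norm_sq (\<lambda>x. h x + c * f x)"
      by (rule Plancherel[OF L2_lincomb[OF h f]])
    finally show ?thesis
      unfolding L2_norm_sq_expand[OF h f] L2_norm_sq_expand[OF fourier_L2(1)[OF h] fourier_L2(1)[OF f]]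
        Plancherel[OF f] Plancherel[OF h] by linarith
  qed
  from this[of 1] this[of \<i>] show ?thesis by (simp add: complex_eq_iff)
qed

lemma form_dom_iff: "\<psi> \<in> form_dom b \<longleftrightarrow> \<psi> \<in> L2 \<and> fourier \<psi> \<in> energy_dom b"
  using fourier_L2(1) by (auto simp: form_dom_def energy_dom_def)

lemma ift_L2: "g \<in> L2 \<Longrightarrow> integrable lborel g \<Longrightarrow> ift g \<in> L2"
  unfolding ift_def[abs_def] by (intro L2_uminus_arg ft_L2)

text \<open>Together with \<open>ift_fourier\<close>, this makes \<open>ift\<close> and \<open>fourier\<close> mutually inverse bijections, up to
  null sets, between the energy space and the form domain.\<close>

lemma fourier_ift:
  assumes g: "g \<in> L2" "integrable lborel g"
  shows "AE k in lborel. fourier (ift g) k = g k"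
proof -
  have "AE x in lborel. ift g x = fourier g (- x)"
    using AE_lborel_uminus[OF fourier_eq_ft[OF g]] by eventually_elim (simp add: ift_def)
  then have "fourier (ift g) = fourier (\<lambda>x. fourier g (- x))"
    by (intro fourier_cong_AE L2_measurable[OF ift_L2[OF g]] L2_measurable[OF L2_uminus_arg(1)[OF fourier_L2(1)[OF g(1)]]])
  moreover have "AE k in lborel. fourier (\<lambda>x. fourier g (- x)) k = fourier (fourier g) (- k)"
    by (rule fourier_uminus[OF fourier_L2(1)[OF g(1)]])
  moreover have "AE k in lborel. fourier (fourier g) (- k) = g k"
    using AE_lborel_uminus[OF fourier_inversion[OF g(1)]] by simp
  ultimately show ?thesis by auto
qed

lemma ift_fourier:
  assumes \<phi>: "\<phi> \<in> L2" "integrable lborel (fourier \<phi>)"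
  shows "AE x in lborel. ift (fourier \<phi>) x = \<phi> x"
  using AE_lborel_uminus[OF fourier_eq_ft[OF fourier_L2(1)[OF \<phi>(1)] \<phi>(2)]]
    AE_lborel_uminus[OF fourier_inversion[OF \<phi>(1)]]
  by eventually_elim (simp add: ift_def)

lemma ift_form_dom:
  assumes b: "b > 0" and g: "g \<in> energy_dom b"
  shows "ift g \<in> form_dom b"
proof -
  note gi = energy_dom_L2[OF g] energy_dom_integrable[OF b g]
  have m: "fourier (ift g) \<in> borel_measurable borel"
    by (rule fourier_measurable[OF ift_L2[OF gi]])
  have "(\<lambda>k. of_real (2 * cosh (pi * b * k)) * fourier (ift g) k) \<in> L2"
  proof (rule L2_cong_AE)
    show "(\<lambda>k. of_real (2 * cosh (pi * b * k)) * g k) \<in> L2" using g by (simp add: energy_dom_def)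
    show "AE k in lborel. of_real (2 * cosh (pi * b * k)) * g k = of_real (2 * cosh (pi * b * k)) * fourier (ift g) k"
      using fourier_ift[OF gi] by eventually_elim simp
  qed (use m in measurable)
  then show ?thesis using ift_L2[OF gi] by (simp add: form_dom_def)
qed

text \<open>Thus the eigenvalue equation at \<open>\<mu>\<close> is the Euler--Lagrange equation for the shift \<open>2 - \<mu>\<close>.\<close>

lemma sesq_fourier_side:
  assumes b: "b > 0" and V: "integrable lborel V" and \<phi>: "\<phi> \<in> form_dom b" and g: "g \<in> energy_dom b"
  shows "sesq b V \<phi> (ift g) = of_real \<mu> * L2_inner \<phi> (ift g) + shifted_sesq b (2 - \<mu>) V (fourier \<phi>) g"
proof -
  let ?h = "fourier \<phi>"
  have h: "\<phi> \<in> L2" "?h \<in> energy_dom b" using \<phi> by (simp_all add: form_dom_iff)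
  note gi = energy_dom_L2[OF g] energy_dom_integrable[OF b g]
  note hi = energy_dom_L2[OF h(2)] energy_dom_integrable[OF b h(2)]
  note [measurable] = L2_measurable[OF h(1)] L2_measurable[OF hi(1)] L2_measurable[OF gi(1)]
    L2_measurable[OF ift_L2[OF gi]] L2_measurable[OF ift_L2[OF hi]] fourier_measurable[OF ift_L2[OF gi]]
    borel_measurable_integrable[OF V]
  have [measurable]: "sinh_mult b u \<in> borel_measurable borel" if "u \<in> borel_measurable borel" for u
    unfolding sinh_mult_def[abs_def] using that by measurable
  have inner: "L2_inner \<phi> (ift g) = L2_inner ?h g"
    unfolding Parseval[OF h(1) ift_L2[OF gi], symmetric]
    by (rule L2_inner_cong_AE) (use fourier_ift[OF gi] in auto)
  have sm: "(\<lambda>k. of_real (2 * sinh (pi * b * k)) * u k) = sinh_mult b u" for u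
    by (simp add: sinh_mult_def[abs_def])
  have kin: "L2_inner (\<lambda>k. of_real (2 * sinh (pi * b * k)) * ?h k)
        (\<lambda>k. of_real (2 * sinh (pi * b * k)) * fourier (ift g) k)
      = L2_inner (sinh_mult b ?h) (sinh_mult b g)"
    unfolding sm
  proof (rule L2_inner_cong_AE)
    show "AE k in lborel. sinh_mult b (fourier (ift g)) k = sinh_mult b g k"
      using fourier_ift[OF gi] by eventually_elim (simp add: sinh_mult_def)
  qed auto
  have pot: "(LINT x|lborel. of_real (V x) * (cnj (\<phi> x) * ift g x))
      = (LINT x|lborel. of_real (V x) * (cnj (ift ?h x) * ift g x))"
  proof (rule integral_cong_AE)
    show "AE x in lborel. of_real (V x) * (cnj (\<phi> x) * ift g x) = of_real (V x) * (cnj (ift ?h x) * ift g x)"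
      using ift_fourier[OF h(1) hi(2)] by eventually_elim simp
    show "(\<lambda>x. of_real (V x) * (cnj (\<phi> x) * ift g x) :: complex) \<in> borel_measurable lborel"
      by measurable
    show "(\<lambda>x. of_real (V x) * (cnj (ift ?h x) * ift g x) :: complex) \<in> borel_measurable lborel"
      using borel_measurable_integrable[OF pot_integrable[OF V gi(2) hi(2)]] .
  qed
  show ?thesis
    unfolding sesq_def kin pot inner shifted_sesq_def by (simp add: algebra_simps)
qed

text \<open>The variational principle: the Rayleigh quotient of any test function that is below 2 bounds an
  eigenvalue from above.\<close>

theorem eigenvalue_from_test_function:
  assumes b: "b > 0" and V: "integrable lborel V"
    and g1: "g1 \<in> energy_dom b" "L2_norm_sq g1 > 0" and neg: "L2_norm_sq (sinh_mult b g1) < pot V g1"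
  obtains \<mu> where "\<mu> \<le> 2 - (pot V g1 - L2_norm_sq (sinh_mult b g1)) / L2_norm_sq g1" "eigenvalue b V \<mu>"
proof -
  obtain s g0 where s: "s \<ge> (pot V g1 - L2_norm_sq (sinh_mult b g1)) / L2_norm_sq g1"
    and g0: "g0 \<in> energy_dom b" "L2_norm_sq g0 > 0" "\<And>h. h \<in> energy_dom b \<Longrightarrow> shifted_sesq b s V h g0 = 0"
    by (rule minimiser_exists[OF b V g1 neg]) blast
  note gi = energy_dom_L2[OF g0(1)] energy_dom_integrable[OF b g0(1)]
  let ?\<mu> = "2 - s"
  have "ift g0 \<in> eigenspace b V ?\<mu>"
    unfolding eigenspace_def W_def
  proof (clarsimp, intro conjI ballI)
    show "ift g0 \<in> form_dom b" by (rule ift_form_dom[OF b g0(1)])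
    show "(\<lambda>x. (2 - complex_of_real s) * ift g0 x) \<in> L2" by (rule L2_cmult[OF ift_L2[OF gi]])
    fix \<phi> assume \<phi>: "\<phi> \<in> form_dom b"
    have "shifted_sesq b s V (fourier \<phi>) g0 = 0" using \<phi> g0(3) by (simp add: form_dom_iff)
    moreover have "L2_inner \<phi> (\<lambda>x. (2 - complex_of_real s) * ift g0 x) = (2 - complex_of_real s) * L2_inner \<phi> (ift g0)"
      unfolding L2_inner_def mult.left_commute[of "cnj _"] by (rule integral_mult_right_zero)
    ultimately show "sesq b V \<phi> (ift g0) = L2_inner \<phi> (\<lambda>x. (2 - complex_of_real s) * ift g0 x)"
      using sesq_fourier_side[OF b V \<phi> g0(1), of ?\<mu>] by simp
  qed
  moreover have "\<not> (AE x in lborel. ift g0 x = 0)"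
  proof
    assume "AE x in lborel. ift g0 x = 0"
    then have "L2_norm_sq (ift g0) = L2_norm_sq (\<lambda>_. 0)"
      by (intro L2_norm_sq_cong_AE L2_measurable[OF ift_L2[OF gi]]) auto
    moreover have "L2_norm_sq (ift g0) = L2_norm_sq g0"
      unfolding Plancherel[OF ift_L2[OF gi], symmetric]
      by (intro L2_norm_sq_cong_AE fourier_ift[OF gi] fourier_measurable[OF ift_L2[OF gi]] L2_measurable[OF gi(1)])
    ultimately show False using g0(2) by (simp add: L2_norm_sq_def)
  qed
  ultimately have "eigenvalue b V ?\<mu>" unfolding eigenvalue_def by blast
  then show thesis using that[of ?\<mu>] s by simp
qed

section \<open>Test functions\<close>

text \<open>The inverse transform of this function is \<open>sin (2\<pi> d x) / (2\<pi> d x)\<close>, which approaches the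
  constant 1 (the threshold resonance of the free operator) as \<open>d \<rightarrow> 0\<close>.\<close>

definition plateau :: "real \<Rightarrow> real \<Rightarrow> complex" where
  "plateau d k = of_real (1 / (2 * d)) * indicator {- d..d} k"

lemma plateau_L2: "plateau d \<in> L2"
  unfolding plateau_def[abs_def] by (intro L2_cmult interval_indicator_L2)

lemma integral_plateau_norm:
  assumes d: "d > 0"
  shows "integrable lborel (plateau d)" "(LINT k|lborel. cmod (plateau d k)) = 1" "(LINT k|lborel. plateau d k) = 1"
    "L2_norm_sq (plateau d) = 1 / (2 * d)"
proof -
  show i: "integrable lborel (plateau d)"
    unfolding plateau_def[abs_def] by (intro integrable_mult_right interval_indicator_integrable)
  have I: "(LINT k|lborel. indicator {-d..d} k :: real) = 2 * d" using d by simp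
  have c: "plateau d k = of_real (1 / (2 * d) * indicator {-d..d} k)" for k
    by (simp add: plateau_def indicator_def)
  have n: "cmod (plateau d k) = 1 / (2 * d) * indicator {-d..d} k" for k
    using d unfolding c norm_of_real by simp
  show "(LINT k|lborel. cmod (plateau d k)) = 1"
    unfolding n integral_mult_right_zero I using d by simp
  show "(LINT k|lborel. plateau d k) = 1"
    unfolding c integral_complex_of_real integral_mult_right_zero I using d by simp
  have sq: "(1 / (2 * d) * indicator {-d..d} k)\<^sup>2 = (1 / (2 * d))\<^sup>2 * indicator {-d..d} k" for k
    by (simp add: power2_eq_square indicator_def)
  show "L2_norm_sq (plateau d) = 1 / (2 * d)"
    unfolding L2_norm_sq_def n sq integral_mult_right_zero I using d by (simp add: power2_eq_square)
qed

lemma plateau_weighted: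
  assumes d: "d > 0" and m: "m \<in> borel_measurable borel"
    and le: "\<And>k. \<bar>k\<bar> \<le> d \<Longrightarrow> \<bar>m k\<bar> \<le> C"
  shows "(\<lambda>k. of_real (m k) * plateau d k) \<in> L2" "L2_norm_sq (\<lambda>k. of_real (m k) * plateau d k) \<le> C\<^sup>2 / (2 * d)"
proof -
  have C: "C \<ge> 0" using le[of 0] d abs_ge_zero[of "m 0"] by linarith
  let ?m = "\<lambda>k. complex_of_real (m k) * indicator {-d..d} k"
  have eq: "(\<lambda>k. of_real (m k) * plateau d k) = (\<lambda>k. ?m k * plateau d k)"
    by (auto simp: plateau_def indicator_def)
  have mm: "?m \<in> borel_measurable borel" using m by measurable
  have mb: "cmod (?m k) \<le> C" for k
    using le[of k] C by (auto simp: indicator_def norm_mult)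
  show "(\<lambda>k. of_real (m k) * plateau d k) \<in> L2"
    unfolding eq by (rule L2_mult_bounded(1)[OF plateau_L2 mm mb])
  show "L2_norm_sq (\<lambda>k. of_real (m k) * plateau d k) \<le> C\<^sup>2 / (2 * d)"
    using L2_mult_bounded(2)[OF plateau_L2[of d] mm mb] unfolding eq integral_plateau_norm(4)[OF d] by simp
qed

lemma cosh_mono_abs: "\<bar>x\<bar> \<le> y \<Longrightarrow> cosh x \<le> cosh (y :: real)"
  by (metis abs_ge_zero cosh_real_abs cosh_real_nonneg_le_iff order_trans)

lemma abs_sinh_le_mult_cosh: 
  assumes "\<bar>t\<bar> \<le> y"
  shows "\<bar>sinh t\<bar> \<le> y * cosh (y :: real)"
proof -
  have y: "y \<ge> 0" using assms by linarith
  have "\<bar>sinh t\<bar> = sinh \<bar>t\<bar>" by simp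
  also have "\<dots> \<le> sinh y" using assms by (simp only: sinh_real_le_iff)
  also have "\<dots> \<le> y * cosh y"
  proof (cases "y = 0")
    case False
    then have "0 < y" using y by simp
    then obtain z where z: "0 < z" "z < y" "sinh y - sinh 0 = (y - 0) * cosh z"
      using MVT2[of 0 y sinh cosh] has_field_derivative_sinh[OF DERIV_ident] by auto
    then show ?thesis using y by (simp add: mult_left_mono cosh_mono_abs)
  qed simp
  finally show ?thesis .
qed

lemma plateau_energy_dom: 
  assumes b: "b > 0" and d: "d > 0"
  shows "plateau d \<in> energy_dom b"
proof -
  have "\<bar>2 * cosh (pi * b * k)\<bar> \<le> 2 * cosh (pi * b * d)" if "\<bar>k\<bar> \<le> d" for k
    using that b by (simp add: cosh_mono_abs abs_mult)
  from plateau_weighted(1)[OF d _ this] show ?thesis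
    using plateau_L2 by (simp add: energy_dom_def)
qed

text \<open>The constant that \<open>\<bar>sinh t\<bar> \<le> \<pi> b d cosh (\<pi> b)\<close> for \<open>\<bar>t\<bar> \<le> \<pi> b d\<close>, \<open>d \<le> 1\<close>, yields for the
  kinetic energy.\<close>

definition plateau_rate :: "real \<Rightarrow> real" where
  "plateau_rate b = 2 * (pi * b * cosh (pi * b))\<^sup>2"

lemma plateau_rate_pos: "b > 0 \<Longrightarrow> plateau_rate b > 0"
  by (simp add: plateau_rate_def)

lemma plateau_kinetic_le:
  assumes b: "b > 0" and d: "0 < d" "d \<le> 1"
  shows "L2_norm_sq (sinh_mult b (plateau d)) \<le> plateau_rate b * d"
proof -
  have "\<bar>2 * sinh (pi * b * k)\<bar> \<le> 2 * (pi * b * d * cosh (pi * b))" if "\<bar>k\<bar> \<le> d" for k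
  proof -
    have "\<bar>sinh (pi * b * k)\<bar> \<le> pi * b * d * cosh (pi * b * d)"
      by (rule abs_sinh_le_mult_cosh) (use that b in \<open>simp add: abs_mult\<close>)
    also have "\<dots> \<le> pi * b * d * cosh (pi * b)"
      using b d by (intro mult_left_mono cosh_mono_abs) (simp_all add: abs_mult mult_left_le)
    finally show ?thesis by simp
  qed
  from plateau_weighted(2)[OF d(1) _ this]
  have "L2_norm_sq (sinh_mult b (plateau d)) \<le> (2 * (pi * b * d * cosh (pi * b)))\<^sup>2 / (2 * d)"
    unfolding sinh_mult_def[abs_def] by simp
  also have "\<dots> = plateau_rate b * d"
    using d by (simp add: plateau_rate_def power2_eq_square field_simps)
  finally show ?thesis .
qed

lemma ift_plateau:
  assumes d: "d > 0"
  shows "cmod (ift (plateau d) x) \<le> 1" "cmod (ift (plateau d) x - 1) \<le> 2 * pi * \<bar>x\<bar> * d"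
proof -
  note B = integral_plateau_norm[OF d]
  show "cmod (ift (plateau d) x) \<le> 1" using ift_bound[OF B(1), of x] B(2) by simp
  let ?E = "\<lambda>s k. exp (- 2 * complex_of_real pi * \<i> * of_real s * of_real k)"
  have i: "integrable lborel (\<lambda>k. (?E (- x) k - ?E 0 k) * plateau d k)"
    unfolding left_diff_distrib
    by (intro Bochner_Integration.integrable_diff integrable_character_mult B)
  have "ift (plateau d) x - 1 = (LINT k|lborel. (?E (- x) k - ?E 0 k) * plateau d k)"
    unfolding left_diff_distrib ift_def ft_def
    by (subst Bochner_Integration.integral_diff[OF integrable_character_mult[OF B(1)] integrable_character_mult[OF B(1)]])
       (simp add: B(3))
  then have "cmod (ift (plateau d) x - 1) \<le> (LINT k|lborel. cmod ((?E (- x) k - ?E 0 k) * plateau d k))"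
    using integral_norm_bound[of lborel "\<lambda>k. (?E (- x) k - ?E 0 k) * plateau d k"] by simp
  also have "\<dots> \<le> (LINT k|lborel. 2 * pi * \<bar>x\<bar> * d * cmod (plateau d k))"
  proof (rule integral_mono)
    fix k
    show "cmod ((?E (- x) k - ?E 0 k) * plateau d k) \<le> 2 * pi * \<bar>x\<bar> * d * cmod (plateau d k)"
    proof (cases "\<bar>k\<bar> \<le> d")
      case True
      have "cmod (?E (- x) k - ?E 0 k) \<le> 2 * pi * \<bar>x\<bar> * \<bar>k\<bar>"
        using cmod_character_diff_le[of "- x" k 0] by simp
      also have "\<dots> \<le> 2 * pi * \<bar>x\<bar> * d" by (intro mult_left_mono True) simp
      finally show ?thesis unfolding norm_mult by (rule mult_right_mono) simp
    next
      case False
      then have "plateau d k = 0" by (auto simp: plateau_def indicator_def)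
      then show ?thesis by simp
    qed
  qed (intro integrable_norm i integrable_mult_right B)+
  also have "\<dots> = 2 * pi * \<bar>x\<bar> * d" by (simp only: integral_mult_right_zero B(2) mult_1_right)
  finally show "cmod (ift (plateau d) x - 1) \<le> 2 * pi * \<bar>x\<bar> * d" .
qed

text \<open>As \<open>d \<rightarrow> 0\<close> the kinetic energy of the plateau function vanishes, while its potential energy tends
  to the integral of \<open>V\<close>.\<close>

lemma eigenvalue_below_2:
  assumes b: "b > 0" and V: "integrable lborel V" and pos: "(LINT x|lborel. V x) > 0"
  shows "\<exists>\<mu><2. eigenvalue b V \<mu>"
proof -
  let ?d = "\<lambda>n. inverse (real (Suc n))"
  have d: "?d n > 0" "?d n \<le> 1" for n by (simp_all add: inverse_le_1_iff)
  have d0: "?d \<longlonglongrightarrow> 0" by (rule LIMSEQ_inverse_real_of_nat)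
  note [measurable] = borel_measurable_integrable[OF V]
  have [measurable]: "ift (plateau (?d n)) \<in> borel_measurable borel" for n
    by (rule ift_measurable[OF L2_measurable[OF plateau_L2]])
  have "(\<lambda>n. pot V (plateau (?d n))) \<longlonglongrightarrow> (LINT x|lborel. V x)"
    unfolding pot_def
  proof (rule integral_dominated_convergence)
    show "integrable lborel (\<lambda>x. \<bar>V x\<bar>)" using V by simp
    show "AE x in lborel. (\<lambda>n. V x * (cmod (ift (plateau (?d n)) x))\<^sup>2) \<longlonglongrightarrow> V x"
    proof (intro AE_I2)
      fix x
      have "(\<lambda>n. 2 * pi * \<bar>x\<bar> * ?d n) \<longlonglongrightarrow> 0"
        using tendsto_mult_left[OF d0, of "2 * pi * \<bar>x\<bar>"] by simp
      then have "(\<lambda>n. ift (plateau (?d n)) x - 1) \<longlonglongrightarrow> 0"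
        by (rule Lim_null_comparison[rotated]) (use ift_plateau(2)[OF d(1)] in \<open>auto intro!: always_eventually\<close>)
      then have "(\<lambda>n. ift (plateau (?d n)) x) \<longlonglongrightarrow> 1" by (simp only: LIM_zero_iff)
      then have "(\<lambda>n. V x * (cmod (ift (plateau (?d n)) x))\<^sup>2) \<longlonglongrightarrow> V x * (cmod 1)\<^sup>2"
        by (intro tendsto_intros)
      then show "(\<lambda>n. V x * (cmod (ift (plateau (?d n)) x))\<^sup>2) \<longlonglongrightarrow> V x" by simp
    qed
    show "AE x in lborel. norm (V x * (cmod (ift (plateau (?d n)) x))\<^sup>2) \<le> \<bar>V x\<bar>" for n
      using ift_plateau(1)[OF d(1)[of n]]
      by (intro AE_I2) (simp add: abs_mult mult_left_le power_le_one)
  qed measurable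
  moreover have "(\<lambda>n. L2_norm_sq (sinh_mult b (plateau (?d n)))) \<longlonglongrightarrow> 0"
  proof (rule tendsto_sandwich[OF _ _ tendsto_const])
    show "(\<lambda>n. plateau_rate b * ?d n) \<longlonglongrightarrow> 0" using tendsto_mult_left[OF d0, of "plateau_rate b"] by simp
  qed (use plateau_kinetic_le[OF b d] in \<open>auto intro!: always_eventually\<close>)
  ultimately have "(\<lambda>n. pot V (plateau (?d n)) - L2_norm_sq (sinh_mult b (plateau (?d n)))) \<longlonglongrightarrow> (LINT x|lborel. V x) - 0"
    by (rule tendsto_diff)
  then have "\<forall>\<^sub>F n in sequentially. pot V (plateau (?d n)) - L2_norm_sq (sinh_mult b (plateau (?d n))) > 0"
    using pos by (intro order_tendstoD) auto
  then obtain n where n: "pot V (plateau (?d n)) - L2_norm_sq (sinh_mult b (plateau (?d n))) > 0"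
    by (auto simp: eventually_sequentially)
  have N: "L2_norm_sq (plateau (?d n)) > 0" using integral_plateau_norm(4)[OF d(1)[of n]] d(1)[of n] by simp
  obtain \<mu> where "\<mu> \<le> 2 - (pot V (plateau (?d n)) - L2_norm_sq (sinh_mult b (plateau (?d n)))) / L2_norm_sq (plateau (?d n))"
    "eigenvalue b V \<mu>"
    using eigenvalue_from_test_function[OF b V plateau_energy_dom[OF b d(1)] N] n by auto
  moreover have "(pot V (plateau (?d n)) - L2_norm_sq (sinh_mult b (plateau (?d n)))) / L2_norm_sq (plateau (?d n)) > 0"
    using n N by simp
  ultimately show ?thesis by (intro exI[of _ \<mu>]) linarith
qed

section \<open>Weak coupling\<close>

definition well :: "real \<Rightarrow> real \<Rightarrow> real" where
  "well e x = e * indicator {0..1} x"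

lemma well_integrable: "integrable lborel (well e)"
  unfolding well_def[abs_def]
  by (intro integrable_mult_right integrable_real_indicator) (auto simp: emeasure_lborel_Icc_eq)

lemma well_admissible: "e \<ge> 0 \<Longrightarrow> admissible (well e)"
  unfolding admissible_def using well_integrable
  by (auto intro!: AE_I2 exI[of _ "{0..1}"] simp: well_def indicator_def)

lemma well_powr_integral:
  assumes "p > 0"
  shows "(LINT x|lborel. well e x powr p) = e powr p"
proof -
  have "well e x powr p = e powr p * indicator {0..1} x" for x
    by (simp add: well_def indicator_def)
  then show ?thesis by simp
qed

lemma well_W_ge:
  assumes e: "0 \<le> e" "e \<le> 4"
  shows "W_ge b (well e) (- 2)"
  unfolding W_ge_def
proof
  fix \<psi> assume "\<psi> \<in> form_dom b"
  then have \<psi>: "\<psi> \<in> L2" by (simp add: form_dom_def)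
  note [measurable] = L2_measurable[OF \<psi>]
  have le: "well e x * (cmod (\<psi> x))\<^sup>2 \<le> 4 * (cmod (\<psi> x))\<^sup>2" "0 \<le> well e x * (cmod (\<psi> x))\<^sup>2" for x
    using e by (auto simp: well_def indicator_def intro: mult_right_mono)
  have i: "integrable lborel (\<lambda>x. 4 * (cmod (\<psi> x))\<^sup>2)"
    by (intro integrable_mult_right L2_integrable_sq \<psi>)
  have "integrable lborel (\<lambda>x. well e x * (cmod (\<psi> x))\<^sup>2)"
    by (rule Bochner_Integration.integrable_bound[OF i])
       (use le borel_measurable_integrable[OF well_integrable[of e]] in \<open>auto simp: abs_of_nonneg\<close>)
  then have "(LINT x|lborel. well e x * (cmod (\<psi> x))\<^sup>2) \<le> (LINT x|lborel. 4 * (cmod (\<psi> x))\<^sup>2)"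
    by (intro integral_mono i le)
  then have "(LINT x|lborel. well e x * (cmod (\<psi> x))\<^sup>2) \<le> 4 * L2_norm_sq \<psi>"
    by (simp add: L2_norm_sq_def)
  moreover have "0 \<le> (LINT k|lborel. (cmod (of_real (2 * sinh (pi * b * k)) * fourier \<psi> k))\<^sup>2)"
    by (intro Bochner_Integration.integral_nonneg) auto
  ultimately show "- 2 * L2_norm_sq \<psi> \<le> qform b (well e) \<psi>"
    unfolding qform_def by linarith
qed

text \<open>An eigenvalue has multiplicity at least 1, so its term bounds the sum from below.\<close>

lemma eigenvalue_sum_ge:
  assumes "eigenvalue b V \<mu>" "\<mu> \<le> 2"
  shows "eigenvalue_sum b V \<gamma> \<ge> ennreal (\<bar>\<mu> - 2\<bar> powr \<gamma>)"
proof -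
  obtain \<psi> where \<psi>: "\<psi> \<in> eigenspace b V \<mu>" "\<not> (AE x in lborel. \<psi> x = 0)"
    using assms(1) by (auto simp: eigenvalue_def)
  have "ae_independent 1 (\<lambda>_. \<psi>)"
    unfolding ae_independent_def
  proof (intro allI impI)
    fix c :: "nat \<Rightarrow> complex" and i :: nat
    assume "AE x in lborel. (\<Sum>i<1. c i * \<psi> x) = 0" and i: "i < 1"
    then have "AE x in lborel. c 0 = 0 \<or> \<psi> x = 0" by simp
    then have "c 0 = 0" using \<psi>(2) by (cases "c 0 = 0") auto
    then show "c i = 0" using i by simp
  qed
  then have "(of_nat 1 :: ennreal) \<le> multiplicity b V \<mu>"
    unfolding multiplicity_def using \<psi>(1) by (intro Sup_upper) auto
  then have "1 * ennreal (\<bar>\<mu> - 2\<bar> powr \<gamma>) \<le> multiplicity b V \<mu> * ennreal (\<bar>\<mu> - 2\<bar> powr \<gamma>)"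
    by (intro mult_right_mono) auto
  also have "\<dots> \<le> eigenvalue_sum b V \<gamma>"
    unfolding eigenvalue_sum_def using assms
    by (intro nn_integral_ge_point[of \<mu> _ "\<lambda>\<mu>. multiplicity b V \<mu> * ennreal (\<bar>\<mu> - 2\<bar> powr \<gamma>)"]) simp
  finally show ?thesis by simp
qed

text \<open>A well of depth \<open>e\<close> binds with energy of order \<open>e\<^sup>2\<close>. The kinetic energy of the plateau function is
  of order \<open>d\<close> and its potential energy of order \<open>e\<close>, so \<open>d\<close> is a small multiple \<open>\<eta>\<close> of \<open>e\<close>;
  dividing by the squared norm \<open>1 / (2 d)\<close> leaves a gain of order \<open>d e\<close>.\<close>

lemma well_eigenvalue:
  assumes b: "b > 0"
  obtains c where "c > 0" "\<And>e. 0 < e \<Longrightarrow> e \<le> 1 \<Longrightarrow> \<exists>\<mu>. eigenvalue b (well e) \<mu> \<and> \<mu> \<le> 2 - c * e\<^sup>2"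
proof -
  \<comment> \<open>The first bound keeps the plateau function above \<open>1 / 2\<close> on the well, the second keeps the
    kinetic energy below half of the resulting potential energy \<open>e / 4\<close>.\<close>
  define \<eta> where "\<eta> = min (1 / (4 * pi)) (1 / (8 * plateau_rate b))"
  have \<eta>: "\<eta> > 0" "\<eta> \<le> 1 / (4 * pi)" "\<eta> \<le> 1 / (8 * plateau_rate b)"
    using plateau_rate_pos[OF b] by (auto simp: \<eta>_def)
  show thesis
  proof (rule that[of "\<eta> / 4"])
    show "\<eta> / 4 > 0" using \<eta> by simp
    fix e :: real assume e: "0 < e" "e \<le> 1"
    define d where "d = e * \<eta>"
    have d\<eta>: "d \<le> \<eta>" using e \<eta> by (simp add: d_def mult_left_le_one_le)
    have d: "d > 0" "d \<le> 1 / (4 * pi)" using e \<eta> d\<eta> by (simp add: d_def, linarith)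
    have "1 / (4 * pi) \<le> 1" using pi_gt3 by (simp add: field_simps)
    then have d1: "d \<le> 1" using d by linarith
    note B = integral_plateau_norm[OF d(1)]
    have kin: "L2_norm_sq (sinh_mult b (plateau d)) \<le> e / 8"
    proof -
      have "plateau_rate b * d \<le> e * (plateau_rate b * (1 / (8 * plateau_rate b)))"
        unfolding d_def mult.left_commute[of "plateau_rate b" e] using e \<eta> plateau_rate_pos[OF b]
        by (intro mult_left_mono) auto
      also have "\<dots> = e / 8" using plateau_rate_pos[OF b] by simp
      finally show ?thesis using plateau_kinetic_le[OF b d(1) d1] by linarith
    qed
    have half: "cmod (ift (plateau d) x) \<ge> 1 / 2" if x: "x \<in> {0..1}" for x
    proof -
      have "2 * pi * \<bar>x\<bar> * d \<le> 2 * pi * 1 * (1 / (4 * pi))"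
        using x d by (intro mult_mono) auto
      also have "\<dots> = 1 / 2" by simp
      finally have "cmod (ift (plateau d) x - 1) \<le> 1 / 2" using ift_plateau(2)[OF d(1), of x] by linarith
      then show ?thesis using norm_triangle_ineq2[of 1 "1 - ift (plateau d) x"] by (simp add: norm_minus_commute)
    qed
    have pot: "pot (well e) (plateau d) \<ge> e / 4"
    proof -
      have "e / 4 = (LINT x|lborel. well (e / 4) x)" by (simp add: well_def)
      also have "\<dots> \<le> pot (well e) (plateau d)"
        unfolding pot_def
      proof (intro integral_mono well_integrable pot_sq_integrable B)
        fix x :: real
        show "well (e / 4) x \<le> well e x * (cmod (ift (plateau d) x))\<^sup>2"
        proof (cases "x \<in> {0..1}")
          case True
          have "(1 / 2)\<^sup>2 \<le> (cmod (ift (plateau d) x))\<^sup>2" by (intro power_mono half True) auto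
          from mult_left_mono[OF this, of e] show ?thesis
            using True e by (simp add: well_def power2_eq_square)
        qed (simp add: well_def)
      qed
      finally show ?thesis .
    qed
    have N: "L2_norm_sq (plateau d) > 0" using B(4) d by simp
    obtain \<mu> where \<mu>: "\<mu> \<le> 2 - (pot (well e) (plateau d) - L2_norm_sq (sinh_mult b (plateau d))) / L2_norm_sq (plateau d)"
      "eigenvalue b (well e) \<mu>"
      by (rule eigenvalue_from_test_function[OF b well_integrable plateau_energy_dom[OF b d(1)] N])
         (use pot kin e in auto)
    have "\<eta> / 4 * e\<^sup>2 = (e / 8) * (2 * d)" by (simp add: d_def power2_eq_square)
    also have "\<dots> \<le> (pot (well e) (plateau d) - L2_norm_sq (sinh_mult b (plateau d))) * (2 * d)"
      using pot kin d by (intro mult_right_mono) auto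
    also have "\<dots> = (pot (well e) (plateau d) - L2_norm_sq (sinh_mult b (plateau d))) / L2_norm_sq (plateau d)"
      using B(4) d by simp
    finally have "\<mu> \<le> 2 - \<eta> / 4 * e\<^sup>2" using \<mu>(1) by linarith
    then show "\<exists>\<mu>. eigenvalue b (well e) \<mu> \<and> \<mu> \<le> 2 - \<eta> / 4 * e\<^sup>2"
      using \<mu>(2) by blast
  qed
qed

text \<open>For wells of depth \<open>e\<close> the left-hand side is at least of order \<open>e\<^sup>2\<^sup>\<gamma>\<close> and the right-hand side of
  order \<open>e\<close> to the power \<open>\<gamma> + 1/2 > 2\<gamma>\<close>, which is impossible as \<open>e \<rightarrow> 0\<close>. Wells of depth at most 4
  satisfy the lower bound \<open>- 2\<close>, since the kinetic energy is nonnegative.\<close>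

theorem no_Lieb_Thirring_bound:
  assumes b: "b > 0" and \<gamma>: "0 \<le> \<gamma>" "\<gamma> < 1 / 2"
    and bound: "\<And>V. admissible V \<Longrightarrow> W_ge b V (- 2) \<Longrightarrow>
      eigenvalue_sum b V \<gamma> \<le> ennreal (L / b * (LINT x|lborel. V x powr (\<gamma> + 1 / 2)))"
  shows False
proof -
  obtain c where c: "c > 0" "\<And>e. 0 < e \<Longrightarrow> e \<le> 1 \<Longrightarrow> \<exists>\<mu>. eigenvalue b (well e) \<mu> \<and> \<mu> \<le> 2 - c * e\<^sup>2"
    by (rule well_eigenvalue[OF b]) blast
  have le: "c powr \<gamma> \<le> L / b * e powr (1 / 2 - \<gamma>)" if e: "0 < e" "e \<le> 1" for e
  proof -
    obtain \<mu> where \<mu>: "eigenvalue b (well e) \<mu>" "\<mu> \<le> 2 - c * e\<^sup>2" using c(2)[OF e] by blast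
    have ce: "c * e\<^sup>2 > 0" using c e by simp
    have "ennreal ((c * e\<^sup>2) powr \<gamma>) \<le> ennreal (\<bar>\<mu> - 2\<bar> powr \<gamma>)"
      using \<mu> ce \<gamma> by (intro ennreal_leI powr_mono2) auto
    also have "\<dots> \<le> eigenvalue_sum b (well e) \<gamma>"
      using \<mu> ce by (intro eigenvalue_sum_ge) auto
    also have "\<dots> \<le> ennreal (L / b * (LINT x|lborel. well e x powr (\<gamma> + 1 / 2)))"
      using e by (intro bound well_admissible well_W_ge) auto
    also have "\<dots> = ennreal (L / b * e powr (\<gamma> + 1 / 2))"
      using \<gamma> by (subst well_powr_integral) auto
    finally have "(c * e\<^sup>2) powr \<gamma> \<le> L / b * e powr (\<gamma> + 1 / 2)"
      using ce by (subst (asm) ennreal_le_iff2) (auto simp: not_le)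
    moreover have "(c * e\<^sup>2) powr \<gamma> = c powr \<gamma> * e powr (2 * \<gamma>)"
      using c e by (simp add: powr_mult powr_powr flip: powr_numeral)
    moreover have "e powr (\<gamma> + 1 / 2) = e powr (1 / 2 - \<gamma>) * e powr (2 * \<gamma>)"
      by (simp flip: powr_add)
    ultimately have "c powr \<gamma> * e powr (2 * \<gamma>) \<le> (L / b * e powr (1 / 2 - \<gamma>)) * e powr (2 * \<gamma>)"
      by simp
    then show ?thesis using e by (subst (asm) mult_le_cancel_right_pos) auto
  qed
  have "((\<lambda>e. L / b * e powr (1 / 2 - \<gamma>)) \<longlongrightarrow> L / b * 0) (at_right 0)"
    using \<gamma> by (intro tendsto_mult_left tendsto_zero_powrI[OF tendsto_ident_at tendsto_const])
      (auto simp: eventually_at_right_less eventually_at_filter)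
  moreover have "\<forall>\<^sub>F e in at_right 0. c powr \<gamma> \<le> L / b * e powr (1 / 2 - \<gamma>)"
    unfolding eventually_at_right_field by (intro exI[of _ 1] conjI allI impI le) auto
  ultimately have "c powr \<gamma> \<le> L / b * 0"
    by (intro tendsto_lowerbound[of _ _ "at_right 0"]) auto
  then show False using c(1) by simp
qed

theorem theorem1p3:
  fixes b :: real
  assumes "b > 0"
  shows
    "(\<forall>V :: real \<Rightarrow> real. integrable lborel V \<and> (LINT x|lborel. V x) > 0
        \<longrightarrow> (\<exists>\<mu><2. eigenvalue b V \<mu>))
     \<and>
     (\<forall>\<gamma> :: real. 0 \<le> \<gamma> \<and> \<gamma> < 1/2 \<longrightarrow>
        \<not> (\<exists>L :: real. \<forall>V :: real \<Rightarrow> real. admissible V \<longrightarrow>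
              eigenvalue_sum b V \<gamma> \<le> ennreal (L / b * (LINT x|lborel. V x powr (\<gamma> + 1/2)))))
     \<and>
     (\<forall>\<gamma> :: real. 0 \<le> \<gamma> \<and> \<gamma> < 1/2 \<longrightarrow>
        \<not> (\<exists>L :: real. \<forall>V :: real \<Rightarrow> real. admissible V \<and> W_ge b V (-2) \<longrightarrow>
              eigenvalue_sum b V \<gamma> \<le> ennreal (L / b * (LINT x|lborel. V x powr (\<gamma> + 1/2)))))"
  using eigenvalue_below_2[OF assms] no_Lieb_Thirring_bound[OF assms] by blast

end
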